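(* Let $n>1$, let $q\in\Bbbk$ satisfy $q^n=1$ and have multiplicative order $d\ge 2$, and let $\mathcal{C}_q$ be the tensor category of finite dimensional right $\Bbbk\mathcal{Z}(q)$-comodules with its objects $V(i,l)$. Let $e,m\ge 0$ and $0\le f,h\le d-1$ be integers with $ed+f\le md+h$, and set $\gamma=f+h-d+1$. Then the following isomorphisms hold in $\mathcal{C}_q$. (1) If $0\le f\le h$ and $f+h<d-1$, then $$\begin{aligned}V(0,ed+f)\otimes V(0,md+h)\cong{}&\bigoplus_{k=0}^{e-1}\Big[\bigoplus_{i=0}^{f}V(kd+i,(e+m-2k)d+f+h-2i)\oplus\bigoplus_{j=f+1}^{h}V(kd+j,(e+m-2k)d-1)\\&\oplus\bigoplus_{r=h+1}^{f+h+1}V(kd+r,(e+m-2k)d+h+f-2r)\oplus\bigoplus_{s=f+h+2}^{d-1}V(kd+s,(e+m-1-2k)d-1)\Big]\\&\oplus\bigoplus_{i=0}^{f}V(ed+i,(m-e)d+h+f-2i).\end{aligned}$$ (2) If $0<f\le h<d$ and $f+h\ge d$, then $$\begin{aligned}V(0,ed+f)\otimes V(0,md+h)\cong{}&\bigoplus_{k=0}^{e-1}\Big[\bigoplus_{i=0}^{\gamma}V(kd+i,(e+m-2k)d+d-1)\oplus\bigoplus_{j=\gamma+1}^{f}V(kd+j,(e+m-2k)d+f+h-2j)\\&\oplus\bigoplus_{r=f+1}^{h}V(kd+r,(e+m-2k)d-1)\oplus\bigoplus_{s=h+1}^{d-1}V(kd+s,(e+m-2k)d+h+f-2s)\Big]\\&\oplus\bigoplus_{i=0}^{\gamma}V(ed+i,(m-e)d+d-1)\oplus\bigoplus_{i=\gamma+1}^{f}V(ed+i,(m-e)d+f+h-2i).\end{aligned}$$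 (3) If $0\le h<f<d$ and $f+h<d-1$, then $$\begin{aligned}V(0,ed+f)\otimes V(0,md+h)\cong{}&\bigoplus_{k=0}^{e-1}\Big[\bigoplus_{i=0}^{h}V(kd+i,(e+m-2k)d+h+f-2i)\oplus\bigoplus_{j=h+1}^{f}V(kd+j,(e+m-2k)d-1)\\&\oplus\bigoplus_{r=f+1}^{h+f+1}V(kd+r,(e+m-2k)d+h+f-2r)\oplus\bigoplus_{s=f+h+2}^{d-1}V(kd+s,(e+m-1-2k)d-1)\Big]\\&\oplus\bigoplus_{i=0}^{h}V(ed+i,(m-e)d+h+f-2i)\oplus\bigoplus_{i=h+1}^{f}V(ed+i,(m-e)d-1).\end{aligned}$$ (4) If $0<h<f<d$ and $f+h\ge d$, then $$\begin{aligned}V(0,ed+f)\otimes V(0,md+h)\cong{}&\bigoplus_{k=0}^{e-1}\Big[\bigoplus_{i=0}^{\gamma}V(kd+i,(e+m-2k)d+d-1)\oplus\bigoplus_{j=\gamma+1}^{h}V(kd+j,(e+m-2k)d+f+h-2j)\\&\oplus\bigoplus_{r=h+1}^{f}V(kd+r,(e+m-2k)d-1)\oplus\bigoplus_{s=f+1}^{d-1}V(kd+s,(e+m-2k)d+h+f-2s)\Big]\\&\oplus\bigoplus_{i=0}^{\gamma}V(ed+i,(m-e)d+d-1)\oplus\bigoplus_{i=\gamma+1}^{h}V(ed+i,(m-e)d+f+h-2i)\\&\oplus\bigoplus_{i=h+1}^{f}V(ed+i,(m-e)d-1).\end{aligned}$$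
   Context: $\Bbbk$ is an algebraically closed field of characteristic $0$; $n>1$ is an integer; $\mathbb{Z}_n$ denotes the integers modulo $n$. For $q\in\Bbbk$ and integers $l,m\ge 0$ put $l_q=1+q+\cdots+q^{l-1}$, $l!_q=1_q\cdots l_q$, and let $\binom{l+m}{l}_q=\frac{(l+m)!_q}{l!_q\,m!_q}$ be the Gaussian binomial coefficient (a polynomial in $q$, evaluated at $q$). For $q\in\Bbbk$ with $q^n=1$, $\Bbbk\mathcal{Z}(q)$ is the Hopf algebra with $\Bbbk$-basis $\{p_i^l\mid i\in\mathbb{Z}_n,\ l\ge 0\}$ ($p_i^l$ is the path of length $l$ starting at vertex $i$ of the cyclic quiver with $n$ vertices), comultiplication $\Delta(p_i^l)=\sum_{j=0}^{l}p_{i+j}^{l-j}\otimes p_i^{j}$, counit $\varepsilon(p_i^l)=\delta_{l,0}$, multiplication $p_i^l\cdot p_j^m=q^{im}\binom{l+m}{l}_q\,p_{i+j}^{l+m}$, and unit $p_0^0$. $\mathcal{C}_q$ is the tensor category of finite dimensional right $\Bbbk\mathcal{Z}(q)$-comodules, where the comodule structure of $U\otimes V$ is $u\otimes v\mapsto u_0\otimes v_0\otimes u_1v_1$ (Sweedler notation). For $i\in\mathbb{Z}_n$ and $l\ge 0$, $V(i,l)$ is the right $\Bbbk\mathcal{Z}(q)$-comodule with basis $v^i_0,\dots,v^i_l$ and coaction $v^i_m\mapsto\sum_{j=m}^{l}v^i_j\otimes p_{i+m}^{j-m}$. The first index of $V(i,l)$ is read modulo $n$. A direct sum over an empty index range is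 $0$. *)

theory Defs
  imports "HOL-Computational_Algebra.Polynomial" "HOL-Library.Poly_Mapping"
begin

text \<open>
  Vector spaces are free spaces on explicit bases: the space with basis \<open>A\<close> consists of the
  finitely supported functions \<open>x :: 'a \<Rightarrow>\<^sub>0 'k\<close> with \<open>keys x \<subseteq> A\<close>.  A linear map
  is given by its values on basis vectors, and the tensor product of the spaces with bases
  \<open>A\<close> and \<open>B\<close> is the space with basis \<open>A \<times> B\<close>.
\<close>

definition scale :: "'k \<Rightarrow> ('a \<Rightarrow>\<^sub>0 'k) \<Rightarrow> ('a \<Rightarrow>\<^sub>0 'k::comm_ring_1)" where
  "scale c x = Poly_Mapping.map (\<lambda>y. c * y) x"

abbreviation bvec :: "'a \<Rightarrow> ('a \<Rightarrow>\<^sub>0 'k::comm_ring_1)" where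
  "bvec a \<equiv> Poly_Mapping.single a 1"

definition lin :: "('a \<Rightarrow> ('b \<Rightarrow>\<^sub>0 'k)) \<Rightarrow> ('a \<Rightarrow>\<^sub>0 'k) \<Rightarrow> ('b \<Rightarrow>\<^sub>0 'k::comm_ring_1)" where
  "lin \<phi> x = (\<Sum>a\<in>Poly_Mapping.keys x. scale (Poly_Mapping.lookup x a) (\<phi> a))"

definition tens :: "('a \<Rightarrow>\<^sub>0 'k) \<Rightarrow> ('b \<Rightarrow>\<^sub>0 'k) \<Rightarrow> (('a \<times> 'b) \<Rightarrow>\<^sub>0 'k::comm_ring_1)" where
  "tens x y = lin (\<lambda>a. lin (\<lambda>b. bvec (a, b)) y) x"

definition tens_map ::
    "('a \<Rightarrow> ('c \<Rightarrow>\<^sub>0 'k)) \<Rightarrow> ('b \<Rightarrow> ('d \<Rightarrow>\<^sub>0 'k)) \<Rightarrow>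
     (('a \<times> 'b) \<Rightarrow>\<^sub>0 'k) \<Rightarrow> (('c \<times> 'd) \<Rightarrow>\<^sub>0 'k::comm_ring_1)" where
  "tens_map \<phi> \<psi> = lin (\<lambda>(a, b). tens (\<phi> a) (\<psi> b))"

definition tens_assoc :: "((('a \<times> 'b) \<times> 'c) \<Rightarrow>\<^sub>0 'k) \<Rightarrow> (('a \<times> ('b \<times> 'c)) \<Rightarrow>\<^sub>0 'k::comm_ring_1)"
  where "tens_assoc = lin (\<lambda>((a, b), c). bvec (a, (b, c)))"


text \<open>
  The factor \<open>l!\<^sub>q m!\<^sub>q\<close> can vanish at a root of unity, so the Gaussian binomial
  coefficient is formed as a quotient of polynomials (the division is exact) before it is evaluated.
\<close>

definition qint :: "nat \<Rightarrow> 'k::field poly" where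
  "qint l = (\<Sum>j<l. monom 1 j)"

definition qfact :: "nat \<Rightarrow> 'k::field poly" where
  "qfact l = (\<Prod>j=1..l. qint j)"

definition gauss_binom :: "nat \<Rightarrow> nat \<Rightarrow> 'k::field \<Rightarrow> 'k" where
  "gauss_binom N l q = poly (qfact N div (qfact l * qfact (N - l))) q"


text \<open>
  The pair \<open>(i, l)\<close> with \<open>i < n\<close> stands for the path \<open>p\<^sub>i\<^sup>l\<close>: the
  elements of \<open>\<int>\<^sub>n\<close> are represented by their residues in \<open>{..<n}\<close>.
\<close>

type_synonym path = "nat \<times> nat"

definition paths :: "nat \<Rightarrow> path set" where
  "paths n = {..<n} \<times> UNIV"

definition comult :: "nat \<Rightarrow> path \<Rightarrow> ((path \<times> path) \<Rightarrow>\<^sub>0 'k::field)" where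
  "comult n = (\<lambda>(i, l). \<Sum>j\<le>l. bvec (((i + j) mod n, l - j), (i, j)))"

definition counit :: "path \<Rightarrow> 'k::field" where
  "counit = (\<lambda>(i, l). if l = 0 then 1 else 0)"

definition mult :: "nat \<Rightarrow> 'k \<Rightarrow> path \<times> path \<Rightarrow> (path \<Rightarrow>\<^sub>0 'k::field)" where
  "mult n q = (\<lambda>((i, l), (j, m)).
     Poly_Mapping.single ((i + j) mod n, l + m) (q ^ (i * m) * gauss_binom (l + m) l q))"


text \<open>
  A comodule is a space with a basis together with the values of its coaction
  \<open>U \<rightarrow> U \<otimes> \<Bbbk>\<Z>(q)\<close> on that basis.  The coalgebra, and hence the underlying
  category, does not depend on \<open>q\<close>; only the tensor product of comodules does.
\<close>

record (overloaded) ('a, 'k) comod =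
  cbasis :: "'a set"
  coact :: "'a \<Rightarrow> (('a \<times> path) \<Rightarrow>\<^sub>0 ('k::zero))"

definition Cq_obj :: "nat \<Rightarrow> ('a, 'k::field) comod \<Rightarrow> bool" where
  "Cq_obj n U \<longleftrightarrow>
     finite (cbasis U) \<and>
     (\<forall>u\<in>cbasis U.
        Poly_Mapping.keys (coact U u) \<subseteq> cbasis U \<times> paths n \<and>
        tens_assoc (tens_map (coact U) bvec (coact U u)) = tens_map bvec (comult n) (coact U u) \<and>
        lin (\<lambda>(v, p). scale (counit p) (bvec v)) (coact U u) = bvec u)"

definition Cq_hom ::
    "nat \<Rightarrow> ('a, 'k) comod \<Rightarrow> ('b, 'k::field) comod \<Rightarrow> ('a \<Rightarrow> ('b \<Rightarrow>\<^sub>0 'k)) \<Rightarrow> bool" where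
  "Cq_hom n U W \<phi> \<longleftrightarrow>
     Cq_obj n U \<and> Cq_obj n W \<and>
     (\<forall>u\<in>cbasis U.
        Poly_Mapping.keys (\<phi> u) \<subseteq> cbasis W \<and>
        lin (coact W) (\<phi> u) = tens_map \<phi> bvec (coact U u))"

definition Cq_iso :: "nat \<Rightarrow> ('a, 'k) comod \<Rightarrow> ('b, 'k::field) comod \<Rightarrow> bool" where
  "Cq_iso n U W \<longleftrightarrow>
     (\<exists>\<phi> \<psi>. Cq_hom n U W \<phi> \<and> Cq_hom n W U \<psi> \<and>
        (\<forall>u\<in>cbasis U. lin \<psi> (\<phi> u) = bvec u) \<and>
        (\<forall>w\<in>cbasis W. lin \<phi> (\<psi> w) = bvec w))"

definition ctensor ::
    "nat \<Rightarrow> 'k \<Rightarrow> ('a, 'k) comod \<Rightarrow> ('b, 'k::field) comod \<Rightarrow> ('a \<times> 'b, 'k) comod" where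
  "ctensor n q U W =
     \<lparr>cbasis = cbasis U \<times> cbasis W,
      coact = (\<lambda>(u, w).
        lin (\<lambda>((u0, u1), (w0, w1)). tens (bvec (u0, w0)) (mult n q (u1, w1)))
          (tens (coact U u) (coact W w)))\<rparr>"

definition cplus :: "('a, 'k) comod \<Rightarrow> ('b, 'k::field) comod \<Rightarrow> ('a + 'b, 'k) comod"
    (infixr "\<oplus>" 65) where
  "U \<oplus> W =
     \<lparr>cbasis = cbasis U <+> cbasis W,
      coact = (\<lambda>x. case x of
          Inl u \<Rightarrow> tens_map (\<lambda>a. bvec (Inl a)) bvec (coact U u)
        | Inr w \<Rightarrow> tens_map (\<lambda>b. bvec (Inr b)) bvec (coact W w))\<rparr>"

definition csum :: "'i set \<Rightarrow> ('i \<Rightarrow> ('a, 'k::field) comod) \<Rightarrow> ('i \<times> 'a, 'k) comod" where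
  "csum I U =
     \<lparr>cbasis = (SIGMA i:I. cbasis (U i)),
      coact = (\<lambda>(i, u). tens_map (\<lambda>a. bvec (i, a)) bvec (coact (U i) u))\<rparr>"

definition V :: "nat \<Rightarrow> nat \<Rightarrow> nat \<Rightarrow> (nat, 'k::field) comod" where
  "V n i l =
     \<lparr>cbasis = {..l},
      coact = (\<lambda>m. \<Sum>j=m..l. bvec (j, ((i + m) mod n, j - m)))\<rparr>"

end

(*
  A comodule over the path coalgebra is a Z_n-graded space with a nilpotent operator E of degree one,
  and on V(0,L) (x) V(0,M) one has E (v_a (x) v_b) = v_{a+1} (x) v_b + q^a v_a (x) v_{b+1}.  So this
  tensor product is the quotient of the quantum plane YX = qXY by the ideal (X^{L+1}, Y^{M+1}), with
  E acting as left multiplication by X + Y.  All strings start in different degrees s = 0, ..., L;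
  since the cokernel of E is one-dimensional in these degrees and zero in the others, it suffices to
  find, for every s, an element of degree s outside the image of E that is killed by the power of E
  prescribed by the theorem: these elements generate, and a dimension count does the rest.

  As q has order d, x = X^d and y = Y^d are central and (X + Y)^d = x + y.  The elements are built from
  the classical Clebsch-Gordan vectors in the polynomial ring in x and y and from quantum ones of degree
  below d.  Strings whose length is a multiple of d are generated by a classical vector times a monomial
  in X and Y; the strings starting in degrees kd + i and kd + (f + h + 1 - i) are treated together, because
  they come from the same quantum vector w, with (X + Y)^{f+h+1-2i} w = X^{f+1} u' + Y^{h+1} U'.
*)
theory Submission
  imports Defs
begin

subsection \<open>Gaussian binomial coefficients\<close>

text \<open>The case distinctions of the theorem reflect a threshold. The quantum vector for the
  residue i needs the q-numbers up to f + h + 1 - i to be nonzero, hence f + h + 1 - i < d; beyond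
  that only classical vectors times monomials are available, and the string lengths become multiples
  of d.

  Where the quantum vector w exists, its product with a classical vector g is not killed early
  enough. As u already carries X^(f+1), its cofactor has to end up in (x^e, y^(m+1)), whereas U
  carries Y^(h+1) and asks for (x^(e+1), y^m); in general one vector does not serve both. So two
  classical vectors are taken, normalised to the same value at x = -y. They differ by a multiple of
  x + y = (X + Y)^d, and this difference is absorbed by a correction term in the image of X + Y,
  which is invisible in the cokernel.

  Only upper bounds for the orders of nilpotence are ever proved. They give a homomorphism from the
  sum of the strings onto the tensor product, and equality of dimensions turns it into an
  isomorphism.\<close>

fun qbinom :: "'a::comm_ring_1 \<Rightarrow> nat \<Rightarrow> nat \<Rightarrow> 'a" where
  "qbinom q N 0 = 1"
| "qbinom q 0 (Suc k) = 0"
| "qbinom q (Suc N) (Suc k) = qbinom q N k + q ^ Suc k * qbinom q N (Suc k)"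

definition qnum :: "'a::comm_ring_1 \<Rightarrow> nat \<Rightarrow> 'a" where
  "qnum q l = (\<Sum>j<l. q ^ j)"

definition qfac :: "'a::comm_ring_1 \<Rightarrow> nat \<Rightarrow> 'a" where
  "qfac q l = (\<Prod>j=1..l. qnum q j)"

lemma qfac_0 [simp]: "qfac q 0 = 1"
  by (simp add: qfac_def)

lemma qfac_Suc: "qfac q (Suc l) = qnum q (Suc l) * qfac q l"
  by (simp add: qfac_def mult.commute)

lemma qnum_add: "qnum q (l + m) = qnum q l + q ^ l * qnum q m"
proof -
  have "qnum q (l + m) = (\<Sum>j<l. q ^ j) + (\<Sum>j=l..<l+m. q ^ j)"
    unfolding qnum_def by (metis atLeast0LessThan le_add1 sum.atLeastLessThan_concat zero_le)
  also have "(\<Sum>j=l..<l+m. q ^ j) = (\<Sum>j<m. q ^ (l + j))"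
    using sum.shift_bounds_nat_ivl[of "(^) q" 0 l m] by (simp add: atLeast0LessThan add.commute)
  finally show ?thesis by (simp add: qnum_def sum_distrib_left power_add)
qed

lemma qbinom_eq_0: "N < k \<Longrightarrow> qbinom q N k = 0"
  by (induction q N k rule: qbinom.induct) auto

lemma qbinom_self [simp]: "qbinom q N N = 1"
  by (induction N) (auto simp: qbinom_eq_0)

text \<open>The companion Pascal rule. Expanding by the defining rule and then by this one a level
  below, or in the opposite order, produces the same four terms.\<close>

lemma qbinom_Suc_Suc':
  "k \<le> N \<Longrightarrow> qbinom q (Suc N) (Suc k) = q ^ (N - k) * qbinom q N k + qbinom q N (Suc k)"
proof (induction N arbitrary: k)
  case 0
  then show ?case by simp
next
  case (Suc N)
  show ?case
  proof (cases k)
    case 0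
    have "qbinom q (Suc (Suc N)) (Suc 0) = 1 + q * qbinom q (Suc N) (Suc 0)"
      by simp
    also have "\<dots> = 1 + q * (q ^ N + qbinom q N (Suc 0))"
      using Suc.IH[of 0] by simp
    finally show ?thesis using 0 by (simp add: algebra_simps)
  next
    case (Suc k')
    show ?thesis
    proof (cases "k = Suc N")
      case True
      then show ?thesis by (simp add: qbinom_eq_0)
    next
      case False
      with Suc.prems have kN: "k \<le> N" by simp
      have i1: "qbinom q (Suc N) (Suc k') = q ^ (N - k') * qbinom q N k' + qbinom q N (Suc k')"
        using Suc.IH[of k'] kN Suc by simp
      have i2: "qbinom q (Suc N) (Suc k) = q ^ (N - k) * qbinom q N k + qbinom q N (Suc k)"
        using Suc.IH[of k] kN by simp
      have p1: "q ^ Suc k * q ^ (N - k) = q ^ Suc N" "q ^ (N - k') * q ^ k = q ^ Suc N"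
        "Suc N - k = N - k'"
        using kN Suc by (auto simp flip: power_add power_Suc)
      have "qbinom q (Suc (Suc N)) (Suc k) = qbinom q (Suc N) k + q ^ Suc k * qbinom q (Suc N) (Suc k)"
        by simp
      also have "\<dots> = q ^ (N - k') * qbinom q N k' + qbinom q N k
          + (q ^ Suc k * q ^ (N - k)) * qbinom q N k + q ^ Suc k * qbinom q N (Suc k)"
        using i1 i2 Suc by (simp add: algebra_simps)
      also have "\<dots> = q ^ (N - k') * (qbinom q N k' + q ^ k * qbinom q N k)
          + (qbinom q N k + q ^ Suc k * qbinom q N (Suc k))"
        unfolding p1(1) p1(2)[symmetric] by (simp add: algebra_simps)
      also have "\<dots> = q ^ (Suc N - k) * qbinom q (Suc N) k + qbinom q (Suc N) (Suc k)"
        using Suc p1(3) by simp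
      finally show ?thesis .
    qed
  qed
qed

text \<open>Kept multiplied out, because at a root of unity the factorials may vanish.\<close>

lemma qbinom_qfac: "qbinom q (l + m) l * (qfac q l * qfac q m) = qfac q (l + m)"
proof (induction "l + m" arbitrary: l m)
  case 0
  then show ?case by simp
next
  case (Suc s)
  show ?case
  proof (cases l)
    case 0
    then show ?thesis by simp
  next
    case l: (Suc l')
    show ?thesis
    proof (cases m)
      case 0
      then show ?thesis by simp
    next
      case m: (Suc m')
      have s: "s = l' + m" "s = l + m'" using Suc.hyps l m by auto
      have 1: "qbinom q s l' * (qfac q l' * qfac q m) = qfac q s"
        using Suc.hyps(1)[OF s(1)] s(1) by simp
      have 2: "qbinom q s l * (qfac q l * qfac q m') = qfac q s"
        using Suc.hyps(1)[OF s(2)] s(2) by simp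
      have "qbinom q (l + m) l * (qfac q l * qfac q m)
          = (qbinom q s l' + q ^ l * qbinom q s l) * (qfac q l * qfac q m)"
        using qbinom.simps(3)[of q s l'] l s(1) by simp
      also have "\<dots> = qnum q l * (qbinom q s l' * (qfac q l' * qfac q m))
          + q ^ l * qnum q m * (qbinom q s l * (qfac q l * qfac q m'))"
        using l m by (simp add: qfac_Suc algebra_simps)
      also have "\<dots> = (qnum q l + q ^ l * qnum q m) * qfac q s"
        unfolding 1 2 by (simp add: algebra_simps)
      also have "\<dots> = qfac q (l + m)"
        using qnum_add[of q l m] l s(1) by (simp add: qfac_Suc)
      finally show ?thesis .
    qed
  qed
qed

lemma poly_qbinom: "poly (qbinom p N k) x = qbinom (poly p x) N k"
  by (induction p N k rule: qbinom.induct) simp_all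

lemma qint_eq: "qint l = qnum [:0, 1:] l"
  by (simp add: qint_def qnum_def monom_altdef)

lemma qfact_eq: "qfact l = qfac [:0, 1:] l"
  by (simp add: qfact_def qfac_def qint_eq)

lemma qfact_nonzero: "qfact l \<noteq> (0 :: 'k::field poly)"
proof -
  have "qint j \<noteq> (0 :: 'k poly)" if "j \<ge> 1" for j
  proof -
    have "coeff (qint j :: 'k poly) 0 = (\<Sum>i<j. if i = 0 then 1 else 0)"
      by (simp add: qint_def coeff_sum)
    also have "\<dots> = 1" using that by (subst sum.delta) auto
    finally show ?thesis by force
  qed
  then show ?thesis by (simp add: qfact_def)
qed

text \<open>The Pascal recursion makes sense in every commutative ring. For the indeterminate
  \<open>[:0, 1:]\<close> it gives the exact quotient of the factorials, and evaluation at
  \<open>q\<close> commutes with the recursion.\<close>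

lemma gauss_binom_eq: "gauss_binom (l + m) l q = qbinom q (l + m) l"
proof -
  have "qfact (l + m) = qbinom [:0, 1:] (l + m) l * (qfact l * qfact m :: 'a poly)"
    by (simp add: qfact_eq qbinom_qfac)
  then show ?thesis
    by (simp add: gauss_binom_def qfact_nonzero poly_qbinom)
qed

lemma qnum_geometric:
  fixes q :: "'k::field"
  assumes "q \<noteq> 1"
  shows "qnum q l = (1 - q ^ l) / (1 - q)"
  unfolding qnum_def using assms by (subst sum_gp_strict) auto

lemma qfac_nonzero:
  fixes q :: "'k::field"
  assumes "\<And>j. 0 < j \<Longrightarrow> j \<le> l \<Longrightarrow> qnum q j \<noteq> 0"
  shows "qfac q l \<noteq> 0"
  using assms by (simp add: qfac_def)

text \<open>The q-Vandermonde identity for negative upper indices: it compares coefficients in 1/(z;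
  q)_(A+1) times 1/(q^(A+1) z; q)_(B+1) = 1/(z; q)_(A+B+2). It later evaluates \<open>lam\<close> on
  the quantum vectors.\<close>

lemma qbinom_vandermonde:
  "(\<Sum>j\<le>k. qbinom q (A + j) j * qbinom q (B + (k - j)) (k - j) * q ^ ((A + 1) * (k - j)))
     = qbinom q (A + B + 1 + k) k"
proof (induction B arbitrary: k)
  case 0
  show ?case
  proof (induction k)
    case 0
    then show ?case by simp
  next
    case (Suc k)
    have "(\<Sum>j\<le>Suc k. qbinom q (A + j) j * qbinom q (0 + (Suc k - j)) (Suc k - j) * q ^ ((A + 1) * (Suc k - j)))
      = qbinom q (A + Suc k) (Suc k) + (\<Sum>j\<le>k. qbinom q (A + j) j * q ^ ((A + 1) * (Suc k - j)))"
      by simp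
    also have "(\<Sum>j\<le>k. qbinom q (A + j) j * q ^ ((A + 1) * (Suc k - j)))
      = q ^ (A + 1) * (\<Sum>j\<le>k. qbinom q (A + j) j * qbinom q (0 + (k - j)) (k - j) * q ^ ((A + 1) * (k - j)))"
      unfolding sum_distrib_left by (rule sum.cong) (auto simp: Suc_diff_le power_add algebra_simps)
    also have "\<dots> = q ^ (A + 1) * qbinom q (A + 1 + k) k"
      by (simp only: Suc.IH) simp
    finally show ?case
      using qbinom_Suc_Suc'[of k "A + 1 + k" q] by simp
  qed
next
  case (Suc B)
  note IH = Suc.IH
  show ?case
  proof (induction k)
    case 0
    then show ?case by simp
  next
    case (Suc k)
    define T where "T B k j = qbinom q (A + j) j * qbinom q (B + (k - j)) (k - j) * q ^ ((A + 1) * (k - j))" for B k j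
    have step: "T (Suc B) (Suc k) j = T B (Suc k) j + q ^ (A + B + 2) * T (Suc B) k j" if "j \<le> k" for j
    proof -
      have "qbinom q (Suc B + Suc (k - j)) (Suc (k - j))
          = q ^ Suc B * qbinom q (Suc B + (k - j)) (k - j) + qbinom q (B + Suc (k - j)) (Suc (k - j))"
        using qbinom_Suc_Suc'[of "k - j" "Suc B + (k - j)" q] by simp
      then show ?thesis using that
        by (simp add: T_def Suc_diff_le power_add algebra_simps)
    qed
    have "(\<Sum>j\<le>Suc k. T (Suc B) (Suc k) j) = (\<Sum>j\<le>k. T (Suc B) (Suc k) j) + T B (Suc k) (Suc k)"
      by (simp add: T_def)
    also have "(\<Sum>j\<le>k. T (Suc B) (Suc k) j)
       = (\<Sum>j\<le>k. T B (Suc k) j) + q ^ (A + B + 2) * (\<Sum>j\<le>k. T (Suc B) k j)"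
      by (simp add: step sum.distrib sum_distrib_left)
    also have "(\<Sum>j\<le>k. T (Suc B) k j) = qbinom q (A + Suc B + 1 + k) k"
      using Suc.IH by (simp add: T_def)
    finally have "(\<Sum>j\<le>Suc k. T (Suc B) (Suc k) j)
       = (\<Sum>j\<le>Suc k. T B (Suc k) j) + q ^ (A + B + 2) * qbinom q (A + Suc B + 1 + k) k"
      by simp
    also have "(\<Sum>j\<le>Suc k. T B (Suc k) j) = qbinom q (A + B + 1 + Suc k) (Suc k)"
      using IH[of "Suc k"] by (simp add: T_def)
    finally show ?case
      using qbinom_Suc_Suc'[of k "A + B + 2 + k" q] by (simp add: T_def)
  qed
qed

subsection \<open>A q-analogue of the k-th finite difference\<close>

text \<open>This is (-1)^j q^(j(j-1)/2), written without the halved exponent.\<close>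

definition tri :: "'a::comm_ring_1 \<Rightarrow> nat \<Rightarrow> 'a" where
  "tri q j = (\<Prod>i<j. - (q ^ i))"

lemma tri_0 [simp]: "tri q 0 = 1"
  and tri_Suc: "tri q (Suc j) = - (q ^ j) * tri q j"
  by (simp_all add: tri_def mult.commute)

lemma tri_nonzero: "q \<noteq> 0 \<Longrightarrow> tri q j \<noteq> (0::'k::field)"
  by (simp add: tri_def)

lemma tri_square: "tri q j * tri q j * q ^ j = q ^ (j * j)"
proof (induction j)
  case 0
  then show ?case by simp
next
  case (Suc j)
  have "tri q (Suc j) * tri q (Suc j) * q ^ Suc j = (tri q j * tri q j * q ^ j) * (q ^ j * q ^ j * q)"
    by (simp add: tri_Suc algebra_simps)
  also have "\<dots> = q ^ (Suc j * Suc j)"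
    unfolding Suc.IH by (simp flip: power_add power_Suc2) (simp add: power_add algebra_simps)
  finally show ?case .
qed

text \<open>With S the shift of the argument, this is the value at 0 of the product of the operators
  1 - q^m S over m < k, expanded by the q-binomial theorem; \<open>qdel q m\<close> is a single
  factor.\<close>

definition qdiff :: "'a::comm_ring_1 \<Rightarrow> nat \<Rightarrow> (nat \<Rightarrow> 'a) \<Rightarrow> 'a" where
  "qdiff q k \<phi> = (\<Sum>j\<le>k. tri q j * qbinom q k j * \<phi> j)"

definition qdel :: "'a::comm_ring_1 \<Rightarrow> nat \<Rightarrow> (nat \<Rightarrow> 'a) \<Rightarrow> nat \<Rightarrow> 'a" where
  "qdel q m \<phi> j = \<phi> j - q ^ m * \<phi> (Suc j)"

lemma qdiff_Suc: "qdiff q (Suc k) \<phi> = qdiff q k (qdel q k \<phi>)"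
proof -
  have "qdiff q (Suc k) \<phi> = \<phi> 0 + (\<Sum>j\<le>k. tri q (Suc j) * qbinom q (Suc k) (Suc j) * \<phi> (Suc j))"
    unfolding qdiff_def by (subst sum.atMost_Suc_shift) simp
  also have "(\<Sum>j\<le>k. tri q (Suc j) * qbinom q (Suc k) (Suc j) * \<phi> (Suc j))
     = (\<Sum>j\<le>k. tri q (Suc j) * qbinom q k (Suc j) * \<phi> (Suc j))
       - (\<Sum>j\<le>k. tri q j * qbinom q k j * (q ^ k * \<phi> (Suc j)))"
  proof (subst sum_subtractf[symmetric], rule sum.cong[OF refl])
    fix j assume "j \<in> {..k}"
    then have j: "j \<le> k" by simp
    have "q ^ j * q ^ (k - j) = q ^ k" using j by (simp flip: power_add)
    then have e: "q ^ j * (q ^ (k - j) * x) = q ^ k * x" for x by (metis mult.assoc)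
    show "tri q (Suc j) * qbinom q (Suc k) (Suc j) * \<phi> (Suc j) =
        tri q (Suc j) * qbinom q k (Suc j) * \<phi> (Suc j) - tri q j * qbinom q k j * (q ^ k * \<phi> (Suc j))"
      unfolding qbinom_Suc_Suc'[OF j] tri_Suc e[symmetric] by (simp add: algebra_simps del: power_Suc)
  qed
  also have "\<phi> 0 + ((\<Sum>j\<le>k. tri q (Suc j) * qbinom q k (Suc j) * \<phi> (Suc j)) - X)
     = (\<Sum>j\<le>Suc k. tri q j * qbinom q k j * \<phi> j) - X" for X
    by (subst sum.atMost_Suc_shift) simp
  finally show ?thesis
    by (simp add: qdiff_def qdel_def qbinom_eq_0 right_diff_distrib sum_subtractf)
qed

text \<open>\<open>qpoly q m\<close> plays the role of the polynomial functions of degree less than \<open>m\<close>: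
  for generic \<open>q\<close> it is the span of the functions \<open>j \<mapsto> q\<^sup>-\<^sup>t\<^sup>j\<close> with \<open>t < m\<close>.\<close>

fun qpoly :: "'a::comm_ring_1 \<Rightarrow> nat \<Rightarrow> (nat \<Rightarrow> 'a) \<Rightarrow> bool" where
  "qpoly q 0 \<phi> \<longleftrightarrow> (\<forall>j. \<phi> j = 0)"
| "qpoly q (Suc m) \<phi> \<longleftrightarrow> qpoly q m (qdel q m \<phi>)"

lemma qpoly_add: "qpoly q m \<phi> \<Longrightarrow> qpoly q m \<psi> \<Longrightarrow> qpoly q m (\<lambda>j. \<phi> j + \<psi> j)"
proof (induction m arbitrary: \<phi> \<psi>)
  case (Suc m)
  have "qdel q m (\<lambda>j. \<phi> j + \<psi> j) = (\<lambda>j. qdel q m \<phi> j + qdel q m \<psi> j)"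
    by (auto simp: qdel_def algebra_simps)
  then show ?case using Suc by simp
qed simp

lemma qpoly_cmult: "qpoly q m \<phi> \<Longrightarrow> qpoly q m (\<lambda>j. c * \<phi> j)"
proof (induction m arbitrary: \<phi>)
  case (Suc m)
  have "qdel q m (\<lambda>j. c * \<phi> j) = (\<lambda>j. c * qdel q m \<phi> j)"
    by (auto simp: qdel_def algebra_simps)
  then show ?case using Suc by simp
qed simp

text \<open>The relation satisfied by the functions u + v q^(-j), phrased so that for q = 1 it
  describes the affine functions of j.\<close>

definition qaff :: "'a::comm_ring_1 \<Rightarrow> 'a \<Rightarrow> (nat \<Rightarrow> 'a) \<Rightarrow> bool" where
  "qaff q c l \<longleftrightarrow> (\<forall>j. l j = q * l (Suc j) + c)"

text \<open>A Leibniz rule: pulling an affine factor out of the difference operator lowers its index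
  by one, which is why such a factor raises the degree bound of \<open>qpoly\<close> by one.\<close>

lemma qdel_mult:
  assumes "qaff q c l"
  shows "qdel q (Suc m) (\<lambda>j. l j * \<phi> j) = (\<lambda>j. c * \<phi> j + q * (l (Suc j) * qdel q m \<phi> j))"
proof
  fix j
  show "qdel q (Suc m) (\<lambda>j. l j * \<phi> j) j = c * \<phi> j + q * (l (Suc j) * qdel q m \<phi> j)"
    using assms[unfolded qaff_def, THEN spec, of j] unfolding qdel_def by (simp add: algebra_simps)
qed

lemma qpoly_const: "qpoly q (Suc 0) (\<lambda>_. c)"
  by (simp add: qdel_def)

lemma qpoly_mult:
  assumes "qaff q c l" "qpoly q m \<phi>"
  shows "qpoly q (Suc m) (\<lambda>j. l j * \<phi> j)"
  using assms
proof (induction m arbitrary: \<phi> l)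
  case 0
  from 0(2) show ?case by (simp add: qdel_def)
next
  case (Suc m)
  have "qpoly q m (qdel q m \<phi>)" using Suc.prems(2) by simp
  moreover have "qaff q c (\<lambda>j. l (Suc j))"
    using Suc.prems(1) unfolding qaff_def by blast
  ultimately have "qpoly q (Suc m) (\<lambda>j. l (Suc j) * qdel q m \<phi> j)"
    by (rule Suc.IH[rotated])
  then have "qpoly q (Suc m) (\<lambda>j. c * \<phi> j + q * (l (Suc j) * qdel q m \<phi> j))"
    using Suc.prems(2) by (intro qpoly_add qpoly_cmult)
  then show ?case
    unfolding qpoly.simps(2)[of q "Suc m"] qdel_mult[OF Suc.prems(1), of m \<phi>] .
qed

lemma qdiff_qpoly: "qpoly q k \<phi> \<Longrightarrow> qdiff q k \<phi> = 0"
proof (induction k arbitrary: \<phi>)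
  case 0
  then show ?case by (simp add: qdiff_def)
next
  case (Suc k)
  then show ?case by (simp add: qdiff_Suc)
qed

lemma qdiff_add: "qdiff q k (\<lambda>j. \<phi> j + \<psi> j) = qdiff q k \<phi> + qdiff q k \<psi>"
  and qdiff_cmult: "qdiff q k (\<lambda>j. a * \<phi> j) = a * qdiff q k \<phi>"
  by (simp_all add: qdiff_def algebra_simps sum.distrib sum_distrib_left)

lemma qpoly_prod:
  assumes "finite X" "\<And>x. x \<in> X \<Longrightarrow> qaff q (c x) (l x)" "qpoly q m \<phi>"
  shows "qpoly q (card X + m) (\<lambda>j. (\<Prod>x\<in>X. l x j) * \<phi> j)"
  using assms
proof (induction X rule: finite_induct)
  case (insert y X)
  have "qpoly q (Suc (card X + m)) (\<lambda>j. l y j * ((\<Prod>x\<in>X. l x j) * \<phi> j))"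
    by (rule qpoly_mult[of _ "c y"]) (use insert in auto)
  then show ?case using insert(1,2) by (simp add: mult.assoc)
qed simp

text \<open>An affine function of q^(-j) that becomes j itself at q = 1; it replaces the variable
  j.\<close>

definition qell :: "'k::field \<Rightarrow> nat \<Rightarrow> 'k" where
  "qell q j = qnum q j / q ^ j"

text \<open>The top difference depends only on the leading coefficient.\<close>

lemma qdiff_prod_shift:
  fixes a :: "'i \<Rightarrow> 'a::comm_ring_1"
  assumes "finite X" "qaff q c l" "qpoly q (Suc s) \<phi>"
  shows "qdiff q (card X + s) (\<lambda>j. (\<Prod>x\<in>X. l j + a x) * \<phi> j)
       = qdiff q (card X + s) (\<lambda>j. l j ^ card X * \<phi> j)"
  using assms(1,3)
proof (induction X arbitrary: s \<phi> rule: finite_induct)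
  case (insert y X)
  have l': "qaff q (c + b - q * b) (\<lambda>j. l j + b)" for b
    unfolding qaff_def
  proof
    fix j show "l j + b = q * (l (Suc j) + b) + (c + b - q * b)"
      using assms(2)[unfolded qaff_def, THEN spec, of j] by (simp add: algebra_simps)
  qed
  have p: "qpoly q (card X + Suc s) (\<lambda>j. (\<Prod>x\<in>X. l j + a x) * \<phi> j)"
    by (rule qpoly_prod[where c = "\<lambda>x. c + a x - q * a x"]) (rule insert.hyps(1), rule l', rule insert.prems)
  have p2: "qpoly q (Suc (Suc s)) (\<lambda>j. l j * \<phi> j)"
    by (rule qpoly_mult[OF assms(2) insert.prems])
  have "qdiff q (card X + Suc s) (\<lambda>j. (\<Prod>x\<in>insert y X. l j + a x) * \<phi> j)
     = qdiff q (card X + Suc s) (\<lambda>j. (\<Prod>x\<in>X. l j + a x) * (l j * \<phi> j) + a y * ((\<Prod>x\<in>X. l j + a x) * \<phi> j))"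
    using insert(1,2) by (simp add: algebra_simps)
  also have "\<dots> = qdiff q (card X + Suc s) (\<lambda>j. (\<Prod>x\<in>X. l j + a x) * (l j * \<phi> j))"
    unfolding qdiff_add qdiff_cmult using qdiff_qpoly[OF p] by simp
  also have "\<dots> = qdiff q (card X + Suc s) (\<lambda>j. l j ^ card X * (l j * \<phi> j))"
    by (rule insert.IH[OF p2])
  also have "\<dots> = qdiff q (card X + Suc s) (\<lambda>j. l j ^ Suc (card X) * \<phi> j)"
    by (simp add: mult.assoc mult.left_commute)
  finally show ?case using insert(1,2) by simp
qed simp

lemma qaff_qell: "q \<noteq> 0 \<Longrightarrow> qaff q (-1) (qell q)"
  unfolding qaff_def
proof
  fix j assume "q \<noteq> 0"
  then show "qell q j = q * qell q (Suc j) + (-1)"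
    using qnum_add[of q j 1] by (simp add: qell_def qnum_def field_simps)
qed

lemma qnum_diff: "q \<noteq> 0 \<Longrightarrow> j \<le> x \<Longrightarrow> qnum q (x - j) = qnum q x - q ^ x * qell q j"
  using qnum_add[of q "x - j" j] by (simp add: qell_def field_simps flip: power_add)

text \<open>The q-number of the integer x - k, which may be negative.\<close>

definition qneg :: "'k::field \<Rightarrow> nat \<Rightarrow> nat \<Rightarrow> 'k" where
  "qneg q x k = (if k \<le> x then qnum q (x - k) else - qnum q (k - x) / q ^ (k - x))"

lemma qneg_eq:
  assumes "q \<noteq> 0" "k \<le> x + j"
  shows "qell q j + qneg q x k = qnum q (x + j - k) / q ^ j"
proof (cases "k \<le> x")
  case True
  then have "x + j - k = j + (x - k)" by simp
  then show ?thesis using assms True qnum_add[of q j "x - k"]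
    by (simp add: qell_def qneg_def field_simps)
next
  case False
  then have "j = (x + j - k) + (k - x)" using assms by simp
  then have "qnum q j = qnum q (x + j - k) + q ^ (x + j - k) * qnum q (k - x)"
    "q ^ j = q ^ (x + j - k) * q ^ (k - x)"
    by (metis qnum_add, metis power_add)
  then show ?thesis using assms False
    by (simp add: qell_def qneg_def field_simps)
qed

text \<open>Since the shifts \<open>a x\<close> do not matter, they may be chosen so that the
  product vanishes at j = 0, ..., k - 1; then only the summand j = k survives.\<close>

lemma qdiff_prod:
  fixes q :: "'k::field"
  assumes "finite X" "q \<noteq> 0"
  shows "qdiff q (card X) (\<lambda>j. \<Prod>x\<in>X. qell q j + a x)
       = tri q (card X) * qfac q (card X) / q ^ (card X * card X)"
proof -
  define k where "k = card X"
  have "qdiff q k (\<lambda>j. \<Prod>x\<in>X. qell q j + a x) = qdiff q k (\<lambda>j. qell q j ^ k)"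
    using qdiff_prod_shift[where s = 0 and \<phi> = "\<lambda>_. 1" and a = a, OF assms(1) qaff_qell[OF assms(2)] qpoly_const]
    by (simp add: k_def)
  also have "\<dots> = qdiff q k (\<lambda>j. \<Prod>x=1..k. qell q j + qneg q x k)"
    using qdiff_prod_shift[where s = 0 and \<phi> = "\<lambda>_. 1" and a = "\<lambda>x. qneg q x k" and X = "{1..k}", OF _ qaff_qell[OF assms(2)] qpoly_const]
    by simp
  also have "\<dots> = (\<Sum>j\<le>k. if j = k then tri q k * qfac q k / q ^ (k * k) else 0)"
    unfolding qdiff_def
  proof (rule sum.cong[OF refl])
    fix j assume "j \<in> {..k}"
    show "tri q j * qbinom q k j * (\<Prod>x=1..k. qell q j + qneg q x k)
      = (if j = k then tri q k * qfac q k / q ^ (k * k) else 0)"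
    proof (cases "j = k")
      case True
      have "(\<Prod>x=1..k. qell q k + qneg q x k) = (\<Prod>x=1..k. qnum q x / q ^ k)"
        by (rule prod.cong) (auto simp: qneg_eq assms)
      then show ?thesis using True by (simp add: prod_dividef qfac_def power_mult)
    next
      case False
      with \<open>j \<in> {..k}\<close> have "j < k" by simp
      then have "qell q j + qneg q (k - j) k = 0"
        using qneg_eq[of q k "k - j" j] assms by (simp add: qnum_def)
      moreover have "k - j \<in> {1..k}" using \<open>j < k\<close> by auto
      ultimately have "(\<Prod>x=1..k. qell q j + qneg q x k) = 0"
        by (intro prod_zero) auto
      then show ?thesis using False by simp
    qed
  qed
  finally show ?thesis by (simp add: k_def)
qed

subsection \<open>The quantum plane in one variable\<close>

text \<open>
  The monomial \<open>X\<^sup>aY\<^sup>s\<^sup>-\<^sup>a\<close> of the quantum plane \<open>YX = qXY\<close> is represented, once its degree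
  \<open>s\<close> is fixed, by the power \<open>z\<^sup>a\<close>.  Then \<open>X\<close> is multiplication by \<open>z\<close> and \<open>Y\<close> is the
  substitution \<open>z \<mapsto> qz\<close>; \<open>eop q\<close> is left multiplication by \<open>X + Y\<close>.
\<close>

definition eop :: "'a::comm_ring_1 \<Rightarrow> 'a poly \<Rightarrow> 'a poly" where
  "eop q p = pCons 0 p + pcompose p [:0, q:]"

lemma coeff_eop: "coeff (eop q p) a = (case a of 0 \<Rightarrow> 0 | Suc b \<Rightarrow> coeff p b) + q ^ a * coeff p a"
  by (simp add: eop_def coeff_pCons coeff_pcompose_linear)

lemma eop_add: "eop q (p + p') = eop q p + eop q p'"
  and eop_0 [simp]: "eop q 0 = 0"
  by (rule poly_eqI; simp add: coeff_eop algebra_simps split: nat.split)+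

lemma eop_pow_add: "(eop q ^^ r) (p + p') = (eop q ^^ r) p + (eop q ^^ r) p'"
  and eop_pow_0 [simp]: "(eop q ^^ r) 0 = 0"
  by (induction r) (simp_all add: eop_add)

text \<open>The q-binomial theorem for YX = qXY: the term X^i Y^(r-i) of (X + Y)^r meets the
  monomial with exponent a - i, and moving Y^(r-i) past it costs q^((a-i)(r-i)).\<close>

lemma coeff_eop_pow:
  "coeff ((eop q ^^ r) p) a = (\<Sum>i\<le>a. qbinom q r i * q ^ ((a - i) * (r - i)) * coeff p (a - i))"
proof (induction r arbitrary: a)
  case 0
  have "(\<Sum>i\<le>a. qbinom q 0 i * q ^ ((a - i) * (0 - i)) * coeff p (a - i))
      = (\<Sum>i\<le>a. if i = 0 then coeff p a else 0)"
    by (rule sum.cong) (auto simp: qbinom_eq_0)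
  then show ?case by simp
next
  case (Suc r)
  define t where "t i = qbinom q (Suc r) i * q ^ ((a - i) * (Suc r - i)) * coeff p (a - i)" for i
  \<comment> \<open>The truncated difference \<open>r - i\<close> is harmless, as the binomial
    vanishes for i > r.\<close>
  have e: "q ^ a * (qbinom q r i * q ^ ((a - i) * (r - i)) * coeff p (a - i))
      = q ^ i * qbinom q r i * q ^ ((a - i) * (Suc r - i)) * coeff p (a - i)" if "i \<le> a" for i
  proof (cases "i \<le> r")
    case True
    then have "a + (a - i) * (r - i) = i + (a - i) * (Suc r - i)"
      using that by (simp add: Suc_diff_le)
    then have "q ^ a * q ^ ((a - i) * (r - i)) = q ^ i * q ^ ((a - i) * (Suc r - i))"
      by (metis power_add)
    then have "(q ^ a * q ^ ((a - i) * (r - i))) * (qbinom q r i * coeff p (a - i))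
        = (q ^ i * q ^ ((a - i) * (Suc r - i))) * (qbinom q r i * coeff p (a - i))"
      by simp
    then show ?thesis by (simp only: ac_simps)
  next
    case False
    then show ?thesis by (simp add: qbinom_eq_0)
  qed
  show ?case
  proof (cases a)
    case 0
    then show ?thesis using Suc[of 0] by (simp add: coeff_eop)
  next
    case a: (Suc b)
    have "coeff ((eop q ^^ Suc r) p) a = coeff ((eop q ^^ r) p) b + q ^ a * coeff ((eop q ^^ r) p) a"
      by (simp add: coeff_eop a)
    also have "\<dots> = (\<Sum>i\<le>b. qbinom q r i * q ^ ((b - i) * (r - i)) * coeff p (b - i))
       + (\<Sum>i\<le>a. q ^ i * qbinom q r i * q ^ ((a - i) * (Suc r - i)) * coeff p (a - i))"
      unfolding Suc.IH sum_distrib_left by (intro arg_cong2[of _ _ _ _ "(+)"] sum.cong refl e) simp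
    also have "(\<Sum>i\<le>a. q ^ i * qbinom q r i * q ^ ((a - i) * (Suc r - i)) * coeff p (a - i))
       = t 0 + (\<Sum>i\<le>b. q ^ Suc i * qbinom q r (Suc i) * q ^ ((b - i) * (r - i)) * coeff p (b - i))"
      unfolding a sum.atMost_Suc_shift t_def by (simp add: a)
    also have "(\<Sum>i\<le>b. qbinom q r i * q ^ ((b - i) * (r - i)) * coeff p (b - i)) +
       (t 0 + (\<Sum>i\<le>b. q ^ Suc i * qbinom q r (Suc i) * q ^ ((b - i) * (r - i)) * coeff p (b - i)))
       = t 0 + (\<Sum>i\<le>b. t (Suc i))"
      by (simp add: t_def a algebra_simps sum.distrib)
    also have "\<dots> = (\<Sum>i\<le>a. t i)"
      unfolding a sum.atMost_Suc_shift ..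
    finally show ?thesis by (simp add: t_def)
  qed
qed

text \<open>\<open>bnd a b s p\<close>: as a form of degree \<open>s\<close>, \<open>p\<close> is divisible by \<open>X\<^sup>a\<close> and by \<open>Y\<^sup>b\<close>;
  \<open>mem a b s P\<close>: as a form of degree \<open>s\<close>, \<open>P\<close> lies in the ideal generated by \<open>X\<^sup>a\<close> and
  \<open>Y\<^sup>b\<close>.\<close>

definition bnd :: "nat \<Rightarrow> nat \<Rightarrow> nat \<Rightarrow> 'a::comm_ring_1 poly \<Rightarrow> bool" where
  "bnd a b s p \<longleftrightarrow> (\<forall>j. coeff p j \<noteq> 0 \<longrightarrow> a \<le> j \<and> j + b \<le> s)"

definition mem :: "nat \<Rightarrow> nat \<Rightarrow> nat \<Rightarrow> 'a::comm_ring_1 poly \<Rightarrow> bool" where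
  "mem a b s P \<longleftrightarrow> (\<exists>p p'. P = p + p' \<and> bnd a 0 s p \<and> bnd 0 b s p')"

lemma bnd_0 [simp]: "bnd a b s 0"
  by (simp add: bnd_def)

lemma bnd_add: "bnd a b s p \<Longrightarrow> bnd a b s p' \<Longrightarrow> bnd a b s (p + p')"
  unfolding bnd_def by (metis add_0 coeff_add)

lemma bnd_uminus: "bnd a b s p \<Longrightarrow> bnd a b s (- p)"
  by (simp add: bnd_def)

lemma bnd_smult: "bnd a b s p \<Longrightarrow> bnd a b s (smult c p)"
  unfolding bnd_def by (metis coeff_smult mult_zero_right)

lemma bnd_weaken: "bnd a b s p \<Longrightarrow> a' \<le> a \<Longrightarrow> b' + s \<le> b + s' \<Longrightarrow> bnd a' b' s' p"
  unfolding bnd_def by fastforce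

lemma bnd_mult:
  assumes "bnd a b s p" "bnd a' b' s' p'"
  shows "bnd (a + a') (b + b') (s + s') (p * p')"
  unfolding bnd_def
proof (intro allI impI)
  fix j assume "coeff (p * p') j \<noteq> 0"
  then obtain i where "i \<le> j" "coeff p i * coeff p' (j - i) \<noteq> 0"
    unfolding coeff_mult by (metis (no_types, lifting) atMost_iff sum.not_neutral_contains_not_neutral)
  then have "coeff p i \<noteq> 0" "coeff p' (j - i) \<noteq> 0" by auto
  then show "a + a' \<le> j \<and> j + (b + b') \<le> s + s'"
    using assms \<open>i \<le> j\<close> unfolding bnd_def by fastforce
qed

lemma bnd_degree: "bnd 0 0 s p \<longleftrightarrow> degree p \<le> s"
  unfolding bnd_def using le_degree[of p] degree_le[of s p] by (force simp: not_le[symmetric] dest: order.trans)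

lemma bnd_monom: "bnd a 0 a (monom c a)"
  by (simp add: bnd_def)

lemma bnd_eop: "bnd a b s p \<Longrightarrow> bnd a b (Suc s) (eop q p)"
  unfolding bnd_def
proof (intro allI impI)
  fix j assume *: "\<forall>j. coeff p j \<noteq> 0 \<longrightarrow> a \<le> j \<and> j + b \<le> s" "coeff (eop q p) j \<noteq> 0"
  show "a \<le> j \<and> j + b \<le> Suc s"
  proof (cases "coeff p j = 0")
    case True
    then obtain i where "j = Suc i" "coeff p i \<noteq> 0"
      using *(2) by (auto simp: coeff_eop split: nat.split_asm)
    then show ?thesis using *(1) by (auto simp: le_SucI)
  next
    case False
    then show ?thesis using *(1) by (auto simp: le_SucI)
  qed
qed

lemma bnd_eop_pow: "bnd a b s p \<Longrightarrow> bnd a b (s + r) ((eop q ^^ r) p)"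
  by (induction r) (simp_all add: bnd_eop)

lemma mem_add: "mem a b s P \<Longrightarrow> mem a b s Q \<Longrightarrow> mem a b s (P + Q)"
  unfolding mem_def
proof (elim exE conjE)
  fix p p' r r'
  assume "P = p + p'" "Q = r + r'" "bnd a 0 s p" "bnd 0 b s p'" "bnd a 0 s r" "bnd 0 b s r'"
  then show "\<exists>p p'. P + Q = p + p' \<and> bnd a 0 s p \<and> bnd 0 b s p'"
    by (intro exI[of _ "p + r"] exI[of _ "p' + r'"]) (simp add: bnd_add)
qed

lemma mem_uminus: "mem a b s P \<Longrightarrow> mem a b s (- P)"
  unfolding mem_def by (metis bnd_uminus minus_add_distrib)

lemma mem_diff: "mem a b s P \<Longrightarrow> mem a b s Q \<Longrightarrow> mem a b s (P - Q)"
  using mem_add[OF _ mem_uminus] by fastforce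

lemma mem_bnd_left: "bnd a' b' s P \<Longrightarrow> a \<le> a' \<Longrightarrow> mem a b s P"
  unfolding mem_def by (intro exI[of _ P] exI[of _ 0]) (auto elim: bnd_weaken)

lemma mem_bnd_right: "bnd a' b' s P \<Longrightarrow> b \<le> b' \<Longrightarrow> mem a b s P"
  unfolding mem_def by (intro exI[of _ 0] exI[of _ P]) (auto elim: bnd_weaken)

lemma mem_smult: "mem a b s P \<Longrightarrow> mem a b s (smult c P)"
  unfolding mem_def by (metis bnd_smult smult_add_right)

lemma mem_coeff: "mem a b s P \<Longrightarrow> coeff P j \<noteq> 0 \<Longrightarrow> a \<le> j \<or> j + b \<le> s"
  unfolding mem_def bnd_def by (metis add_0 coeff_add)

subsection \<open>The cokernel of \<open>X + Y\<close>\<close>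

text \<open>The functional that spans the dual of the cokernel in each degree: the recursion for
  \<open>tri\<close> says exactly that it kills (X + Y) X^j. It does not see the power of Y, so one
  formula serves all degrees.\<close>

definition lam :: "'a::comm_ring_1 \<Rightarrow> 'a poly \<Rightarrow> 'a" where
  "lam q p = (\<Sum>j\<le>degree p. tri q j * coeff p j)"

lemma lam_eq: "degree p \<le> N \<Longrightarrow> lam q p = (\<Sum>j\<le>N. tri q j * coeff p j)"
  unfolding lam_def by (rule sum.mono_neutral_left) (auto simp: coeff_eq_0)

lemma lam_add: "lam q (p + p') = lam q p + lam q p'"
proof -
  define N where "N = max (degree p) (degree p')"
  have "degree (p + p') \<le> N" "degree p \<le> N" "degree p' \<le> N"
    by (auto simp: N_def degree_add_le_max)
  then show ?thesis by (simp add: lam_eq[of _ N] algebra_simps sum.distrib)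
qed

lemma lam_smult: "lam q (smult c p) = c * lam q p"
  unfolding lam_eq[OF degree_smult_le] by (simp add: lam_def sum_distrib_left mult.left_commute)

lemma lam_diff: "lam q (p - p') = lam q p - lam q p'"
  using lam_add[of q p "smult (-1) p'"] lam_smult[of q "-1" p'] by simp

lemma lam_0 [simp]: "lam q 0 = 0"
  by (simp add: lam_def)

lemma lam_monom: "lam q (monom c a) = tri q a * c"
proof -
  have "lam q (monom c a) = (\<Sum>j\<le>a. if j = a then tri q a * c else 0)"
    unfolding lam_eq[OF degree_monom_le] by (rule sum.cong) auto
  then show ?thesis by simp
qed

lemma degree_eop_le: "degree (eop q p) \<le> Suc (degree p)"
  using bnd_eop[of 0 0 "degree p" p q] by (simp add: bnd_degree)

lemma lam_eop [simp]: "lam q (eop q p) = 0"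
proof -
  have "(\<Sum>j\<le>Suc N. tri q j * coeff (eop q p) j) = - tri q (Suc (Suc N)) * coeff p (Suc N)" for N
    by (induction N) (simp_all add: coeff_eop tri_Suc algebra_simps)
  then show ?thesis
    by (simp add: lam_eq[OF degree_eop_le] coeff_eq_0)
qed

text \<open>Division by X + Y: the leading coefficient of \<open>eop q (monom 1 t)\<close> is 1, so
  leading terms can be removed until a constant remains, and \<open>lam\<close> reads off that
  constant. The alternative \<open>p' = 0\<close> covers t = 0, where no smaller degree
  exists.\<close>

lemma lam_eq_0_imp:
  fixes q :: "'k::field"
  assumes "degree p \<le> t" "lam q p = 0"
  shows "\<exists>p'. p = eop q p' \<and> (p' = 0 \<or> degree p' < t)"
  using assms
proof (induction t arbitrary: p)
  case 0
  then have "p = 0"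
    using leading_coeff_0_iff[of p] by (simp add: lam_def)
  then show ?case by (metis eop_0)
next
  case (Suc t)
  define c where "c = coeff p (Suc t)"
  define r where "r = p - eop q (monom c t)"
  have "degree r \<le> t"
  proof (rule degree_le, intro allI impI)
    fix i assume "t < i"
    then show "coeff r i = 0"
      using Suc.prems(1) by (cases "i = Suc t") (auto simp: r_def coeff_eop c_def coeff_eq_0 split: nat.split)
  qed
  moreover have "lam q r = 0" using Suc.prems(2) by (simp add: r_def lam_diff)
  ultimately obtain r' where r': "r = eop q r'" "r' = 0 \<or> degree r' < t"
    using Suc.IH by blast
  have "p = eop q (r' + monom c t)"
    using r'(1) by (simp add: r_def eop_add algebra_simps)
  moreover have "degree (r' + monom c t) \<le> t"
    by (rule degree_add_le) (use r'(2) degree_monom_le in auto)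
  ultimately show ?case by (metis less_Suc_eq_le)
qed

subsection \<open>Quantum Clebsch-Gordan vectors\<close>

text \<open>Quotients of factorials become products of q-numbers, here and in
  \<open>qfac_prod2\<close>. As functions of j the factors are affine in q^(-j), up to powers of
  q^j, which brings the theory of \<open>qdiff\<close> into play.\<close>

lemma qfac_prod1:
  assumes "j \<le> a" "a \<le> N"
  shows "qfac q (N - j) = qfac q (a - j) * (\<Prod>x\<in>{a<..N}. qnum q (x - j))"
  using assms(2)
proof (induction N rule: dec_induct)
  case (step N)
  have "{a<..Suc N} = insert (Suc N) {a<..N}" using step by auto
  then show ?case using step assms(1) by (simp add: Suc_diff_le qfac_Suc)
qed auto

lemma qfac_prod2:
  assumes "k \<le> b + j" "b \<le> N"
  shows "qfac q (N + j - k) = qfac q (b + j - k) * (\<Prod>x\<in>{b<..N}. qnum q (x + j - k))"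
  using assms(2)
proof (induction N rule: dec_induct)
  case (step N)
  have "{b<..Suc N} = insert (Suc N) {b<..N}" using step by auto
  then show ?case using step assms(1) by (simp add: Suc_diff_le qfac_Suc)
qed auto

text \<open>The coefficients are those of the highest weight vector of degree \<open>k\<close> in a tensor product of
  two simple modules over quantum \<open>sl\<^sub>2\<close>, of dimensions \<open>B + k + 1\<close> and \<open>A + k + 1\<close>.\<close>

definition qcg_vec :: "'k::field \<Rightarrow> nat \<Rightarrow> nat \<Rightarrow> nat \<Rightarrow> 'k poly" where
  "qcg_vec q A B k = (\<Sum>j\<le>k. monom (tri q j * qbinom q k j * qfac q (B + k - j) * qfac q (A + j) / q ^ (j * (j + A))) j)"

lemma coeff_qcg_vec:
  "coeff (qcg_vec q A B k) j = (if j \<le> k then tri q j * qbinom q k j * qfac q (B + k - j) * qfac q (A + j) / q ^ (j * (j + A)) else 0)"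
  by (simp add: qcg_vec_def coeff_sum)

lemma degree_qcg_vec: "degree (qcg_vec q A B k) \<le> k"
  by (rule degree_le) (simp add: coeff_qcg_vec)

text \<open>The coefficients of the vector are made so that the binomials of (X + Y)^r cancel
  against its factorials and leave a k-th q-difference. The function differenced is a product of A +
  B + k - r affine factors: one too few for a nonzero value if r = A + B + 1, just enough if r = A +
  B.\<close>

lemma coeff_eop_pow_qcg_vec:
  assumes q: "q \<noteq> 0" and ab: "a + b = r + k" "a \<le> B + k" "b \<le> A + k"
  shows "coeff ((eop q ^^ r) (qcg_vec q A B k)) a = qfac q r *
    qdiff q k (\<lambda>j. (\<Prod>x\<in>{a<..B + k}. qnum q x - q ^ x * qell q j) * (\<Prod>x\<in>{b<..A + k}. qell q j + qneg q x k))"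
proof -
  let ?g = "qcg_vec q A B k"
  define T where "T j = (if j \<le> a then qbinom q r (a - j) * q ^ (j * (r - (a - j))) * coeff ?g j else 0)" for j
  have "coeff ((eop q ^^ r) ?g) a = (\<Sum>j\<le>a. T j)"
    unfolding coeff_eop_pow
    by (rule sum.reindex_bij_witness[of _ "\<lambda>j. a - j" "\<lambda>i. a - i"]) (auto simp: T_def)
  also have "\<dots> = (\<Sum>j\<le>a + k. T j)"
    by (rule sum.mono_neutral_left) (auto simp: T_def)
  also have "\<dots> = (\<Sum>j\<le>k. T j)"
    by (rule sum.mono_neutral_right) (auto simp: T_def coeff_qcg_vec)
  also have "\<dots> = (\<Sum>j\<le>k. qfac q r * (tri q j * qbinom q k j * ((\<Prod>x\<in>{a<..B + k}. qnum q x - q ^ x * qell q j) * (\<Prod>x\<in>{b<..A + k}. qell q j + qneg q x k))))"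
  proof (rule sum.cong[OF refl])
    fix j assume "j \<in> {..k}"
    then have j: "j \<le> k" by simp
    let ?P1 = "\<Prod>x\<in>{a<..B + k}. qnum q x - q ^ x * qell q j"
    let ?P2 = "\<Prod>x\<in>{b<..A + k}. qell q j + qneg q x k"
    show "T j = qfac q r * (tri q j * qbinom q k j * (?P1 * ?P2))"
    proof (cases "j \<le> a \<and> k \<le> b + j")
      case True
      have "?P1 = (\<Prod>x\<in>{a<..B + k}. qnum q (x - j))"
        by (rule prod.cong) (use True in \<open>auto simp: qnum_diff q\<close>)
      then have 1: "qfac q (B + k - j) = qfac q (a - j) * ?P1"
        using qfac_prod1[of j a "B + k" q] ab True by simp
      have "?P2 = (\<Prod>x\<in>{b<..A + k}. qnum q (x + j - k) / q ^ j)"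
        by (rule prod.cong) (use True in \<open>auto simp: qneg_eq q\<close>)
      also have "\<dots> = (\<Prod>x\<in>{b<..A + k}. qnum q (x + j - k)) / q ^ (j * (A + k - b))"
        by (simp add: prod_dividef power_mult)
      finally have 2: "qfac q (A + j) = qfac q (b + j - k) * ?P2 * q ^ (j * (A + k - b))"
        using qfac_prod2[of k b j "A + k" q] ab True q by simp
      have r: "r = (a - j) + (b + j - k)" using ab True by simp
      then have 3: "qbinom q r (a - j) * (qfac q (a - j) * qfac q (b + j - k)) = qfac q r"
        using qbinom_qfac[of q "a - j" "b + j - k"] by simp
      have "b + j - k + (A + k - b) = j + A" using ab True by simp
      then have 4: "q ^ (j * (b + j - k)) * q ^ (j * (A + k - b)) = q ^ (j * (j + A))"
        by (metis distrib_left power_add)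
      have "T j = qbinom q r (a - j) * q ^ (j * (b + j - k)) *
         (tri q j * qbinom q k j * (qfac q (a - j) * ?P1) * (qfac q (b + j - k) * ?P2 * q ^ (j * (A + k - b))) / q ^ (j * (j + A)))"
        using True j r unfolding T_def coeff_qcg_vec 1 2 by simp
      also have "\<dots> = (qbinom q r (a - j) * (qfac q (a - j) * qfac q (b + j - k))) *
          (tri q j * qbinom q k j * (?P1 * ?P2)) * ((q ^ (j * (b + j - k)) * q ^ (j * (A + k - b))) / q ^ (j * (j + A)))"
        by (simp only: times_divide_eq_right ac_simps)
      also have "\<dots> = qfac q r * (tri q j * qbinom q k j * (?P1 * ?P2))"
        unfolding 3 4 using q by simp
      finally show ?thesis .
    next
      case False
      \<comment> \<open>Outside the admissible range the summand \<open>T j\<close> is zero; the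
        other side vanishes too, through the factor x = j of the first product or x = k - j of the
        second.\<close>
      then consider "a < j" | "j \<le> a" "b + j < k" by linarith
      then show ?thesis
      proof cases
        case 1
        have "qnum q j - q ^ j * qell q j = 0" using q by (simp add: qell_def)
        moreover have "j \<in> {a<..B + k}" using 1 j by simp
        ultimately have "?P1 = 0" by (intro prod_zero) auto
        then show ?thesis using 1 by (simp add: T_def)
      next
        case 2
        have "qell q j + qneg q (k - j) k = 0"
          using qneg_eq[of q k "k - j" j] q j by (simp add: qnum_def)
        moreover have "k - j \<in> {b<..A + k}" using 2 j by auto
        ultimately have "?P2 = 0" by (intro prod_zero) auto
        moreover have "r < a - j" using ab 2 by simp
        ultimately show ?thesis by (simp add: T_def qbinom_eq_0)
      qed
    qed
  qed
  finally show ?thesis by (simp add: qdiff_def sum_distrib_left)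
qed

lemma qaff_qell_affine: "q \<noteq> 0 \<Longrightarrow> qaff q (u - q * u - v) (\<lambda>j. u + v * qell q j)"
  unfolding qaff_def
proof
  fix j assume "q \<noteq> 0"
  then have "qell q j = q * qell q (Suc j) + (-1)"
    using qaff_qell[of q] unfolding qaff_def by blast
  then show "u + v * qell q j = q * (u + v * qell q (Suc j)) + (u - q * u - v)"
    by (simp only: algebra_simps) simp
qed

text \<open>With r = A + B + 1 the product has k - 1 affine factors, so its k-th q-difference is
  zero.\<close>

lemma qcg_vec_annihilated:
  assumes q: "q \<noteq> 0" and a: "B < a" "a \<le> B + k"
  shows "coeff ((eop q ^^ (A + B + 1)) (qcg_vec q A B k)) a = 0"
proof -
  define b where "b = A + B + 1 + k - a"
  have ab: "a + b = A + B + 1 + k" "b \<le> A + k" using a by (auto simp: b_def)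
  have "qpoly q (card {b<..A + k} + Suc 0) (\<lambda>j. (\<Prod>x\<in>{b<..A + k}. qneg q x k + 1 * qell q j) * 1)"
    by (rule qpoly_prod[OF _ qaff_qell_affine qpoly_const]) (use q in auto)
  then have "qpoly q (card {a<..B + k} + (card {b<..A + k} + Suc 0)) (\<lambda>j. (\<Prod>x\<in>{a<..B + k}. qnum q x + (- (q ^ x)) * qell q j) *
      ((\<Prod>x\<in>{b<..A + k}. qneg q x k + 1 * qell q j) * 1))"
    by (rule qpoly_prod[OF _ qaff_qell_affine, rotated 2]) (use q in auto)
  moreover have "card {a<..B + k} + (card {b<..A + k} + Suc 0) = k"
    using a ab by simp
  ultimately have "qpoly q k (\<lambda>j. (\<Prod>x\<in>{a<..B + k}. qnum q x - q ^ x * qell q j) * (\<Prod>x\<in>{b<..A + k}. qell q j + qneg q x k))"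
    by (simp add: add.commute del: qpoly.simps card_greaterThanAtMost)
  then show ?thesis
    using coeff_eop_pow_qcg_vec[OF q ab(1) a(2) ab(2)] by (simp add: qdiff_qpoly)
qed

text \<open>For r = A + B at this position the first product is empty and the second has exactly k
  factors, so the leading-coefficient formula \<open>qdiff_prod\<close> applies.\<close>

lemma qcg_vec_top_nonzero:
  assumes q: "q \<noteq> 0" and nz: "\<And>j. 0 < j \<Longrightarrow> j \<le> A + B + k \<Longrightarrow> qnum q j \<noteq> 0"
  shows "coeff ((eop q ^^ (A + B)) (qcg_vec q A B k)) (B + k) \<noteq> 0"
proof -
  have "coeff ((eop q ^^ (A + B)) (qcg_vec q A B k)) (B + k)
     = qfac q (A + B) * qdiff q (card {A<..A + k}) (\<lambda>j. \<Prod>x\<in>{A<..A + k}. qell q j + qneg q x k)"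
    using coeff_eop_pow_qcg_vec[OF q, of "B + k" A "A + B" k B A] by simp
  also have "\<dots> = qfac q (A + B) * (tri q k * qfac q k / q ^ (k * k))"
    by (subst qdiff_prod) (use q in auto)
  also have "\<dots> \<noteq> 0"
    using q nz by (auto intro!: qfac_nonzero simp: tri_nonzero)
  finally show ?thesis .
qed

text \<open>One sign factor comes from the functional and one from the vector; their product reduces
  the denominator q^(j(j+A)) to q^((A+1)j). What is left is the q-Vandermonde sum, hence a single
  binomial with nonzero factorials.\<close>

lemma lam_qcg_vec_nonzero:
  assumes q: "q \<noteq> 0" and nz: "\<And>j. 0 < j \<Longrightarrow> j \<le> A + B + k + 1 \<Longrightarrow> qnum q j \<noteq> 0"
  shows "lam q (qcg_vec q A B k) \<noteq> 0"
proof -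
  define C where "C = qfac q k * qfac q B * qfac q A / q ^ ((A + 1) * k)"
  have "lam q (qcg_vec q A B k) = (\<Sum>j\<le>k. tri q j * (tri q j * qbinom q k j * qfac q (B + k - j) * qfac q (A + j) / q ^ (j * (j + A))))"
    by (simp add: lam_eq[OF degree_qcg_vec] coeff_qcg_vec)
  also have "\<dots> = (\<Sum>j\<le>k. C * (qbinom q (A + j) j * qbinom q (B + (k - j)) (k - j) * q ^ ((A + 1) * (k - j))))"
  proof (rule sum.cong[OF refl])
    fix j assume "j \<in> {..k}"
    then have j: "j \<le> k" by simp
    have 1: "qfac q (A + j) = qbinom q (A + j) j * (qfac q j * qfac q A)"
      using qbinom_qfac[of q j A] by (simp add: add.commute)
    have 2: "qfac q (B + k - j) = qbinom q (B + (k - j)) (k - j) * (qfac q (k - j) * qfac q B)"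
      using qbinom_qfac[of q "k - j" B] j by (simp add: add.commute)
    have 3: "qbinom q k j * (qfac q j * qfac q (k - j)) = qfac q k"
      using qbinom_qfac[of q j "k - j"] j by simp
    have "(A + 1) * k = (A + 1) * j + (A + 1) * (k - j)"
      using j by (simp flip: distrib_left)
    then have 4: "q ^ ((A + 1) * k) = q ^ ((A + 1) * j) * q ^ ((A + 1) * (k - j))"
      by (simp only: power_add)
    have "tri q j * tri q j * q ^ ((A + 1) * j) = (tri q j * tri q j * q ^ j) * q ^ (j * A)"
      by (simp add: algebra_simps power_add)
    then have 5: "tri q j * tri q j * q ^ ((A + 1) * j) = q ^ (j * (j + A))"
      unfolding tri_square by (simp add: algebra_simps power_add)
    have "tri q j * (tri q j * qbinom q k j * qfac q (B + k - j) * qfac q (A + j) / q ^ (j * (j + A)))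
      = qbinom q (A + j) j * qbinom q (B + (k - j)) (k - j) * qfac q A * qfac q B *
         (qbinom q k j * (qfac q j * qfac q (k - j))) * (tri q j * tri q j / q ^ (j * (j + A)))"
      unfolding 1 2 by (simp only: times_divide_eq_right ac_simps)
    also have "tri q j * tri q j / q ^ (j * (j + A)) = 1 / q ^ ((A + 1) * j)"
      using q unfolding 5[symmetric] by (simp add: tri_nonzero)
    also have "\<dots> = q ^ ((A + 1) * (k - j)) / q ^ ((A + 1) * k)"
      using q unfolding 4 by simp
    finally show "tri q j * (tri q j * qbinom q k j * qfac q (B + k - j) * qfac q (A + j) / q ^ (j * (j + A)))
      = C * (qbinom q (A + j) j * qbinom q (B + (k - j)) (k - j) * q ^ ((A + 1) * (k - j)))"
      unfolding 3 C_def by (simp only: times_divide_eq_right times_divide_eq_left ac_simps)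
  qed
  also have "\<dots> = C * qbinom q (A + B + 1 + k) k"
    by (simp only: sum_distrib_left[symmetric] qbinom_vandermonde)
  finally have l: "lam q (qcg_vec q A B k) = C * qbinom q (A + B + 1 + k) k" .
  have "qbinom q (k + (A + B + 1)) k * (qfac q k * qfac q (A + B + 1)) \<noteq> 0"
    unfolding qbinom_qfac by (rule qfac_nonzero) (use nz in auto)
  then have "qbinom q (A + B + 1 + k) k \<noteq> 0" by (auto simp: add.commute)
  moreover have "C \<noteq> 0"
    unfolding C_def using q nz by (auto intro!: qfac_nonzero)
  ultimately show ?thesis using l by simp
qed

lemma mem_coeffI:
  assumes "\<And>j. coeff P j \<noteq> 0 \<Longrightarrow> j \<le> s \<and> (a \<le> j \<or> j + b \<le> s)"
  shows "mem a b s P"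
proof -
  define p' where "p' = poly_cutoff (s + 1 - b) P"
  have c: "coeff p' j = (if j + b \<le> s then coeff P j else 0)" for j
    by (auto simp: p'_def coeff_poly_cutoff)
  have "bnd 0 b s p'" by (simp add: bnd_def c)
  moreover have "bnd a 0 s (P - p')"
    unfolding bnd_def using assms by (fastforce simp: c split: if_splits)
  ultimately show ?thesis
    unfolding mem_def by (intro exI[of _ "P - p'"] exI[of _ p']) simp
qed

subsection \<open>The classical case \<open>q = 1\<close>\<close>

lemma eop_1: "eop 1 p = [:1, 1:] * p"
  by (rule poly_eqI) (simp add: coeff_eop coeff_pCons split: nat.split)

lemma eop_1_pow: "(eop 1 ^^ r) p = [:1, 1:] ^ r * p"
  by (induction r) (simp_all only: funpow.simps eop_1 id_apply comp_apply power_0 mult_1 power_Suc mult.assoc)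

text \<open>For commuting variables the cokernel of x + y is read off by setting x = -y.\<close>

lemma lam_1: "lam 1 p = poly p (-1)"
proof -
  have "tri 1 j = (-1 :: 'a) ^ j" for j
    by (induction j) (simp_all add: tri_Suc)
  then show ?thesis by (simp add: lam_def poly_altdef mult.commute)
qed

lemma qnum_1: "qnum 1 j = of_nat j"
  by (simp add: qnum_def)

lemma bnd_linear_pow: "bnd 0 0 r ([:1, 1:] ^ r :: 'a::comm_ring_1 poly)"
  using bnd_eop_pow[of 0 0 0 "1 :: 'a poly" r 1] by (simp add: eop_1_pow bnd_degree)

text \<open>Below both exponents this is the quantum vector at q = 1, where characteristic 0 keeps
  the q-numbers nonzero. The value 1 at -1 makes two such vectors of equal degree agree modulo x +
  y.\<close>

lemma clebsch_gordan:
  assumes "k \<le> a" "k \<le> b"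
  obtains g :: "'k::field_char_0 poly" where "bnd 0 0 k g" "poly g (-1) = 1"
    "mem a b (a + b - 1 - 2 * k + k) ([:1, 1:] ^ (a + b - 1 - 2 * k) * g)"
proof -
  consider "k = a" | "k = b" | "k < a" "k < b" using assms by linarith
  then have "\<exists>g :: 'k poly. bnd 0 0 k g \<and> poly g (-1) \<noteq> 0 \<and>
    mem a b (a + b - 1 - 2 * k + k) ([:1, 1:] ^ (a + b - 1 - 2 * k) * g)"
  proof cases
    \<comment> \<open>At the boundary k = a the monomial x^a already lies in the ideal. For k = b
      its counterpart is y^b, which is written 1 in the single variable.\<close>
    case 1
    let ?g = "monom 1 a :: 'k poly"
    have g: "bnd a 0 k ?g" using bnd_monom 1 by blast
    have "mem a b (a + b - 1 - 2 * k + k) ([:1, 1:] ^ (a + b - 1 - 2 * k) * ?g)"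
      using bnd_mult[OF bnd_linear_pow g] by (intro mem_bnd_left) auto
    then show ?thesis using g
      by (intro exI[of _ ?g]) (auto simp: poly_monom elim: bnd_weaken)
  next
    case 2
    have g: "bnd 0 b k (1 :: 'k poly)" using 2 by (simp add: bnd_def)
    have "mem a b (a + b - 1 - 2 * k + k) ([:1, 1:] ^ (a + b - 1 - 2 * k) * (1 :: 'k poly))"
      using bnd_mult[OF bnd_linear_pow g] by (intro mem_bnd_right) auto
    then show ?thesis using g
      by (intro exI[of _ 1]) (auto elim: bnd_weaken)
  next
    case 3
    define A B where "A = b - 1 - k" and "B = a - 1 - k"
    have ab: "a = B + k + 1" "b = A + k + 1" "a + b - 1 - 2 * k = A + B + 1"
      using 3 by (auto simp: A_def B_def)
    let ?g = "qcg_vec 1 A B k :: 'k poly"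
    have g: "bnd 0 0 k ?g" by (simp add: bnd_degree degree_qcg_vec)
    have "lam 1 ?g \<noteq> 0"
      by (rule lam_qcg_vec_nonzero) (auto simp: qnum_1)
    moreover have "mem a b (A + B + 1 + k) ((eop 1 ^^ (A + B + 1)) ?g)"
    proof (rule mem_coeffI)
      fix j assume j: "coeff ((eop 1 ^^ (A + B + 1)) ?g) j \<noteq> 0"
      have "j \<le> A + B + 1 + k"
        using bnd_eop_pow[OF g, of "A + B + 1" 1] j by (simp add: bnd_def add.commute del: funpow.simps)
      moreover have "\<not> (B < j \<and> j \<le> B + k)"
        using qcg_vec_annihilated[of "1::'k" B j k A] j by auto
      ultimately show "j \<le> A + B + 1 + k \<and> (a \<le> j \<or> j + b \<le> A + B + 1 + k)"
        using ab by linarith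
    qed
    ultimately show ?thesis using g unfolding ab(3) eop_1_pow lam_1 by blast
  qed
  then obtain g :: "'k poly" where g: "bnd 0 0 k g" "poly g (-1) \<noteq> 0"
    "mem a b (a + b - 1 - 2 * k + k) ([:1, 1:] ^ (a + b - 1 - 2 * k) * g)" by blast
  show thesis
    by (rule that[of "smult (inverse (poly g (-1))) g"])
      (use g in \<open>auto intro: bnd_smult mem_smult\<close>)
qed

lemma divide_linear:
  fixes p :: "'k::field poly"
  assumes "poly p (-1) = 0" "bnd 0 0 s p"
  obtains g where "p = [:1, 1:] * g" "g = 0 \<or> (s > 0 \<and> bnd 0 0 (s - 1) g)"
proof -
  obtain g where g: "p = [:1, 1:] * g"
    using assms(1) unfolding poly_eq_0_iff_dvd by (auto elim: dvdE)
  have "g = 0 \<or> (s > 0 \<and> bnd 0 0 (s - 1) g)"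
  proof (cases "g = 0")
    case False
    then have "degree p = Suc (degree g)"
      unfolding g by (subst degree_mult_eq) auto
    moreover have "degree p \<le> s" using assms(2) by (simp add: bnd_degree)
    ultimately show ?thesis by (auto simp: bnd_degree)
  qed simp
  with g that show thesis by blast
qed

subsection \<open>Generators at a root of unity\<close>

locale primitive_root =
  fixes q :: "'k::field_char_0" and d :: nat
  assumes d2: "d \<ge> 2" and root: "q ^ d = 1" and prim: "\<And>t. 0 < t \<Longrightarrow> t < d \<Longrightarrow> q ^ t \<noteq> 1"
begin

lemma q0: "q \<noteq> 0"
  using root d2 by (auto simp: power_0_left)

lemma q1: "q \<noteq> 1"
  using prim[of 1] d2 by simp

lemma qnum_nonzero: "0 < j \<Longrightarrow> j < d \<Longrightarrow> qnum q j \<noteq> 0"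
  using prim[of j] q1 by (simp add: qnum_geometric)

text \<open>The factorial of d contains the vanishing q-number of d, while those of i and d - i do
  not vanish.\<close>

lemma qbinom_d_eq_0:
  assumes "0 < i" "i < d"
  shows "qbinom q d i = 0"
proof -
  obtain d' where d': "d = Suc d'" using d2 by (cases d) auto
  have "qbinom q d i * (qfac q i * qfac q (d - i)) = qfac q d"
    using qbinom_qfac[of q i "d - i"] assms by simp
  also have "\<dots> = 0"
    using root q1 by (simp add: d' qfac_Suc qnum_geometric)
  finally show ?thesis
    using qfac_nonzero[of i q] qfac_nonzero[of "d - i" q] qnum_nonzero assms by auto
qed

text \<open>All inner q-binomials vanish, so (X + Y)^d = X^d + Y^d. In the single variable X^d is
  z^d, and Y^d acts as the identity because q^d = 1.\<close>

lemma eop_pow_d: "(eop q ^^ d) p = [:1, 1:] \<circ>\<^sub>p monom 1 d * p"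
proof (rule poly_eqI)
  fix a
  have "coeff ((eop q ^^ d) p) a = (\<Sum>i\<le>a. (if i = 0 then coeff p a else 0) + (if i = d then coeff p (a - d) else 0))"
    unfolding coeff_eop_pow
  proof (rule sum.cong[OF refl])
    fix i assume "i \<in> {..a}"
    consider "i = 0" | "0 < i" "i < d" | "i = d" | "d < i" by linarith
    then show "qbinom q d i * q ^ ((a - i) * (d - i)) * coeff p (a - i)
       = (if i = 0 then coeff p a else 0) + (if i = d then coeff p (a - d) else 0)"
    proof cases
      case 1
      have "q ^ (a * d) = 1" using root by (metis mult.commute power_mult power_one)
      then show ?thesis using 1 d2 by simp
    qed (use d2 in \<open>auto simp: qbinom_d_eq_0 qbinom_eq_0\<close>)
  qed
  also have "\<dots> = coeff p a + (if d \<le> a then coeff p (a - d) else 0)"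
    by (simp add: sum.distrib)
  also have "\<dots> = coeff ([:1, 1:] \<circ>\<^sub>p monom 1 d * p) a"
    by (simp add: pcompose_pCons distrib_right coeff_monom_mult not_le)
  finally show "coeff ((eop q ^^ d) p) a = coeff ([:1, 1:] \<circ>\<^sub>p monom 1 d * p) a" .
qed

text \<open>Embeds forms in x and y into the quantum plane. Here too y is set to 1, and a form of
  degree k becomes one of degree kd.\<close>

abbreviation zd :: "'k poly \<Rightarrow> 'k poly" where
  "zd G \<equiv> G \<circ>\<^sub>p monom 1 d"

lemma eop_zd: "eop q (zd G * p) = zd G * eop q p"
proof -
  have "monom 1 d \<circ>\<^sub>p [:0, q:] = monom 1 d"
    by (rule poly_eqI) (auto simp: coeff_pcompose_linear root)
  then have "(zd G * p) \<circ>\<^sub>p [:0, q:] = zd G * (p \<circ>\<^sub>p [:0, q:])"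
    by (simp add: pcompose_mult flip: pcompose_assoc)
  then show ?thesis by (simp add: eop_def algebra_simps)
qed

lemma eop_pow_zd: "(eop q ^^ r) (zd G * p) = zd G * (eop q ^^ r) p"
  by (induction r) (simp_all add: eop_zd)

lemma zd_mult: "zd (G * H) * p = zd G * (zd H * p)"
  by (simp add: pcompose_mult mult.assoc)

lemma eop_pow_mult_d: "(eop q ^^ (N * d)) p = zd ([:1, 1:] ^ N) * p"
proof (induction N)
  case (Suc N)
  have "(eop q ^^ (Suc N * d)) p = (eop q ^^ d) ((eop q ^^ (N * d)) p)"
    by (simp add: funpow_add)
  then show ?case
    by (simp only: Suc.IH eop_pow_d power_Suc zd_mult)
qed (simp add: pcompose_1)

lemma lam_eop_pow: "r > 0 \<Longrightarrow> lam q ((eop q ^^ r) p) = 0"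
  by (cases r) auto

text \<open>Modulo the image of X + Y one has x = -y, since x + y is a power of X + Y; a form in x
  and y therefore acts on the cokernel through its value at -1.\<close>

lemma lam_zd: "lam q (zd G * p) = poly G (-1) * lam q p"
proof (induction G)
  case (pCons c G)
  have "lam q ((eop q ^^ d) (zd G * p)) = 0"
    using d2 by (intro lam_eop_pow) simp
  then have "lam q (zd G * p + monom 1 d * (zd G * p)) = 0"
    by (simp add: eop_pow_d pcompose_pCons algebra_simps)
  then have "lam q (monom 1 d * (zd G * p)) = - lam q (zd G * p)"
    by (simp add: lam_add add_eq_0_iff)
  moreover have "zd (pCons c G) * p = smult c p + monom 1 d * (zd G * p)"
    by (simp add: pcompose_pCons algebra_simps)
  ultimately show ?case using pCons
    by (simp add: lam_add lam_smult algebra_simps)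
qed simp

lemma bnd_zd:
  assumes "bnd a b s G"
  shows "bnd (a * d) (b * d) (s * d) (zd G)"
proof -
  have "bnd (a * d) (b * d) (s * d) (monom c (j * d))" if "coeff G j = c" for c j
    using assms that d2 unfolding bnd_def by (auto simp flip: add_mult_distrib)
  moreover have "zd G = (\<Sum>j\<le>degree G. monom (coeff G j) (j * d))"
  proof -
    have "zd G = (\<Sum>j\<le>degree G. [:coeff G j:] * monom 1 d ^ j)"
      unfolding pcompose_altdef poly_altdef
      by (simp add: degree_map_poly coeff_map_poly)
    then show ?thesis by (simp add: monom_power smult_monom mult.commute)
  qed
  moreover have "bnd a b s (\<Sum>j\<in>J. F j)" if "finite J" "\<And>j. j \<in> J \<Longrightarrow> bnd a b s (F j)"
    for F :: "nat \<Rightarrow> 'k poly" and J a b s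
    using that by (induction J rule: finite_induct) (auto intro: bnd_add)
  ultimately show ?thesis by simp
qed

lemma bnd_zd_mult:
  assumes "bnd a b s G" "bnd a' b' s' p"
  shows "bnd (a * d + a') (b * d + b') (s * d + s') (zd G * p)"
  by (rule bnd_mult[OF bnd_zd[OF assms(1)] assms(2)])

text \<open>\<open>gen_len L M s r\<close>: the tensor product of \<open>V(0,L)\<close> and \<open>V(0,M)\<close> has an element of
  degree \<open>s\<close> outside the image of \<open>X + Y\<close> that is killed by \<open>(X + Y)\<^sup>r\<close>.\<close>

definition gen_len :: "nat \<Rightarrow> nat \<Rightarrow> nat \<Rightarrow> nat \<Rightarrow> bool" where
  "gen_len L M s r \<longleftrightarrow> (\<exists>w. bnd 0 0 s w \<and> lam q w \<noteq> 0 \<and> mem (Suc L) (Suc M) (s + r) ((eop q ^^ r) w))"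

text \<open>Multiplication by X^u Y^v raises the exponents ad and bd of the ideal to ad + u and bd +
  v. In a fixed degree the splitting into u and v and the pair (a, b) can still be chosen, which
  accounts for every string whose length is divisible by d.\<close>

lemma gen_len_full:
  assumes "k \<le> a" "k \<le> b" "L < a * d + u" "M < b * d + v"
  shows "gen_len L M (k * d + (u + v)) ((a + b - 1 - 2 * k) * d)"
proof -
  define N where "N = a + b - 1 - 2 * k"
  obtain g :: "'k poly" where g: "bnd 0 0 k g" "poly g (-1) = 1" "mem a b (N + k) ([:1, 1:] ^ N * g)"
    using clebsch_gordan[OF assms(1,2)] unfolding N_def .
  obtain p p' where p: "[:1, 1:] ^ N * g = p + p'" "bnd a 0 (N + k) p" "bnd 0 b (N + k) p'"
    using g(3) unfolding mem_def by blast
  have z: "bnd u v (u + v) (monom 1 u :: 'k poly)" by (simp add: bnd_def)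
  define w where "w = zd g * monom 1 u"
  have "bnd 0 0 (k * d + (u + v)) w"
    using bnd_zd_mult[OF g(1) z] unfolding w_def by (rule bnd_weaken) auto
  moreover have "lam q w \<noteq> 0"
    using q0 by (simp add: w_def lam_zd g lam_monom tri_nonzero)
  moreover have "mem (Suc L) (Suc M) (k * d + (u + v) + N * d) ((eop q ^^ (N * d)) w)"
  proof -
    have e: "(eop q ^^ (N * d)) w = zd p * monom 1 u + zd p' * monom 1 u"
      unfolding w_def eop_pow_mult_d zd_mult[symmetric] p(1)
      by (simp add: pcompose_add algebra_simps)
    have s: "k * d + (u + v) + N * d = (N + k) * d + (u + v)" by (simp add: algebra_simps)
    show ?thesis unfolding e s
      by (intro mem_add mem_bnd_left[OF bnd_zd_mult[OF p(2) z]] mem_bnd_right[OF bnd_zd_mult[OF p(3) z]])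
        (use assms in auto)
  qed
  ultimately show ?thesis unfolding gen_len_def N_def by blast
qed

text \<open>The number \<open>lam q u\<close> telescopes to the coefficient of \<open>X\<^sup>f\<close> in \<open>(X + Y)\<^sup>c\<^sup>-\<^sup>1 w\<close>,
  where \<open>c = f + h + 1 - 2i\<close>.\<close>

lemma small_generator:
  assumes "i \<le> f" "i \<le> h" "f + h + 1 - i < d"
  obtains w u U where "bnd 0 0 i w" "lam q w \<noteq> 0" "lam q u \<noteq> 0"
    "(eop q ^^ (f + h + 1 - 2 * i)) w = u + U"
    "bnd (Suc f) 0 (f + h + 1 - i) u" "bnd 0 (Suc h) (f + h + 1 - i) U"
proof -
  define A B where "A = h - i" and "B = f - i"
  have AB: "f + h + 1 - 2 * i = Suc (A + B)" "f = B + i" "f + h + 1 - i = A + B + i + 1"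
    using assms by (auto simp: A_def B_def)
  define w where "w = qcg_vec q A B i"
  define v where "v = (eop q ^^ (A + B)) w"
  \<comment> \<open>The cut is placed at X^(f+1). No monomial survives with exponent in the gap
    between B and f, so everything below the cut has exponent at most B and is divisible by
    Y^(h+1).\<close>
  define U where "U = poly_cutoff (Suc f) (eop q v)"
  define u where "u = eop q v - U"
  have cU: "coeff U j = (if j \<le> f then coeff (eop q v) j else 0)" for j
    by (simp add: U_def coeff_poly_cutoff less_Suc_eq_le)
  have w: "bnd 0 0 i w" by (simp add: w_def bnd_degree degree_qcg_vec)
  have nz: "qnum q j \<noteq> 0" if "0 < j" "j \<le> A + B + i + 1" for j
    using that assms AB by (intro qnum_nonzero) auto
  have v: "bnd 0 0 (Suc (A + B + i)) (eop q v)"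
    using bnd_eop[OF bnd_eop_pow[OF w, of "A + B" q]] by (simp add: v_def add_ac)
  have vanish: "coeff (eop q v) a = 0" if "B < a" "a \<le> f" for a
    using qcg_vec_annihilated[OF q0, of B a i A] that AB(2) by (simp add: v_def w_def)
  have "eop q v = (eop q ^^ (f + h + 1 - 2 * i)) w"
    unfolding AB(1) v_def by simp
  then have e: "(eop q ^^ (f + h + 1 - 2 * i)) w = u + U" by (simp add: u_def)
  have bu: "bnd (Suc f) 0 (f + h + 1 - i) u"
    using v unfolding AB(3) bnd_def u_def by (auto simp: cU split: if_splits)
  have bU: "bnd 0 (Suc h) (f + h + 1 - i) U"
    unfolding bnd_def
  proof (intro allI impI)
    fix j assume "coeff U j \<noteq> 0"
    then have "j \<le> f" "coeff (eop q v) j \<noteq> 0" by (auto simp: cU split: if_splits)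
    then have "j \<le> B" using vanish[of j] by (meson not_le)
    then show "0 \<le> j \<and> j + Suc h \<le> f + h + 1 - i" using assms by (auto simp: B_def)
  qed
  have "lam q u \<noteq> 0"
  proof -
    \<comment> \<open>Cutting v instead of (X + Y) v at the same place differs only by the term that
      X carries across the cut, from X^f to X^(f+1).\<close>
    define v2 where "v2 = v - poly_cutoff (Suc f) v"
    have c2: "coeff v2 j = (if j \<le> f then 0 else coeff v j)" for j
      by (simp add: v2_def coeff_poly_cutoff)
    have "u = eop q v2 + monom (coeff v f) (Suc f)"
    proof (rule poly_eqI)
      fix j show "coeff u j = coeff (eop q v2 + monom (coeff v f) (Suc f)) j"
        by (cases j) (auto simp: u_def cU c2 coeff_eop not_le less_Suc_eq_le)
    qed
    then have "lam q u = tri q (Suc f) * coeff v f"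
      by (simp add: lam_add lam_monom)
    moreover have "coeff v f \<noteq> 0"
      unfolding v_def w_def AB(2) by (rule qcg_vec_top_nonzero[OF q0]) (use nz in auto)
    ultimately show ?thesis using q0 by (simp add: tri_nonzero)
  qed
  moreover have "lam q w \<noteq> 0"
    unfolding w_def by (rule lam_qcg_vec_nonzero[OF q0]) (use nz in auto)
  ultimately show thesis using that[OF w _ _ e bu bU] by blast
qed

text \<open>
  Write \<open>x = X\<^sup>d\<close>, \<open>y = Y\<^sup>d\<close> and let \<open>w, u, U\<close> be as in \<open>small_generator\<close>.  Choose
  Clebsch-Gordan vectors \<open>g\<close> and \<open>G\<close> in \<open>x, y\<close> that agree modulo \<open>x + y\<close>, so that
  \<open>G - g = (x + y) g\<^sub>1\<close>.  Then \<open>(X + Y)\<^sup>c\<close> maps \<open>g w + (X + Y)\<^sup>d\<^sup>-\<^sup>c g\<^sub>1 u\<close> to \<open>G u + g U\<close>.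
\<close>

lemma gen_len_long:
  assumes i: "i \<le> f" "i \<le> h" "f + h + 1 - i < d" and fh: "f < d" "h < d" and k: "k \<le> e" "k \<le> m"
  shows "gen_len (e * d + f) (m * d + h) (k * d + i) ((e + m - 2 * k) * d + (f + h + 1 - 2 * i))"
proof -
  define c A where "c = f + h + 1 - 2 * i" and "A = e + m - 2 * k"
  have ic: "f + h + 1 - i = i + c" and c: "c \<le> d" "0 < c" "c < d" using i by (auto simp: c_def)
  obtain w u U where w: "bnd 0 0 i w" "lam q w \<noteq> 0" "lam q u \<noteq> 0"
    "(eop q ^^ c) w = u + U" "bnd (Suc f) 0 (i + c) u" "bnd 0 (Suc h) (i + c) U"
    using small_generator[OF i] unfolding ic c_def[symmetric] .
  \<comment> \<open>Both ideals, (x^(e+1), y^m) for \<open>g\<close> and (x^e, y^(m+1)) for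
    \<open>G\<close>, have the same sum of exponents, so one power A of x + y works for
    both.\<close>
  have eA: "e + 1 + m - 1 - 2 * k = A" "e + (m + 1) - 1 - 2 * k = A" by (auto simp: A_def)
  have k': "k \<le> e + 1" "k \<le> m + 1" using k by auto
  obtain g :: "'k poly"
    where g: "bnd 0 0 k g" "poly g (-1) = 1" "mem (e + 1) m (A + k) ([:1, 1:] ^ A * g)"
    using clebsch_gordan[OF k'(1) k(2)] unfolding eA .
  obtain G :: "'k poly"
    where G: "bnd 0 0 k G" "poly G (-1) = 1" "mem e (m + 1) (A + k) ([:1, 1:] ^ A * G)"
    using clebsch_gordan[OF k(1) k'(2)] unfolding eA .
  obtain P P' where P: "[:1, 1:] ^ A * G = P + P'" "bnd e 0 (A + k) P" "bnd 0 (m + 1) (A + k) P'"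
    using G(3) unfolding mem_def by blast
  obtain Q Q' where Q: "[:1, 1:] ^ A * g = Q + Q'" "bnd (e + 1) 0 (A + k) Q" "bnd 0 m (A + k) Q'"
    using g(3) unfolding mem_def by blast
  have Gg: "poly (G - g) (-1) = 0" using g(2) G(2) by simp
  have bGg: "bnd 0 0 k (G - g)" using bnd_add[OF G(1) bnd_uminus[OF g(1)]] by simp
  obtain g1 where g1: "G - g = [:1, 1:] * g1" "g1 = 0 \<or> (k > 0 \<and> bnd 0 0 (k - 1) g1)"
    by (rule divide_linear[OF Gg bGg])
  \<comment> \<open>Applying (X + Y)^c completes the correction to (x + y) g1 u = (G - g) u, which
    replaces the unsuitable g u by G u. As d - c > 0, it does not change the value of
    \<open>lam\<close>, and its degree (k - 1)d + (i + c) + (d - c) is the right one.\<close>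
  define w' where "w' = zd g * w + (eop q ^^ (d - c)) (zd g1 * u)"
  have "bnd 0 0 (k * d + i) ((eop q ^^ (d - c)) (zd g1 * u))"
  proof (cases "g1 = 0")
    case False
    then obtain k' where k': "k = Suc k'" and b: "bnd 0 0 k' g1" using g1 by (cases k) auto
    have "bnd 0 0 (k' * d + (i + c) + (d - c)) ((eop q ^^ (d - c)) (zd g1 * u))"
      by (rule bnd_eop_pow) (rule bnd_weaken[OF bnd_zd_mult[OF b w(5)]], auto)
    then show ?thesis by (rule bnd_weaken) (use c k' in auto)
  qed simp
  then have 1: "bnd 0 0 (k * d + i) w'"
    unfolding w'_def by (intro bnd_add) (use bnd_zd_mult[OF g(1) w(1)] in auto)
  have 2: "lam q w' \<noteq> 0"
    using w(2) c by (simp add: w'_def lam_add lam_zd lam_eop_pow g)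
  have "(eop q ^^ (A * d + c)) w' = (eop q ^^ (A * d)) ((eop q ^^ c) (zd g * w) + (eop q ^^ c) ((eop q ^^ (d - c)) (zd g1 * u)))"
    by (simp add: w'_def funpow_add eop_pow_add)
  also have "(eop q ^^ c) ((eop q ^^ (d - c)) (zd g1 * u)) = (eop q ^^ d) (zd g1 * u)"
    using c by (simp flip: comp_apply[of "eop q ^^ c"] funpow_add)
  also have "\<dots> = zd (G - g) * u"
    unfolding eop_pow_d g1(1) zd_mult ..
  also have "(eop q ^^ c) (zd g * w) = zd g * (u + U)"
    by (simp add: eop_pow_zd w)
  also have "zd g * (u + U) + zd (G - g) * u = zd G * u + zd g * U"
    by (simp add: pcompose_diff algebra_simps)
  also have "(eop q ^^ (A * d)) \<dots> = zd P * u + zd P' * u + (zd Q * U + zd Q' * U)"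
    unfolding eop_pow_mult_d distrib_left zd_mult[symmetric] P(1) Q(1)
    by (simp add: pcompose_add algebra_simps)
  finally have e: "(eop q ^^ (A * d + c)) w' = zd P * u + zd P' * u + (zd Q * U + zd Q' * U)" .
  have s: "k * d + i + (A * d + c) = (A + k) * d + (i + c)" by (simp add: algebra_simps)
  have "mem (Suc (e * d + f)) (Suc (m * d + h)) (k * d + i + (A * d + c)) ((eop q ^^ (A * d + c)) w')"
    unfolding e s
    by (intro mem_add mem_bnd_left[OF bnd_zd_mult[OF P(2) w(5)]] mem_bnd_right[OF bnd_zd_mult[OF P(3) w(5)]]
        mem_bnd_left[OF bnd_zd_mult[OF Q(2) w(6)]] mem_bnd_right[OF bnd_zd_mult[OF Q(3) w(6)]])
      (use fh in auto)
  then show ?thesis using 1 2 unfolding gen_len_def A_def c_def by blast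
qed

text \<open>
  Here the generator is \<open>g u + g\<^sub>1 (X + Y)\<^sup>c w\<close> with \<open>(x + y) g\<^sub>1 = H - x g\<close> for Clebsch-Gordan
  vectors \<open>g\<close> and \<open>H\<close> of degrees \<open>k\<close> and \<open>k + 1\<close>.
\<close>

lemma gen_len_short:
  assumes i: "i \<le> f" "i \<le> h" "f + h + 1 - i < d" and fh: "f < d" "h < d" and k: "k < e" "k < m"
  shows "gen_len (e * d + f) (m * d + h) (k * d + (f + h + 1 - i)) ((e + m - 2 * k) * d - (f + h + 1 - 2 * i))"
proof -
  define c A where "c = f + h + 1 - 2 * i" and "A = e + m - 1 - 2 * k"
  have ic: "f + h + 1 - i = i + c" and c: "c \<le> d" "0 < c" "c < d" using i by (auto simp: c_def)
  have A: "e + m - 2 * k = Suc A" using k by (simp add: A_def)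
  obtain w u U where w: "bnd 0 0 i w" "lam q w \<noteq> 0" "lam q u \<noteq> 0"
    "(eop q ^^ c) w = u + U" "bnd (Suc f) 0 (i + c) u" "bnd 0 (Suc h) (i + c) U"
    using small_generator[OF i] unfolding ic c_def[symmetric] .
  \<comment> \<open>Raising k and both exponents of the ideal by one leaves the power A unchanged,
    so \<open>g\<close> and \<open>H'\<close> are annihilated together.\<close>
  have eA: "e + 1 + (m + 1) - 1 - 2 * (k + 1) = A" by (auto simp: A_def)
  have k': "k \<le> e" "k \<le> m" "k + 1 \<le> e + 1" "k + 1 \<le> m + 1" using k by auto
  obtain g :: "'k poly"
    where g: "bnd 0 0 k g" "poly g (-1) = 1" "mem e m (A + k) ([:1, 1:] ^ A * g)"
    using clebsch_gordan[OF k'(1,2)] unfolding A_def[symmetric] .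
  obtain H' :: "'k poly"
    where H': "bnd 0 0 (k + 1) H'" "poly H' (-1) = 1" "mem (e + 1) (m + 1) (A + (k + 1)) ([:1, 1:] ^ A * H')"
    using clebsch_gordan[OF k'(3,4)] unfolding eA .
  \<comment> \<open>The sign is forced: x g takes the value -1 at -1, and H - x g has to be
    divisible by x + y.\<close>
  define H where "H = - H'"
  have H: "bnd 0 0 (k + 1) H" "poly H (-1) = -1" "mem (e + 1) (m + 1) (A + (k + 1)) ([:1, 1:] ^ A * H)"
    using H' mem_uminus[OF H'(3)] by (simp_all add: H_def bnd_uminus)
  obtain P P' where P: "[:1, 1:] ^ A * g = P + P'" "bnd e 0 (A + k) P" "bnd 0 m (A + k) P'"
    using g(3) unfolding mem_def by blast
  obtain Q Q' where Q: "[:1, 1:] ^ A * H = Q + Q'" "bnd (e + 1) 0 (A + (k + 1)) Q" "bnd 0 (m + 1) (A + (k + 1)) Q'"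
    using H(3) unfolding mem_def by blast
  let ?t = "monom 1 1 :: 'k poly"
  have t: "bnd 1 0 1 ?t" by (rule bnd_monom)
  have tg: "bnd 0 0 (k + 1) (?t * g)" using bnd_mult[OF t g(1)] by (auto elim: bnd_weaken)
  have bHg: "bnd 0 0 (k + 1) (H - ?t * g)" using bnd_add[OF H(1) bnd_uminus[OF tg]] by simp
  have Hg: "poly (H - ?t * g) (-1) = 0" using H(2) g(2) by (simp add: poly_monom)
  obtain g1 where g1: "H - ?t * g = [:1, 1:] * g1" "g1 = 0 \<or> (k + 1 > 0 \<and> bnd 0 0 (k + 1 - 1) g1)"
    by (rule divide_linear[OF Hg bHg])
  from g1(2) have bg1: "bnd 0 0 k g1" by auto
  \<comment> \<open>The second term lies in the image of X + Y, so \<open>lam\<close> sees only u,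
    which has a nonzero value by \<open>small_generator\<close>.\<close>
  define w' where "w' = zd g * u + zd g1 * (eop q ^^ c) w"
  have "bnd 0 0 (i + c) ((eop q ^^ c) w)" by (rule bnd_eop_pow[OF w(1)])
  then have 1: "bnd 0 0 (k * d + (i + c)) w'"
    unfolding w'_def
    by (intro bnd_add bnd_weaken[OF bnd_zd_mult[OF g(1) w(5)]] bnd_weaken[OF bnd_zd_mult[OF bg1]]) auto
  have 2: "lam q w' \<noteq> 0"
    using w(3) c by (simp add: w'_def lam_add lam_zd lam_eop_pow g)
  define u' U' where "u' = (eop q ^^ (d - c)) u" and "U' = (eop q ^^ (d - c)) U"
  have u': "bnd (Suc f) 0 (i + d) u'" "bnd 0 (Suc h) (i + d) U'"
    using bnd_eop_pow[OF w(5), of "d - c" q] bnd_eop_pow[OF w(6), of "d - c" q] c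
    by (simp_all add: u'_def U'_def)
  have dw: "(eop q ^^ (d - c)) ((eop q ^^ c) x) = zd [:1, 1:] * x" for x
    using c unfolding eop_pow_d[symmetric] by (simp flip: comp_apply[of "eop q ^^ (d - c)"] funpow_add)
  have uU: "u' = zd [:1, 1:] * w - U'"
    using dw[of w] unfolding w(4) by (simp add: u'_def U'_def eop_pow_add algebra_simps)
  have "Suc A * d - c = A * d + (d - c)" using c by simp
  then have "(eop q ^^ (Suc A * d - c)) w' = (eop q ^^ (A * d)) (zd g * u' + zd g1 * (zd [:1, 1:] * w))"
    by (simp only: w'_def funpow_add comp_apply eop_pow_add eop_pow_zd u'_def dw)
  also have "\<dots> = zd ([:1, 1:] ^ A) * (zd g * u' + zd (H - ?t * g) * w)"
    unfolding eop_pow_mult_d g1(1) by (simp only: pcompose_mult mult_ac)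
  also have "\<dots> = zd (P + P') * u' + zd (Q + Q') * w - zd (?t * (P + P')) * w"
    unfolding P(1)[symmetric] Q(1)[symmetric] by (simp add: pcompose_mult pcompose_diff algebra_simps)
  also have "\<dots> = zd P * u' + zd P' * u' + (zd Q * w + zd Q' * w) - zd (?t * P) * w - zd ?t * (zd P' * w)"
    by (simp add: pcompose_mult pcompose_add algebra_simps)
  \<comment> \<open>P' is divisible only by y^m, and u' supplies no further power of Y. Rewriting u'
    as (x + y) w - U' turns this term into y P' w - P' U', with enough powers of Y, and x P' w,
    which cancels the last term of the preceding line.\<close>
  also have "zd P' * u' = zd P' * w + zd ?t * (zd P' * w) - zd P' * U'"
    unfolding uU by (simp add: pcompose_pCons pcompose_mult monom_altdef algebra_simps)
  finally have e: "(eop q ^^ (Suc A * d - c)) w'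
      = zd P * u' + (zd P' * w - zd P' * U') + (zd Q * w + zd Q' * w) - zd (?t * P) * w"
    by simp
  have s: "k * d + (i + c) + (Suc A * d - c) = (A + k) * d + (i + d)"
    "(A + k) * d + (i + d) = (A + (k + 1)) * d + i"
    using c by (simp_all add: algebra_simps)
  have tP: "bnd (e + 1) 0 (A + (k + 1)) (?t * P)"
    using bnd_mult[OF t P(2)] by simp
  \<comment> \<open>This is y P' in disguise: multiplication by y only raises the degree of the form
    by one.\<close>
  have P'': "bnd 0 (m + 1) (A + (k + 1)) P'" by (rule bnd_weaken[OF P(3)]) auto
  have "mem (Suc (e * d + f)) (Suc (m * d + h)) ((A + k) * d + (i + d)) (zd P * u' - zd P' * U')"
    by (intro mem_diff mem_bnd_left[OF bnd_zd_mult[OF P(2) u'(1)]] mem_bnd_right[OF bnd_zd_mult[OF P(3) u'(2)]]) auto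
  moreover have "mem (Suc (e * d + f)) (Suc (m * d + h)) ((A + k) * d + (i + d))
     (zd P' * w + (zd Q * w + zd Q' * w) - zd (?t * P) * w)"
    unfolding s(2)
    by (intro mem_diff mem_add mem_bnd_left[OF bnd_zd_mult[OF Q(2) w(1)]] mem_bnd_right[OF bnd_zd_mult[OF Q(3) w(1)]]
        mem_bnd_left[OF bnd_zd_mult[OF tP w(1)]] mem_bnd_right[OF bnd_zd_mult[OF P'' w(1)]]) (use fh in auto)
  ultimately have "mem (Suc (e * d + f)) (Suc (m * d + h)) (k * d + (i + c) + (Suc A * d - c)) ((eop q ^^ (Suc A * d - c)) w')"
    unfolding s(1) e by (auto dest: mem_add simp: algebra_simps)
  then show ?thesis using 1 2 unfolding gen_len_def A c_def[symmetric] ic by blast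
qed

end

subsection \<open>Linear maps on free spaces\<close>

lemma lookup_scale [simp]: "Poly_Mapping.lookup (scale c x) a = c * Poly_Mapping.lookup x a"
  by (simp add: scale_def map.rep_eq when_def)

interpretation pm: vector_space "scale :: 'k::field \<Rightarrow> ('a \<Rightarrow>\<^sub>0 'k) \<Rightarrow> ('a \<Rightarrow>\<^sub>0 'k)"
  by standard (auto intro!: poly_mapping_eqI simp: lookup_add algebra_simps)

lemma lin_superset:
  fixes x :: "'a \<Rightarrow>\<^sub>0 'k::field"
  assumes "finite A" "Poly_Mapping.keys x \<subseteq> A"
  shows "lin \<phi> x = (\<Sum>a\<in>A. scale (Poly_Mapping.lookup x a) (\<phi> a))"
  unfolding lin_def
  by (rule sum.mono_neutral_left) (use assms in \<open>auto simp: in_keys_iff\<close>)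

lemma lin_add: "lin \<phi> (x + y) = lin \<phi> x + lin \<phi> (y :: 'a \<Rightarrow>\<^sub>0 'k::field)"
proof -
  let ?A = "Poly_Mapping.keys x \<union> Poly_Mapping.keys y"
  have "Poly_Mapping.keys (x + y) \<subseteq> ?A" by (rule Poly_Mapping.keys_add)
  then show ?thesis
    by (simp add: lin_superset[of ?A] lookup_add pm.scale_left_distrib sum.distrib)
qed

lemma lin_scale: "lin \<phi> (scale c x) = scale c (lin \<phi> (x :: 'a \<Rightarrow>\<^sub>0 'k::field))"
proof -
  have "Poly_Mapping.keys (scale c x) \<subseteq> Poly_Mapping.keys x" by (auto simp: in_keys_iff)
  then show ?thesis
    by (simp add: lin_superset[of "Poly_Mapping.keys x"] pm.scale_sum_right)
qed

lemma lin_0 [simp]: "lin \<phi> 0 = 0"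
  by (simp add: lin_def)

lemma lin_sum: "lin \<phi> (\<Sum>i\<in>I. f i) = (\<Sum>i\<in>I. lin \<phi> (f i :: 'a \<Rightarrow>\<^sub>0 'k::field))"
  by (induction I rule: infinite_finite_induct) (simp_all add: lin_add)

lemma lin_diff: "lin \<phi> (x - y) = lin \<phi> x - lin \<phi> (y :: 'a \<Rightarrow>\<^sub>0 'k::field)"
  using lin_add[of \<phi> "x - y" y] by simp

lemma lin_single: "lin \<phi> (Poly_Mapping.single a c) = scale c (\<phi> a :: 'b \<Rightarrow>\<^sub>0 'k::field)"
  by (simp add: lin_superset[of "{a}"])

lemma lin_bvec [simp]: "lin \<phi> (bvec a) = (\<phi> a :: 'b \<Rightarrow>\<^sub>0 'k::field)"
  by (simp add: lin_single)

lemma lin_cong: "(\<And>a. a \<in> Poly_Mapping.keys x \<Longrightarrow> \<phi> a = \<psi> a) \<Longrightarrow> lin \<phi> x = lin \<psi> x"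
  by (simp add: lin_def)

lemma lin_lin: "lin \<phi> (lin \<psi> x) = lin (\<lambda>a. lin \<phi> (\<psi> a)) (x :: 'a \<Rightarrow>\<^sub>0 'k::field)"
  unfolding lin_def[of \<psi>] lin_sum lin_scale by (simp add: lin_def)

lemma lookup_sum': "Poly_Mapping.lookup (\<Sum>i\<in>I. f i) a = (\<Sum>i\<in>I. Poly_Mapping.lookup (f i :: 'a \<Rightarrow>\<^sub>0 'k::field) a)"
  by (induction I rule: infinite_finite_induct) (simp_all add: lookup_add)

lemma lin_id: "lin bvec x = (x :: 'a \<Rightarrow>\<^sub>0 'k::field)"
proof (rule poly_mapping_eqI)
  fix a
  have "Poly_Mapping.lookup (lin bvec x) a
     = (\<Sum>b\<in>Poly_Mapping.keys x. if b = a then Poly_Mapping.lookup x a else 0)"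
    unfolding lin_def lookup_sum' by (rule sum.cong) (auto simp: lookup_single)
  then show "Poly_Mapping.lookup (lin bvec x) a = Poly_Mapping.lookup x a"
    by (simp add: in_keys_iff)
qed

lemma lin_sum_fun: "lin (\<lambda>a. \<Sum>i\<in>I. f i a) x = (\<Sum>i\<in>I. lin (f i) (x :: 'a \<Rightarrow>\<^sub>0 'k::field))"
  unfolding lin_def by (subst sum.swap) (simp add: pm.scale_sum_right)

lemma keys_lin_subset:
  fixes x :: "'a \<Rightarrow>\<^sub>0 'k::field"
  assumes "\<And>a. a \<in> Poly_Mapping.keys x \<Longrightarrow> Poly_Mapping.keys (\<phi> a) \<subseteq> B"
  shows "Poly_Mapping.keys (lin \<phi> x) \<subseteq> B"
proof
  fix b assume "b \<in> Poly_Mapping.keys (lin \<phi> x)"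
  then have "(\<Sum>a\<in>Poly_Mapping.keys x. Poly_Mapping.lookup x a * Poly_Mapping.lookup (\<phi> a) b) \<noteq> 0"
    by (simp add: in_keys_iff lin_def lookup_sum')
  then obtain a where "a \<in> Poly_Mapping.keys x" "Poly_Mapping.lookup (\<phi> a) b \<noteq> 0"
    by (metis (no_types, lifting) mult_zero_right sum.neutral)
  then show "b \<in> B" using assms[of a] by (auto simp: in_keys_iff)
qed

lemma keys_sum_subset:
  fixes f :: "'i \<Rightarrow> 'a \<Rightarrow>\<^sub>0 'k::field"
  assumes "\<And>i. i \<in> I \<Longrightarrow> Poly_Mapping.keys (f i) \<subseteq> B"
  shows "Poly_Mapping.keys (\<Sum>i\<in>I. f i) \<subseteq> B"
  using assms
proof (induction I rule: infinite_finite_induct)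
  case (insert i I)
  then show ?case using Poly_Mapping.keys_add[of "f i" "sum f I"] by auto
qed auto

lemma keys_scale_subset: "Poly_Mapping.keys (scale c x) \<subseteq> Poly_Mapping.keys (x :: 'a \<Rightarrow>\<^sub>0 'k::field)"
  by (auto simp: in_keys_iff)

lemma lin_pow_eq:
  fixes E :: "'a \<Rightarrow> ('a \<Rightarrow>\<^sub>0 'k::field)"
  shows "(lin E ^^ t) x = lin (\<lambda>v. (lin E ^^ t) (bvec v)) x"
  by (induction t) (simp_all add: lin_id lin_lin)

lemma lin_pow_0 [simp]:
  fixes E :: "'a \<Rightarrow> ('a \<Rightarrow>\<^sub>0 'k::field)"
  shows "(lin E ^^ t) 0 = 0"
  by (subst lin_pow_eq) simp

definition at_path :: "'p \<Rightarrow> ('a \<Rightarrow>\<^sub>0 'k) \<Rightarrow> (('a \<times> 'p) \<Rightarrow>\<^sub>0 'k::field)" where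
  "at_path p x = lin (\<lambda>a. bvec (a, p)) x"

lemma at_path_bvec [simp]: "at_path p (bvec a) = bvec (a, p)"
  and at_path_0 [simp]: "at_path p 0 = 0"
  by (simp_all add: at_path_def)

lemma lookup_at_path: "Poly_Mapping.lookup (at_path p x) (a, p') = (if p' = p then Poly_Mapping.lookup x a else 0)"
proof -
  have "Poly_Mapping.lookup (at_path p x) (a, p') = (\<Sum>b\<in>Poly_Mapping.keys x. if b = a then (if p' = p then Poly_Mapping.lookup x a else 0) else 0)"
    unfolding at_path_def lin_def lookup_sum' by (rule sum.cong) (auto simp: lookup_single when_def)
  then show ?thesis by (auto simp: in_keys_iff)
qed

lemma keys_at_path: "Poly_Mapping.keys (at_path p x) \<subseteq> Poly_Mapping.keys x \<times> {p}"
  unfolding at_path_def by (rule keys_lin_subset) auto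

lemma tens_bvec: "tens x (bvec p) = at_path p (x :: 'a \<Rightarrow>\<^sub>0 'k::field)"
  by (simp add: tens_def at_path_def)

lemma tens_bvec_left: "tens (bvec a) y = lin (\<lambda>b. bvec (a, b)) (y :: 'b \<Rightarrow>\<^sub>0 'k::field)"
  by (simp add: tens_def)

lemma tens_map_bvec_at_path: "tens_map \<phi> bvec (at_path p x) = at_path p (lin \<phi> (x :: 'a \<Rightarrow>\<^sub>0 'k::field))"
  by (simp add: tens_map_def at_path_def lin_lin tens_bvec)

lemma tens_map_bvec_sum: "tens_map \<phi> \<psi> (\<Sum>i\<in>I. f i) = (\<Sum>i\<in>I. tens_map \<phi> \<psi> (f i :: ('a \<times> 'b) \<Rightarrow>\<^sub>0 'k::field))"
  by (simp add: tens_map_def lin_sum)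

lemma at_path_sum: "at_path p (\<Sum>i\<in>I. f i) = (\<Sum>i\<in>I. at_path p (f i))"
  by (simp add: at_path_def lin_sum)

subsection \<open>Comodules as graded spaces with a nilpotent operator\<close>

text \<open>A comodule over the path coalgebra is a graded space with a nilpotent operator \<open>E\<close> of degree
  one.  The weights \<open>wt\<close> lift the grading from \<open>\<int>\<^sub>n\<close> to the natural numbers.\<close>

definition nilrep :: "nat \<Rightarrow> ('a, 'k::field) comod \<Rightarrow> ('a \<Rightarrow> nat) \<Rightarrow> ('a \<Rightarrow> ('a \<Rightarrow>\<^sub>0 'k)) \<Rightarrow> nat \<Rightarrow> bool" where
  "nilrep n U wt E T \<longleftrightarrow> n > 0 \<and> T > 0 \<and> finite (cbasis U) \<and>
     (\<forall>u\<in>cbasis U.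
        Poly_Mapping.keys (E u) \<subseteq> {v\<in>cbasis U. wt v = Suc (wt u)} \<and>
        (lin E ^^ T) (bvec u) = 0 \<and>
        coact U u = (\<Sum>t<T. at_path (wt u mod n, t) ((lin E ^^ t) (bvec u))))"

lemma nilrep_keys:
  assumes "nilrep n U wt E T" "Poly_Mapping.keys x \<subseteq> {v\<in>cbasis U. wt v = w}"
  shows "Poly_Mapping.keys ((lin E ^^ t) x) \<subseteq> {v\<in>cbasis U. wt v = w + t}"
proof (induction t)
  case (Suc t)
  have "Poly_Mapping.keys (lin E ((lin E ^^ t) x)) \<subseteq> {v\<in>cbasis U. wt v = w + Suc t}"
    by (rule keys_lin_subset) (use Suc assms(1) in \<open>fastforce simp: nilrep_def\<close>)
  then show ?case by simp
qed (use assms in simp)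

lemma nilrep_zero:
  assumes "nilrep n U wt E T" "Poly_Mapping.keys x \<subseteq> cbasis U" "T \<le> t"
  shows "(lin E ^^ t) x = 0"
proof -
  have "(lin E ^^ T) x = lin (\<lambda>_. 0) x"
    unfolding lin_pow_eq[of T E x] by (rule lin_cong) (use assms in \<open>auto simp: nilrep_def\<close>)
  then have "(lin E ^^ T) x = 0" by (simp add: lin_def)
  moreover have "(lin E ^^ t) x = (lin E ^^ (t - T)) ((lin E ^^ T) x)"
    using assms(3) by (simp flip: funpow_add comp_apply[of "lin E ^^ (t - T)"])
  ultimately show ?thesis by simp
qed

lemma nilrep_extend:
  assumes "nilrep n U wt E T" "T \<le> T'"
  shows "nilrep n U wt E T'"
proof -
  have "(\<Sum>t<T. at_path (wt u mod n, t) ((lin E ^^ t) (bvec u)))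
      = (\<Sum>t<T'. at_path (wt u mod n, t) ((lin E ^^ t) (bvec u)))" if "u \<in> cbasis U" for u
    by (rule sum.mono_neutral_left) (use that assms nilrep_zero[OF assms(1), of "bvec u"] in auto)
  moreover have "(lin E ^^ T') (bvec u) = 0" if "u \<in> cbasis U" for u
    using nilrep_zero[OF assms(1), of "bvec u" T'] that assms(2) by simp
  ultimately show ?thesis using assms unfolding nilrep_def by auto
qed

lemma nilrep_lin_coact:
  assumes "nilrep n U wt E T" "Poly_Mapping.keys x \<subseteq> {v\<in>cbasis U. wt v = w}"
  shows "lin (coact U) x = (\<Sum>t<T. at_path (w mod n, t) ((lin E ^^ t) x))"
proof -
  have "lin (coact U) x = lin (\<lambda>v. \<Sum>t<T. at_path (w mod n, t) ((lin E ^^ t) (bvec v))) x"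
    by (rule lin_cong) (use assms in \<open>auto simp: nilrep_def\<close>)
  also have "\<dots> = (\<Sum>t<T. at_path (w mod n, t) ((lin E ^^ t) x))"
    unfolding lin_sum_fun by (subst (2) lin_pow_eq) (simp add: at_path_def lin_lin)
  finally show ?thesis .
qed

text \<open>Coassociativity amounts to E^s E^t = E^(t+s): both sides collect the terms with t + s <
  T, either as a square truncated by nilpotence or along the diagonals.\<close>

lemma nilrep_obj:
  assumes U: "nilrep n U wt E T"
  shows "Cq_obj n U"
  unfolding Cq_obj_def
proof (intro conjI ballI)
  show "finite (cbasis U)" using U by (simp add: nilrep_def)
  fix u assume u: "u \<in> cbasis U"
  define w where "w = wt u"
  define x where "x t = (lin E ^^ t) (bvec u)" for t
  have c: "coact U u = (\<Sum>t<T. at_path (w mod n, t) (x t))"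
    using U u by (simp add: nilrep_def x_def w_def)
  have x: "Poly_Mapping.keys (x t) \<subseteq> {v\<in>cbasis U. wt v = w + t}" for t
    unfolding x_def by (rule nilrep_keys[OF U]) (use u in \<open>simp add: w_def\<close>)
  have x0: "x t = 0" if "T \<le> t" for t
    unfolding x_def by (rule nilrep_zero[OF U _ that]) (use u in auto)
  have n: "n > 0" "T > 0" using U by (auto simp: nilrep_def)
  show "Poly_Mapping.keys (coact U u) \<subseteq> cbasis U \<times> paths n"
    unfolding c
  proof (rule keys_sum_subset)
    fix t show "Poly_Mapping.keys (at_path (w mod n, t) (x t)) \<subseteq> cbasis U \<times> paths n"
      using keys_at_path[of "(w mod n, t)" "x t"] x[of t] n by (auto simp: paths_def)
  qed
  have assoc: "tens_assoc (at_path p (at_path p' y)) = at_path (p', p) y" for p p' and y :: "'a \<Rightarrow>\<^sub>0 'b"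
    by (simp add: tens_assoc_def at_path_def lin_lin)
  have xx: "(lin E ^^ s) (x t) = x (t + s)" for s t
    by (simp add: x_def add.commute[of t] funpow_add)
  define F where "F t s = at_path (((w + t) mod n, s), (w mod n, t)) (x (t + s))" for t s
  have "tens_assoc (tens_map (coact U) bvec (coact U u)) = (\<Sum>t<T. \<Sum>s<T. F t s)"
    unfolding c tens_map_bvec_sum tens_map_bvec_at_path nilrep_lin_coact[OF U x] at_path_sum
    by (simp add: tens_assoc_def lin_sum assoc[unfolded tens_assoc_def] F_def xx)
  also have "\<dots> = (\<Sum>(t, s)\<in>{..<T} \<times> {..<T}. F t s)"
    by (simp add: sum.cartesian_product)
  also have "\<dots> = (\<Sum>(t, s)\<in>{(t, s). t + s < T}. F t s)"
  proof (rule sum.mono_neutral_right)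
    show "\<forall>i\<in>{..<T} \<times> {..<T} - {(t, s). t + s < T}. (case i of (t, s) \<Rightarrow> F t s) = 0"
    proof
      fix i assume "i \<in> {..<T} \<times> {..<T} - {(t, s). t + s < T}"
      then obtain t s where "i = (t, s)" "T \<le> t + s" by (cases i) auto
      then show "(case i of (t, s) \<Rightarrow> F t s) = 0" by (simp add: F_def x0)
    qed
  qed auto
  also have "\<dots> = (\<Sum>N<T. \<Sum>j\<le>N. F j (N - j))"
    by (rule sum.triangle_reindex)
  also have "\<dots> = (\<Sum>N<T. tens_map bvec (comult n) (at_path (w mod n, N) (x N)))"
  proof (rule sum.cong[OF refl])
    fix N
    have "tens_map bvec (comult n) (at_path (w mod n, N) (x N))
        = lin (\<lambda>a. \<Sum>j\<le>N. bvec (a, (((w mod n + j) mod n, N - j), (w mod n, j)))) (x N)"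
      by (simp add: tens_map_def at_path_def lin_lin tens_bvec_left comult_def lin_sum)
    also have "\<dots> = (\<Sum>j\<le>N. F j (N - j))"
      unfolding lin_sum_fun by (rule sum.cong) (simp_all add: F_def at_path_def mod_simps)
    finally show "(\<Sum>j\<le>N. F j (N - j)) = tens_map bvec (comult n) (at_path (w mod n, N) (x N))" ..
  qed
  also have "\<dots> = tens_map bvec (comult n) (coact U u)"
    unfolding c tens_map_bvec_sum ..
  finally show "tens_assoc (tens_map (coact U) bvec (coact U u)) = tens_map bvec (comult n) (coact U u)" .
  have "lin (\<lambda>(v, p). scale (counit p) (bvec v)) (coact U u) = (\<Sum>t<T. scale (counit (w mod n, t)) (x t))"
    unfolding c lin_sum
  proof (rule sum.cong[OF refl])
    fix t
    have "lin (\<lambda>(v, p). scale (counit p) (bvec v)) (at_path (w mod n, t) (x t))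
        = lin (\<lambda>v. scale (counit (w mod n, t)) (bvec v)) (x t)"
      by (simp add: at_path_def lin_lin)
    also have "\<dots> = scale (counit (w mod n, t)) (lin bvec (x t))"
      by (simp add: lin_def pm.scale_sum_right mult.commute)
    finally show "lin (\<lambda>(v, p). scale (counit p) (bvec v)) (at_path (w mod n, t) (x t)) = scale (counit (w mod n, t)) (x t)"
      by (simp add: lin_id)
  qed
  also have "\<dots> = (\<Sum>t<T. if t = 0 then x 0 else 0)"
    by (rule sum.cong) (auto simp: counit_def)
  also have "\<dots> = bvec u" using n by (simp add: x_def)
  finally show "lin (\<lambda>(v, p). scale (counit p) (bvec v)) (coact U u) = bvec u" .
qed

definition nilhom :: "('a, 'k::field) comod \<Rightarrow> ('a \<Rightarrow> nat) \<Rightarrow> ('a \<Rightarrow> ('a \<Rightarrow>\<^sub>0 'k)) \<Rightarrow>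
    ('b, 'k) comod \<Rightarrow> ('b \<Rightarrow> nat) \<Rightarrow> ('b \<Rightarrow> ('b \<Rightarrow>\<^sub>0 'k)) \<Rightarrow> ('a \<Rightarrow> ('b \<Rightarrow>\<^sub>0 'k)) \<Rightarrow> bool" where
  "nilhom U wt E W wt' E' \<phi> \<longleftrightarrow> (\<forall>u\<in>cbasis U.
     Poly_Mapping.keys (\<phi> u) \<subseteq> {v\<in>cbasis W. wt' v = wt u} \<and> lin E' (\<phi> u) = lin \<phi> (E u))"

lemma nilhom_hom:
  assumes U: "nilrep n U wt E T" and W: "nilrep n W wt' E' T'" and \<phi>: "nilhom U wt E W wt' E' \<phi>"
  shows "Cq_hom n U W \<phi>"
proof -
  define S where "S = max T T'"
  have U': "nilrep n U wt E S" and W': "nilrep n W wt' E' S"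
    using U W by (auto intro: nilrep_extend simp: S_def)
  have comm: "lin E' (lin \<phi> x) = lin \<phi> (lin E x)" if "Poly_Mapping.keys x \<subseteq> cbasis U" for x
    unfolding lin_lin by (rule lin_cong) (use that \<phi> in \<open>auto simp: nilhom_def\<close>)
  show ?thesis
    unfolding Cq_hom_def
  proof (intro conjI ballI)
    show "Cq_obj n U" "Cq_obj n W" using U W by (auto intro: nilrep_obj)
    fix u assume u: "u \<in> cbasis U"
    show "Poly_Mapping.keys (\<phi> u) \<subseteq> cbasis W" using \<phi> u by (auto simp: nilhom_def)
    have pow: "(lin E' ^^ t) (\<phi> u) = lin \<phi> ((lin E ^^ t) (bvec u))" for t
    proof (induction t)
      case (Suc t)
      have "Poly_Mapping.keys ((lin E ^^ t) (bvec u)) \<subseteq> cbasis U"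
        using nilrep_keys[OF U, of "bvec u" "wt u" t] u by auto
      then show ?case using Suc by (simp add: comm)
    qed simp
    have "lin (coact W) (\<phi> u) = (\<Sum>t<S. at_path (wt u mod n, t) ((lin E' ^^ t) (\<phi> u)))"
      by (rule nilrep_lin_coact[OF W']) (use \<phi> u in \<open>auto simp: nilhom_def\<close>)
    also have "\<dots> = tens_map \<phi> bvec (coact U u)"
      using U' u by (simp add: nilrep_def tens_map_bvec_sum tens_map_bvec_at_path pow)
    finally show "lin (coact W) (\<phi> u) = tens_map \<phi> bvec (coact U u)" .
  qed
qed

text \<open>The images of \<open>A\<close> span a space that contains as many independent vectors as
  \<open>A\<close> has elements. If two of them coincided, or one depended on the others, fewer
  vectors would span it.\<close>

lemma lin_injective:
  fixes \<psi> :: "'a \<Rightarrow> ('b \<Rightarrow>\<^sub>0 'k::field)"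
  assumes A: "finite A" and B: "finite B" "card A = card B"
    and surj: "\<And>b. b \<in> B \<Longrightarrow> \<exists>x. Poly_Mapping.keys x \<subseteq> A \<and> lin \<psi> x = bvec b"
    and x: "Poly_Mapping.keys x \<subseteq> A" "lin \<psi> x = 0"
  shows "x = 0"
proof -
  let ?S = "(bvec :: 'b \<Rightarrow> 'b \<Rightarrow>\<^sub>0 'k) ` B"
  have inj: "inj (bvec :: 'b \<Rightarrow> 'b \<Rightarrow>\<^sub>0 'k)"
    by (rule injI) (metis lookup_single_eq lookup_single_not_eq zero_neq_one)
  have indS: "pm.independent ?S"
  proof (rule pm.independent_if_scalars_zero)
    fix f v assume f: "(\<Sum>v\<in>?S. scale (f v) v) = 0" and v: "v \<in> ?S"
    then obtain b where b: "b \<in> B" "v = bvec b" by auto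
    have "0 = Poly_Mapping.lookup (\<Sum>c\<in>B. scale (f (bvec c)) (bvec c)) b"
      using f by (subst (asm) sum.reindex) (auto intro: inj_on_subset[OF inj])
    also have "\<dots> = (\<Sum>c\<in>B. if c = b then f (bvec b) else 0)"
      unfolding lookup_sum' by (rule sum.cong) (auto simp: lookup_single)
    finally show "f v = 0" using b B by simp
  qed (use B in auto)
  have spanS: "?S \<subseteq> pm.span (\<psi> ` A)"
  proof
    fix v assume "v \<in> ?S"
    then obtain b x where "b \<in> B" "v = lin \<psi> x" "Poly_Mapping.keys x \<subseteq> A" using surj by force
    then show "v \<in> pm.span (\<psi> ` A)"
      unfolding lin_def by (auto intro!: pm.span_sum pm.span_scale intro: pm.span_base)
  qed
  have card: "card B \<le> card X" if "finite X" "?S \<subseteq> pm.span X" for X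
    using pm.independent_span_bound[OF that(1) indS that(2)] card_image[OF inj_on_subset[OF inj], of B] by simp
  have "card A \<le> card (\<psi> ` A)" using card[OF _ spanS] A B by simp
  then have inj\<psi>: "inj_on \<psi> A" using A by (simp add: card_image_le eq_card_imp_inj_on le_antisym)
  have "pm.independent (\<psi> ` A)"
  proof (rule ccontr)
    assume "\<not> pm.independent (\<psi> ` A)"
    then obtain v where v: "v \<in> \<psi> ` A" "v \<in> pm.span (\<psi> ` A - {v})"
      unfolding pm.dependent_def by blast
    have "\<psi> ` A \<subseteq> pm.span (\<psi> ` A - {v})"
    proof
      fix y assume "y \<in> \<psi> ` A"
      then show "y \<in> pm.span (\<psi> ` A - {v})"
        using v(2) pm.span_base[of y "\<psi> ` A - {v}"] by (cases "y = v") auto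
    qed
    then have "pm.span (\<psi> ` A) \<subseteq> pm.span (\<psi> ` A - {v})"
      by (rule pm.span_minimal) (rule pm.subspace_span)
    then have "card B \<le> card (\<psi> ` A - {v})" using card spanS A by auto
    moreover have "card (\<psi> ` A - {v}) < card (\<psi> ` A)" using v A by (intro card_Diff1_less) auto
    ultimately show False using card_image[OF inj\<psi>] B by simp
  qed
  moreover have "(\<Sum>v\<in>\<psi> ` A. scale (Poly_Mapping.lookup x (inv_into A \<psi> v)) v) = 0"
    using x(2) unfolding lin_superset[OF A x(1)]
    by (subst sum.reindex[OF inj\<psi>]) (simp add: inj\<psi> cong: sum.cong)
  ultimately have z: "Poly_Mapping.lookup x (inv_into A \<psi> v) = 0" if "v \<in> \<psi> ` A" for v
    by (rule pm.independentD[OF _ finite_imageI[OF A] subset_refl _ that])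
  show "x = 0"
  proof (rule poly_mapping_eqI)
    fix a show "Poly_Mapping.lookup x a = Poly_Mapping.lookup 0 a"
      using z[of "\<psi> a"] x(1) inj\<psi> by (cases "a \<in> A") (auto simp: in_keys_iff)
  qed
qed

text \<open>The inverse is chosen among homogeneous preimages, which makes it respect the weights;
  that it commutes with the operators follows from the injectivity of \<open>\<psi>\<close>.\<close>

lemma nilhom_iso:
  assumes W: "nilrep n W wt' E' T'" and U: "nilrep n U wt E T" and \<psi>: "nilhom U wt E W wt' E' \<psi>"
    and card: "card (cbasis U) = card (cbasis W)"
    and surj: "\<And>c. c \<in> cbasis W \<Longrightarrow> \<exists>x. Poly_Mapping.keys x \<subseteq> {u\<in>cbasis U. wt u = wt' c} \<and> lin \<psi> x = bvec c"
  shows "Cq_iso n W U"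
proof -
  have fin: "finite (cbasis U)" "finite (cbasis W)" using U W by (auto simp: nilrep_def)
  have surj': "\<exists>x. Poly_Mapping.keys x \<subseteq> cbasis U \<and> lin \<psi> x = bvec c" if "c \<in> cbasis W" for c
    using surj[OF that] by blast
  have inj: "x = y" if "Poly_Mapping.keys x \<subseteq> cbasis U" "Poly_Mapping.keys y \<subseteq> cbasis U" "lin \<psi> x = lin \<psi> y" for x y
  proof -
    have k: "Poly_Mapping.keys (x - y) \<subseteq> cbasis U"
      using that(1,2) keys_diff[of x y] by blast
    have l: "lin \<psi> (x - y) = 0" using that(3) by (simp add: lin_diff)
    have "x - y = 0" by (rule lin_injective[OF fin card surj' k l])
    then show ?thesis by simp
  qed
  define \<phi> where "\<phi> c = (SOME x. Poly_Mapping.keys x \<subseteq> {u\<in>cbasis U. wt u = wt' c} \<and> lin \<psi> x = bvec c)" for c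
  have \<phi>: "Poly_Mapping.keys (\<phi> c) \<subseteq> {u\<in>cbasis U. wt u = wt' c}" "lin \<psi> (\<phi> c) = bvec c"
    if "c \<in> cbasis W" for c
    using someI_ex[OF surj[OF that]] by (auto simp: \<phi>_def)
  have \<psi>\<phi>: "lin \<psi> (lin \<phi> y) = y" if "Poly_Mapping.keys y \<subseteq> cbasis W" for y
  proof -
    have "lin \<psi> (lin \<phi> y) = lin bvec y"
      unfolding lin_lin by (rule lin_cong) (use that \<phi> in auto)
    then show ?thesis by (simp add: lin_id)
  qed
  have k\<phi>: "Poly_Mapping.keys (lin \<phi> y) \<subseteq> cbasis U" if "Poly_Mapping.keys y \<subseteq> cbasis W" for y
    by (rule keys_lin_subset) (use that \<phi> in blast)
  have kE: "Poly_Mapping.keys (lin E y) \<subseteq> cbasis U" if "Poly_Mapping.keys y \<subseteq> cbasis U" for y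
    by (rule keys_lin_subset) (use that U in \<open>auto simp: nilrep_def\<close>)
  have kE': "Poly_Mapping.keys (E' c) \<subseteq> cbasis W" if "c \<in> cbasis W" for c
    using that W by (auto simp: nilrep_def)
  have comm: "lin E' (lin \<psi> x) = lin \<psi> (lin E x)" if "Poly_Mapping.keys x \<subseteq> cbasis U" for x
    unfolding lin_lin by (rule lin_cong) (use that \<psi> in \<open>auto simp: nilhom_def\<close>)
  have "nilhom W wt' E' U wt E \<phi>"
    unfolding nilhom_def
  proof (intro ballI conjI)
    fix c assume c: "c \<in> cbasis W"
    show "Poly_Mapping.keys (\<phi> c) \<subseteq> {v \<in> cbasis U. wt v = wt' c}" by (rule \<phi>(1)[OF c])
    then have k: "Poly_Mapping.keys (\<phi> c) \<subseteq> cbasis U" by blast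
    show "lin E (\<phi> c) = lin \<phi> (E' c)"
    proof (rule inj)
      show "lin \<psi> (lin E (\<phi> c)) = lin \<psi> (lin \<phi> (E' c))"
        unfolding \<psi>\<phi>[OF kE'[OF c]] comm[OF k, symmetric] \<phi>(2)[OF c] by simp
    qed (use k kE k\<phi> kE'[OF c] in blast)+
  qed
  then have "Cq_hom n W U \<phi>" by (rule nilhom_hom[OF W U])
  moreover have "Cq_hom n U W \<psi>" by (rule nilhom_hom[OF U W \<psi>])
  moreover have "lin \<phi> (\<psi> u) = bvec u" if u: "u \<in> cbasis U" for u
  proof -
    have k: "Poly_Mapping.keys (\<psi> u) \<subseteq> cbasis W" using \<psi> u by (auto simp: nilhom_def)
    show ?thesis by (rule inj) (use k k\<phi> u in \<open>auto simp: \<psi>\<phi>\<close>)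
  qed
  ultimately show ?thesis unfolding Cq_iso_def using \<phi>(2) by blast
qed

subsection \<open>The tensor product of two strings\<close>

text \<open>The image in \<open>V(0,L) \<otimes> V(0,M)\<close> of a form of degree \<open>s\<close>.\<close>

definition hmg :: "nat \<Rightarrow> nat \<Rightarrow> nat \<Rightarrow> 'k poly \<Rightarrow> ((nat \<times> nat) \<Rightarrow>\<^sub>0 'k::field)" where
  "hmg L M s p = (\<Sum>a | a \<le> L \<and> a \<le> s \<and> s \<le> a + M. Poly_Mapping.single (a, s - a) (coeff p a))"

lemma lookup_hmg:
  "Poly_Mapping.lookup (hmg L M s p) (a, b) = (if a \<le> L \<and> b \<le> M \<and> a + b = s then coeff p a else 0)"
proof -
  have "Poly_Mapping.lookup (hmg L M s p) (a, b)
      = (\<Sum>c | c \<le> L \<and> c \<le> s \<and> s \<le> c + M. if c = a then (if a + b = s then coeff p a else 0) else 0)"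
    unfolding hmg_def lookup_sum' by (rule sum.cong) (auto simp: lookup_single when_def)
  moreover have "finite {c. c \<le> L \<and> c \<le> s \<and> s \<le> c + M}" by (rule finite_subset[of _ "{..L}"]) auto
  ultimately show ?thesis by auto
qed

lemma hmg_add: "hmg L M s (p + p') = hmg L M s p + hmg L M s p'"
  by (rule poly_mapping_eqI) (auto simp: lookup_hmg lookup_add split: prod.split)

lemma hmg_smult: "hmg L M s (smult c p) = scale c (hmg L M s p)"
  by (rule poly_mapping_eqI) (auto simp: lookup_hmg split: prod.split)

lemma hmg_0 [simp]: "hmg L M s 0 = 0"
  by (simp add: hmg_def)

lemma keys_hmg: "Poly_Mapping.keys (hmg L M s p) \<subseteq> {(a, b). a \<le> L \<and> b \<le> M \<and> a + b = s}"
  by (auto simp: in_keys_iff lookup_hmg split: if_splits)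

lemma hmg_eq_0:
  assumes "mem (Suc L) (Suc M) s p"
  shows "hmg L M s p = 0"
  by (rule poly_mapping_eqI) (use mem_coeff[OF assms] in \<open>force simp: lookup_hmg\<close>)

lemma hmg_monom: "a \<le> L \<Longrightarrow> b \<le> M \<Longrightarrow> hmg L M (a + b) (monom 1 a) = bvec (a, b)"
  by (rule poly_mapping_eqI) (auto simp: lookup_hmg lookup_single when_def split: if_splits)

text \<open>Left multiplication by X + Y on the class of X^a Y^b; the truncation at L and M is
  inherited from \<open>hmg\<close>.\<close>

definition tenE :: "'k::field \<Rightarrow> nat \<Rightarrow> nat \<Rightarrow> nat \<times> nat \<Rightarrow> ((nat \<times> nat) \<Rightarrow>\<^sub>0 'k)" where
  "tenE q L M = (\<lambda>(a, b). hmg L M (Suc (a + b)) (eop q (monom 1 a)))"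

lemma lin_tenE:
  assumes "degree p \<le> s"
  shows "lin (tenE q L M) (hmg L M s p) = hmg L M (Suc s) (eop q p)"
proof (rule poly_mapping_eqI)
  fix z :: "nat \<times> nat"
  obtain x y where z: "z = (x, y)" by (cases z)
  let ?A = "{a. a \<le> L \<and> a \<le> s \<and> s \<le> a + M}"
  have fin: "finite ?A" by (rule finite_subset[of _ "{..L}"]) auto
  have "lin (tenE q L M) (hmg L M s p) = (\<Sum>a\<in>?A. scale (coeff p a) (hmg L M (Suc s) (eop q (monom 1 a))))"
    unfolding hmg_def[of L M s p] lin_sum lin_single by (rule sum.cong) (auto simp: tenE_def)
  then have l: "Poly_Mapping.lookup (lin (tenE q L M) (hmg L M s p)) (x, y)
     = (\<Sum>a\<in>?A. coeff p a * (if x \<le> L \<and> y \<le> M \<and> x + y = Suc s then coeff (eop q (monom 1 a)) x else 0))"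
    by (simp add: lookup_sum' lookup_hmg)
  show "Poly_Mapping.lookup (lin (tenE q L M) (hmg L M s p)) z = Poly_Mapping.lookup (hmg L M (Suc s) (eop q p)) z"
  proof (cases "x \<le> L \<and> y \<le> M \<and> x + y = Suc s")
    case True
    have "(\<Sum>a\<in>?A. coeff p a * coeff (eop q (monom 1 a)) x)
      = (\<Sum>a\<in>?A. (case x of 0 \<Rightarrow> 0 | Suc b \<Rightarrow> if a = b then coeff p b else 0) + (if a = x then q ^ x * coeff p x else 0))"
      by (rule sum.cong) (auto simp: coeff_eop algebra_simps split: nat.split)
    also have "\<dots> = (case x of 0 \<Rightarrow> 0 | Suc b \<Rightarrow> if b \<in> ?A then coeff p b else 0) + (if x \<in> ?A then q ^ x * coeff p x else 0)"
      unfolding sum.distrib using fin by (simp add: sum.delta split: nat.split)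
    also have "\<dots> = coeff (eop q p) x"
    proof -
      \<comment> \<open>The only exponent that could be missing is s + 1, which occurs for y = 0 and
        exceeds the degree of p.\<close>
      have "x \<in> ?A \<or> coeff p x = 0"
        using True assms by (cases y) (auto intro: coeff_eq_0)
      moreover have "b \<in> ?A" if "x = Suc b" for b using True that by auto
      ultimately show ?thesis by (auto simp: coeff_eop split: nat.split)
    qed
    finally show ?thesis using True unfolding z l by (simp add: lookup_hmg)
  next
    case False
    then have "Poly_Mapping.lookup (hmg L M (Suc s) (eop q p)) (x, y) = 0"
      unfolding lookup_hmg by (rule if_not_P)
    then show ?thesis unfolding z l if_not_P[OF False] by simp
  qed
qed

lemma lin_tenE_pow:
  assumes "degree p \<le> s"
  shows "(lin (tenE q L M) ^^ t) (hmg L M s p) = hmg L M (s + t) ((eop q ^^ t) p)"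
proof (induction t)
  case (Suc t)
  have "degree ((eop q ^^ t) p) \<le> s + t"
    using bnd_eop_pow[of 0 0 s p t q] assms by (simp add: bnd_degree)
  then show ?case using Suc by (simp add: lin_tenE)
qed simp

lemma coeff_eop_pow_monom:
  "coeff ((eop q ^^ t) (monom 1 a)) x = (if a \<le> x then qbinom q t (x - a) * q ^ (a * (t - (x - a))) else 0)"
proof -
  have "coeff ((eop q ^^ t) (monom 1 a)) x
      = (\<Sum>i\<le>x. if i = x - a then (if a \<le> x then qbinom q t (x - a) * q ^ (a * (t - (x - a))) else 0) else 0)"
    unfolding coeff_eop_pow by (rule sum.cong) auto
  then show ?thesis by simp
qed

text \<open>The product of the paths of lengths x - a and y - b contributes q^(a(y-b)) times a
  Gaussian binomial. By the q-binomial theorem this is the coefficient of X^x Y^y in (X + Y)^t X^a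
  Y^b, so the multiplication of the Hopf algebra encodes the quantum plane.\<close>

lemma ctensor_nilrep:
  assumes n: "n > 0" and q: "q ^ n = (1 :: 'k::field)"
  shows "nilrep n (ctensor n q (V n 0 L) (V n 0 M)) (\<lambda>(a, b). a + b) (tenE q L M) (Suc (L + M))"
    (is "nilrep n ?W ?wt ?E ?T")
proof -
  have basis: "cbasis ?W = {..L} \<times> {..M}" by (simp add: ctensor_def V_def)
  have pow: "(lin ?E ^^ t) (bvec (a, b)) = hmg L M (a + b + t) ((eop q ^^ t) (monom 1 a))"
    if "a \<le> L" "b \<le> M" for a b t
    unfolding hmg_monom[OF that, symmetric]
    by (rule lin_tenE_pow) (simp add: order.trans[OF degree_monom_le])
  have "coact ?W (a, b) = (\<Sum>t<?T. at_path ((a + b) mod n, t) ((lin ?E ^^ t) (bvec (a, b))))"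
    if ab: "a \<le> L" "b \<le> M" for a b
  proof (rule poly_mapping_eqI)
    fix k :: "(nat \<times> nat) \<times> path"
    obtain x y z t where k: "k = ((x, y), (z, t))" by (metis surj_pair)
    define c where "c j j' = q ^ ((a mod n) * (j' - b)) * gauss_binom (j - a + (j' - b)) (j - a) q" for j j'
    \<comment> \<open>The start of a path is known only modulo n; the hypothesis q^n = 1 permits
      computing with a itself.\<close>
    have qmod: "q ^ ((a mod n) * r) = q ^ (a * r)" for r
    proof -
      have "q ^ (a * r) = q ^ (n * (a div n) * r + (a mod n) * r)"
        by (metis add_mult_distrib mult_div_mod_eq)
      then show ?thesis by (simp add: power_add power_mult q)
    qed
    have ce: "coact ?W (a, b) = (\<Sum>j\<in>{a..L}. \<Sum>j'\<in>{b..M}.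
        scale (c j j') (bvec ((j, j'), ((a + b) mod n, j - a + (j' - b)))))"
      by (simp add: ctensor_def V_def tens_def lin_sum mult_def lin_single c_def mod_simps sum.swap[of _ "{b..M}"] add.commute[of b a])
    have "Poly_Mapping.lookup (coact ?W (a, b)) k = (\<Sum>j\<in>{a..L}. \<Sum>j'\<in>{b..M}.
       if j = x then (if j' = y then (if (z, t) = ((a + b) mod n, x - a + (y - b)) then c x y else 0) else 0) else 0)"
      unfolding ce lookup_sum' k by (intro sum.cong refl) (auto simp: lookup_single when_def)
    also have "\<dots> = (if x \<in> {a..L} \<and> y \<in> {b..M} \<and> (z, t) = ((a + b) mod n, x - a + (y - b)) then c x y else 0)"
    proof -
      have i: "(\<Sum>j'\<in>{b..M}. if j = x then (if j' = y then D else 0) else 0) = (if j = x then (if y \<in> {b..M} then D else 0) else 0)"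
        for j and D :: 'k by (simp add: sum.delta)
      have "(\<Sum>j\<in>{a..L}. \<Sum>j'\<in>{b..M}. if j = x then (if j' = y then D else 0) else 0) = (if x \<in> {a..L} \<and> y \<in> {b..M} then D else 0)" for D :: 'k
        unfolding i by (simp add: sum.delta)
      then show ?thesis by simp
    qed
    also have "\<dots> = (if z = (a + b) mod n \<and> t < ?T then
        (if x \<le> L \<and> y \<le> M \<and> x + y = a + b + t then coeff ((eop q ^^ t) (monom 1 a)) x else 0) else 0)"
    proof (cases "x \<le> L \<and> y \<le> M \<and> x + y = a + b + t \<and> z = (a + b) mod n \<and> a \<le> x")
      case True
      show ?thesis
      proof (cases "b \<le> y")
        case yb: True
        then have t: "t = x - a + (y - b)" using True by simp
        moreover have "t < ?T" using True by simp
        moreover have "t - (x - a) = y - b" "gauss_binom t (x - a) q = qbinom q t (x - a)"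
          using gauss_binom_eq[of "x - a" "y - b" q] t by simp_all
        ultimately show ?thesis using True yb
          by (simp add: coeff_eop_pow_monom c_def qmod del: diff_diff_right)
      next
        case False
        then have "t < x - a" using True by linarith
        then show ?thesis using True False by (simp add: coeff_eop_pow_monom qbinom_eq_0)
      qed
    next
      case False
      have l: "\<not> (x \<in> {a..L} \<and> y \<in> {b..M} \<and> (z, t) = ((a + b) mod n, x - a + (y - b)))"
      proof
        assume "x \<in> {a..L} \<and> y \<in> {b..M} \<and> (z, t) = ((a + b) mod n, x - a + (y - b))"
        then have "x \<le> L" "y \<le> M" "a \<le> x" "b \<le> y" "z = (a + b) mod n" "t = x - a + (y - b)" by auto
        then show False using False by linarith
      qed
      have r: "coeff ((eop q ^^ t) (monom 1 a)) x = 0" if "x \<le> L \<and> y \<le> M \<and> x + y = a + b + t" "z = (a + b) mod n"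
      proof -
        have "\<not> a \<le> x" using that False by blast
        then show ?thesis by (simp add: coeff_eop_pow_monom)
      qed
      show ?thesis unfolding if_not_P[OF l] using r by presburger
    qed
    also have "\<dots> = (\<Sum>t'<?T. if t' = t then (if z = (a + b) mod n then Poly_Mapping.lookup ((lin ?E ^^ t) (bvec (a, b))) (x, y) else 0) else 0)"
      by (simp add: pow[OF ab] lookup_hmg)
    also have "\<dots> = Poly_Mapping.lookup (\<Sum>t<?T. at_path ((a + b) mod n, t) ((lin ?E ^^ t) (bvec (a, b)))) k"
      unfolding lookup_sum' k by (rule sum.cong) (auto simp: lookup_at_path)
    finally show "Poly_Mapping.lookup (coact ?W (a, b)) k
      = Poly_Mapping.lookup (\<Sum>t<?T. at_path ((a + b) mod n, t) ((lin ?E ^^ t) (bvec (a, b)))) k" .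
  qed
  moreover have "(lin ?E ^^ ?T) (bvec (a, b)) = 0" if "a \<le> L" "b \<le> M" for a b
    unfolding pow[OF that] by (rule poly_mapping_eqI) (auto simp: lookup_hmg)
  moreover have "Poly_Mapping.keys (?E u) \<subseteq> {v\<in>cbasis ?W. ?wt v = Suc (?wt u)}" for u
    using keys_hmg[of L M "Suc (?wt u)"] by (fastforce simp: tenE_def basis split: prod.splits)
  ultimately show ?thesis
    using n by (auto simp: nilrep_def basis)
qed

subsection \<open>Direct sums of strings\<close>

text \<open>Strings can be indexed by their first degrees \<open>s \<in> I\<close>, because those that occur in the theorem
  all start in different degrees.\<close>

definition decomp :: "nat \<Rightarrow> ('a, 'k::field) comod \<Rightarrow> nat set \<Rightarrow> (nat \<Rightarrow> nat) \<Rightarrow> bool" where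
  "decomp n U I len \<longleftrightarrow> finite I \<and> (\<exists>\<beta>. bij_betw \<beta> (SIGMA s:I. {..len s}) (cbasis U) \<and>
     (\<forall>s\<in>I. \<forall>t\<le>len s. coact U (\<beta> (s, t)) = (\<Sum>j=t..len s. bvec (\<beta> (s, j), ((s + t) mod n, j - t)))))"

lemma decomp_V: "len s = l \<Longrightarrow> decomp n (V n s l) {s} len"
  unfolding decomp_def
  by (intro conjI exI[of _ snd]) (auto simp: V_def bij_betw_def inj_on_def image_iff)

lemma tens_map_bvec_bvec_sum:
  "tens_map (\<lambda>a. bvec (g a)) bvec (\<Sum>j\<in>J. bvec (f j, p j)) = (\<Sum>j\<in>J. bvec (g (f j), p j) :: _ \<Rightarrow>\<^sub>0 'k::field)"
  by (simp add: tens_map_def lin_sum tens_bvec)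

text \<open>Disjointness lets the starting degree alone identify the summand to which a string
  belongs; \<open>\<kappa>\<close> below recovers it.\<close>

lemma decomp_csum:
  assumes "finite K" "\<And>k. k \<in> K \<Longrightarrow> decomp n (U k) (I k) len"
    and disj: "\<And>k k'. k \<in> K \<Longrightarrow> k' \<in> K \<Longrightarrow> k \<noteq> k' \<Longrightarrow> I k \<inter> I k' = {}"
  shows "decomp n (csum K U) (\<Union>k\<in>K. I k) len"
proof -
  have "\<forall>k\<in>K. \<exists>\<beta>. bij_betw \<beta> (SIGMA s:I k. {..len s}) (cbasis (U k)) \<and>
     (\<forall>s\<in>I k. \<forall>t\<le>len s. coact (U k) (\<beta> (s, t)) = (\<Sum>j=t..len s. bvec (\<beta> (s, j), ((s + t) mod n, j - t))))"
    using assms(2) by (simp add: decomp_def)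
  from bchoice[OF this] obtain \<beta> where \<beta>: "\<And>k. k \<in> K \<Longrightarrow> bij_betw (\<beta> k) (SIGMA s:I k. {..len s}) (cbasis (U k))"
    "\<And>k s t. k \<in> K \<Longrightarrow> s \<in> I k \<Longrightarrow> t \<le> len s \<Longrightarrow>
       coact (U k) (\<beta> k (s, t)) = (\<Sum>j=t..len s. bvec (\<beta> k (s, j), ((s + t) mod n, j - t)))"
    by blast
  define \<kappa> where "\<kappa> s = (THE k. k \<in> K \<and> s \<in> I k)" for s
  have \<kappa>: "\<kappa> s = k" if "k \<in> K" "s \<in> I k" for k s
    unfolding \<kappa>_def using that disj by (intro the_equality) auto
  define B where "B = (\<lambda>(s, t). (\<kappa> s, \<beta> (\<kappa> s) (s, t)))"
  have "bij_betw B (SIGMA s:(\<Union>k\<in>K. I k). {..len s}) (cbasis (csum K U))"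
  proof (rule bij_betw_imageI)
    show "inj_on B (SIGMA s:(\<Union>k\<in>K. I k). {..len s})"
    proof (rule inj_onI)
      fix u v assume u: "u \<in> (SIGMA s:(\<Union>k\<in>K. I k). {..len s})" and v: "v \<in> (SIGMA s:(\<Union>k\<in>K. I k). {..len s})"
        and e: "B u = B v"
      obtain k where k: "k \<in> K" "fst u \<in> I k" using u by auto
      obtain k' where k': "k' \<in> K" "fst v \<in> I k'" using v by auto
      have kk: "k = k'" using e \<kappa>[OF k] \<kappa>[OF k'] by (auto simp: B_def split: prod.splits)
      then have "\<beta> k u = \<beta> k v" using e \<kappa>[OF k] \<kappa>[OF k'] by (auto simp: B_def split: prod.splits)
      moreover have "inj_on (\<beta> k) (SIGMA s:I k. {..len s})" using \<beta>(1)[OF k(1)] by (simp add: bij_betw_def)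
      ultimately show "u = v" using u v k k' kk by (elim inj_onD) (auto simp: mem_Sigma_iff)
    qed
    show "B ` (SIGMA s:(\<Union>k\<in>K. I k). {..len s}) = cbasis (csum K U)"
    proof (intro equalityI subsetI)
      fix y assume "y \<in> B ` (SIGMA s:(\<Union>k\<in>K. I k). {..len s})"
      then obtain s t k where "k \<in> K" "s \<in> I k" "t \<le> len s" "y = B (s, t)" by auto
      then show "y \<in> cbasis (csum K U)"
        using bij_betwE[OF \<beta>(1)[of k]] by (auto simp: B_def \<kappa> csum_def)
    next
      fix y assume "y \<in> cbasis (csum K U)"
      then obtain k u where k: "k \<in> K" "u \<in> cbasis (U k)" "y = (k, u)" by (auto simp: csum_def)
      then obtain s t where "s \<in> I k" "t \<le> len s" "u = \<beta> k (s, t)"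
        using \<beta>(1)[OF k(1)] by (fastforce simp: bij_betw_def)
      then show "y \<in> B ` (SIGMA s:(\<Union>k\<in>K. I k). {..len s})"
        using k by (intro image_eqI[of _ _ "(s, t)"]) (auto simp: B_def \<kappa>)
    qed
  qed
  moreover have "coact (csum K U) (B (s, t)) = (\<Sum>j=t..len s. bvec (B (s, j), ((s + t) mod n, j - t)))"
    if "k \<in> K" "s \<in> I k" "t \<le> len s" for k s t
    using that \<beta>(2)[OF that] by (simp add: B_def \<kappa> csum_def tens_map_bvec_bvec_sum)
  moreover have "finite (\<Union>k\<in>K. I k)" using assms by (auto simp: decomp_def)
  ultimately show ?thesis unfolding decomp_def by blast
qed

lemma decomp_cplus:
  assumes "decomp n U I len" "decomp n W J len" and disj: "I \<inter> J = {}"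
  shows "decomp n (U \<oplus> W) (I \<union> J) len"
proof -
  obtain \<beta> where \<beta>: "bij_betw \<beta> (SIGMA s:I. {..len s}) (cbasis U)"
    "\<And>s t. s \<in> I \<Longrightarrow> t \<le> len s \<Longrightarrow> coact U (\<beta> (s, t)) = (\<Sum>j=t..len s. bvec (\<beta> (s, j), ((s + t) mod n, j - t)))"
    using assms(1) by (auto simp: decomp_def)
  obtain \<gamma> where \<gamma>: "bij_betw \<gamma> (SIGMA s:J. {..len s}) (cbasis W)"
    "\<And>s t. s \<in> J \<Longrightarrow> t \<le> len s \<Longrightarrow> coact W (\<gamma> (s, t)) = (\<Sum>j=t..len s. bvec (\<gamma> (s, j), ((s + t) mod n, j - t)))"
    using assms(2) by (auto simp: decomp_def)
  define B where "B u = (if fst u \<in> I then Inl (\<beta> u) else Inr (\<gamma> u))" for u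
  have "bij_betw B (SIGMA s:I \<union> J. {..len s}) (cbasis (U \<oplus> W))"
  proof -
    have S: "(SIGMA s:I \<union> J. {..len s}) = (SIGMA s:I. {..len s}) \<union> (SIGMA s:J. {..len s})" by auto
    have "bij_betw B (SIGMA s:I. {..len s}) (Inl ` cbasis U)"
      by (rule bij_betw_cong[THEN iffD1, OF _ bij_betw_trans[OF \<beta>(1), of Inl]])
        (auto simp: B_def bij_betw_def)
    moreover have "bij_betw B (SIGMA s:J. {..len s}) (Inr ` cbasis W)"
      by (rule bij_betw_cong[THEN iffD1, OF _ bij_betw_trans[OF \<gamma>(1), of Inr]])
        (use disj in \<open>auto simp: B_def bij_betw_def\<close>)
    ultimately show ?thesis
      unfolding S cplus_def by (auto simp: Plus_def intro!: bij_betw_combine)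
  qed
  moreover have "coact (U \<oplus> W) (B (s, t)) = (\<Sum>j=t..len s. bvec (B (s, j), ((s + t) mod n, j - t)))"
    if "s \<in> I \<union> J" "t \<le> len s" for s t
    using that disj \<beta>(2)[of s t] \<gamma>(2)[of s t]
    by (cases "s \<in> I") (auto simp: B_def cplus_def tens_map_bvec_bvec_sum)
  moreover have "finite (I \<union> J)" using assms by (auto simp: decomp_def)
  ultimately show ?thesis unfolding decomp_def by blast
qed

subsection \<open>Decomposition of the tensor product\<close>

context primitive_root
begin

text \<open>Each string is sent to the orbit of its generator under X + Y; this is well defined
  because the generator is killed in time, and surjective because the generators span the
  cokernel.\<close>

lemma iso_of_gen_len:
  assumes n: "n > 0" "q ^ n = 1" and U: "decomp n U {..L} len"
    and gen: "\<And>s. s \<le> L \<Longrightarrow> gen_len L M s (Suc (len s))"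
    and dim: "(\<Sum>s\<le>L. Suc (len s)) = Suc L * Suc M"
  shows "Cq_iso n (ctensor n q (V n 0 L) (V n 0 M)) U"
proof -
  obtain \<beta> where \<beta>: "bij_betw \<beta> (SIGMA s:{..L}. {..len s}) (cbasis U)"
    and co: "\<And>s t. s \<le> L \<Longrightarrow> t \<le> len s \<Longrightarrow> coact U (\<beta> (s, t)) = (\<Sum>j=t..len s. bvec (\<beta> (s, j), ((s + t) mod n, j - t)))"
    using U by (auto simp: decomp_def)
  define \<pi> where "\<pi> = inv_into (SIGMA s:{..L}. {..len s}) \<beta>"
  have \<pi>: "\<pi> (\<beta> (s, t)) = (s, t)" if "s \<le> L" "t \<le> len s" for s t
    unfolding \<pi>_def by (rule inv_into_f_f) (use \<beta> that in \<open>auto simp: bij_betw_def\<close>)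
  have basisI: "\<beta> (s, t) \<in> cbasis U" if "s \<le> L" "t \<le> len s" for s t
    using bij_betwE[OF \<beta>] that by auto
  have basisE: "\<exists>s t. s \<le> L \<and> t \<le> len s \<and> u = \<beta> (s, t)" if "u \<in> cbasis U" for u
    using \<beta> that by (fastforce simp: bij_betw_def)
  \<comment> \<open>For s > L the default X^s has a nonzero value under \<open>lam\<close> but lies
    in the ideal. Thus the induction for surjectivity treats all degrees alike, although no string
    starts there.\<close>
  define w where "w s = (if s \<le> L then SOME w. bnd 0 0 s w \<and> lam q w \<noteq> 0 \<and>
      mem (Suc L) (Suc M) (s + Suc (len s)) ((eop q ^^ Suc (len s)) w) else monom 1 s)" for s
  have wL: "bnd 0 0 s (w s) \<and> lam q (w s) \<noteq> 0 \<and>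
      mem (Suc L) (Suc M) (s + Suc (len s)) ((eop q ^^ Suc (len s)) (w s))" if "s \<le> L" for s
    using someI_ex[OF gen[OF that, unfolded gen_len_def]] that by (simp add: w_def)
  have w: "degree (w s) \<le> s" "lam q (w s) \<noteq> 0" for s
    using wL[of s] q0 by (cases "s \<le> L"; auto simp: w_def bnd_degree lam_monom tri_nonzero degree_monom_le)+
  define wt where "wt u = fst (\<pi> u) + snd (\<pi> u)" for u
  define E where "E u = (case \<pi> u of (s, t) \<Rightarrow> if t < len s then bvec (\<beta> (s, Suc t)) else (0 :: _ \<Rightarrow>\<^sub>0 'k))" for u
  define \<psi> where "\<psi> u = (case \<pi> u of (s, t) \<Rightarrow> hmg L M (s + t) ((eop q ^^ t) (w s)))" for u
  define T where "T = Suc (\<Sum>s\<le>L. len s)"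
  have lenT: "len s < T" if "s \<le> L" for s
    using member_le_sum[of s "{..L}" len] that by (simp add: T_def)
  have pow: "(lin E ^^ j) (bvec (\<beta> (s, t))) = (if t + j \<le> len s then bvec (\<beta> (s, t + j)) else 0)"
    if "s \<le> L" "t \<le> len s" for s t j
    by (induction j) (use that in \<open>auto simp: E_def \<pi>\<close>)
  let ?W = "ctensor n q (V n 0 L) (V n 0 M)"
  have W: "nilrep n ?W (\<lambda>(a, b). a + b) (tenE q L M) (Suc (L + M))"
    by (rule ctensor_nilrep[OF n])
  have basisW: "cbasis ?W = {..L} \<times> {..M}" by (simp add: ctensor_def V_def)
  have UU: "nilrep n U wt E T"
    unfolding nilrep_def
  proof (intro conjI ballI)
    show "n > 0" "T > 0" "finite (cbasis U)"
      using n \<beta> by (auto simp: T_def dest: bij_betw_finite)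
    fix u assume "u \<in> cbasis U"
    then obtain s t where st: "s \<le> L" "t \<le> len s" "u = \<beta> (s, t)" using basisE by blast
    show "Poly_Mapping.keys (E u) \<subseteq> {v \<in> cbasis U. wt v = Suc (wt u)}"
      using st basisI by (auto simp: E_def wt_def \<pi>)
    show "(lin E ^^ T) (bvec u) = 0"
      using st lenT[of s] by (simp add: pow)
    have "coact U u = (\<Sum>j=t..len s. bvec (\<beta> (s, j), ((s + t) mod n, j - t)))"
      using co st by simp
    also have "\<dots> = (\<Sum>j\<in>{..len s - t}. bvec (\<beta> (s, t + j), ((s + t) mod n, j)))"
      by (rule sum.reindex_bij_witness[of _ "\<lambda>j. t + j" "\<lambda>j. j - t"]) (use st in auto)
    also have "\<dots> = (\<Sum>j\<in>{..len s - t}. at_path (wt u mod n, j) ((lin E ^^ j) (bvec u)))"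
      by (rule sum.cong) (use st in \<open>auto simp: pow wt_def \<pi>\<close>)
    also have "\<dots> = (\<Sum>j<T. at_path (wt u mod n, j) ((lin E ^^ j) (bvec u)))"
      by (rule sum.mono_neutral_left) (use st lenT[of s] in \<open>auto simp: pow\<close>)
    finally show "coact U u = (\<Sum>j<T. at_path (wt u mod n, j) ((lin E ^^ j) (bvec u)))" .
  qed
  have deg: "degree ((eop q ^^ t) (w s)) \<le> s + t" for s t
    using bnd_eop_pow[of 0 0 s "w s" t q] w(1) by (simp add: bnd_degree)
  have \<psi>: "nilhom U wt E ?W (\<lambda>(a, b). a + b) (tenE q L M) \<psi>"
    unfolding nilhom_def
  proof (intro ballI conjI)
    fix u assume "u \<in> cbasis U"
    then obtain s t where st: "s \<le> L" "t \<le> len s" "u = \<beta> (s, t)" using basisE by blast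
    show "Poly_Mapping.keys (\<psi> u) \<subseteq> {v \<in> cbasis ?W. (case v of (a, b) \<Rightarrow> a + b) = wt u}"
      using keys_hmg[of L M "s + t" "(eop q ^^ t) (w s)"] st
      by (auto simp: \<psi>_def wt_def \<pi> basisW)
    have "lin (tenE q L M) (\<psi> u) = hmg L M (s + Suc t) ((eop q ^^ Suc t) (w s))"
      using st by (simp add: \<psi>_def \<pi> lin_tenE[OF deg])
    also have "\<dots> = lin \<psi> (E u)"
    proof (cases "t < len s")
      case True
      then show ?thesis using st by (simp add: E_def \<psi>_def \<pi>)
    next
      case False
      then have "t = len s" using st by simp
      then show ?thesis using wL[OF st(1)] st by (simp add: E_def \<pi> hmg_eq_0 del: funpow.simps)
    qed
    finally show "lin (tenE q L M) (\<psi> u) = lin \<psi> (E u)" .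
  qed
  have comm: "lin (tenE q L M) (lin \<psi> x) = lin \<psi> (lin E x)" if "Poly_Mapping.keys x \<subseteq> cbasis U" for x
    unfolding lin_lin by (rule lin_cong) (use that \<psi> in \<open>auto simp: nilhom_def\<close>)
  \<comment> \<open>Subtracting the multiple of \<open>w t\<close> with the same value under
    \<open>lam\<close> leaves an element (X + Y) p' with p' one degree lower, to which the induction
    hypothesis applies.\<close>
  have surj: "\<exists>x. Poly_Mapping.keys x \<subseteq> {u\<in>cbasis U. wt u = t} \<and> lin \<psi> x = hmg L M t p" if "degree p \<le> t" for t p
    using that
  proof (induction t arbitrary: p rule: less_induct)
    case (less t)
    define c where "c = lam q p / lam q (w t)"
    have "degree (p - smult c (w t)) \<le> t"
      using less.prems w(1)[of t] by (intro degree_diff_le) (auto intro: order.trans[OF degree_smult_le])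
    moreover have "lam q (p - smult c (w t)) = 0"
      using w(2)[of t] by (simp add: c_def lam_diff lam_smult)
    ultimately obtain p' where p': "p - smult c (w t) = eop q p'" "p' = 0 \<or> degree p' < t"
      using lam_eq_0_imp by blast
    have hp: "hmg L M t p = scale c (hmg L M t (w t)) + hmg L M t (eop q p')"
      unfolding p'(1)[symmetric] hmg_smult[symmetric] hmg_add[symmetric] by simp
    have 1: "\<exists>x. Poly_Mapping.keys x \<subseteq> {u\<in>cbasis U. wt u = t} \<and> lin \<psi> x = hmg L M t (w t)"
    proof (cases "t \<le> L")
      case True
      then show ?thesis
        using basisI[of t 0] by (intro exI[of _ "bvec (\<beta> (t, 0))"]) (simp add: \<psi>_def wt_def \<pi>)
    next
      case False
      have "mem (Suc L) (Suc M) t (w t)"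
        using False bnd_monom[of t "1::'k"] by (intro mem_bnd_left[of t 0]) (simp_all add: w_def)
      then show ?thesis by (intro exI[of _ 0]) (simp add: hmg_eq_0)
    qed
    have 2: "\<exists>x. Poly_Mapping.keys x \<subseteq> {u\<in>cbasis U. wt u = t} \<and> lin \<psi> x = hmg L M t (eop q p')"
    proof (cases "p' = 0")
      case True
      then show ?thesis by (intro exI[of _ 0]) simp
    next
      case False
      then obtain t' where t': "t = Suc t'" "degree p' \<le> t'" using p'(2) by (cases t) auto
      then obtain x where x: "Poly_Mapping.keys x \<subseteq> {u\<in>cbasis U. wt u = t'}" "lin \<psi> x = hmg L M t' p'"
        using less.IH by blast
      have "Poly_Mapping.keys (lin E x) \<subseteq> {u\<in>cbasis U. wt u = t}"
        using nilrep_keys[OF UU x(1), of 1] t'(1) by simp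
      moreover have "Poly_Mapping.keys x \<subseteq> cbasis U" using x(1) by blast
      then have "lin \<psi> (lin E x) = hmg L M t (eop q p')"
        using comm[of x] x(2) t'(1) lin_tenE[OF t'(2), of q L M] by simp
      ultimately show ?thesis by blast
    qed
    obtain x y where "Poly_Mapping.keys x \<subseteq> {u\<in>cbasis U. wt u = t}" "lin \<psi> x = hmg L M t (w t)"
      "Poly_Mapping.keys y \<subseteq> {u\<in>cbasis U. wt u = t}" "lin \<psi> y = hmg L M t (eop q p')"
      using 1 2 by blast
    then have "Poly_Mapping.keys (scale c x + y) \<subseteq> {u\<in>cbasis U. wt u = t}" "lin \<psi> (scale c x + y) = hmg L M t p"
      using Poly_Mapping.keys_add[of "scale c x" y] keys_scale_subset[of c x]
      by (auto simp: hp lin_add lin_scale)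
    then show ?case by blast
  qed
  show ?thesis
  proof (rule nilhom_iso[OF W UU \<psi>])
    have "card (cbasis U) = (\<Sum>s\<le>L. Suc (len s))"
      using bij_betw_same_card[OF \<beta>] by simp
    then show "card (cbasis U) = card (cbasis ?W)"
      unfolding basisW dim by simp
    fix c assume "c \<in> cbasis ?W"
    then obtain a b where c: "c = (a, b)" "a \<le> L" "b \<le> M" by (auto simp: basisW)
    have hm: "hmg L M (a + b) (monom (1::'k) a) = bvec (a, b)" by (rule hmg_monom[OF c(2,3)])
    have dm: "degree (monom (1::'k) a) \<le> a + b" by (rule order.trans[OF degree_monom_le]) simp
    show "\<exists>x. Poly_Mapping.keys x \<subseteq> {u \<in> cbasis U. wt u = (case c of (a, b) \<Rightarrow> a + b)} \<and> lin \<psi> x = bvec c"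
      using surj[OF dm] unfolding hm c(1) by simp
  qed
qed

end

section \<open>Gluing strings along consecutive intervals of starting degrees\<close>

text \<open>The half-open interval is empty when b + 1 = a, so the empty sums of the boundary cases
  fit between their neighbours without special treatment.\<close>

lemma decomp_strings:
  assumes "\<And>i. a \<le> i \<Longrightarrow> i \<le> b \<Longrightarrow> len (c + i) = l i" "p = c + a" "r = c + b + 1"
  shows "decomp n (csum {a..b} (\<lambda>i. V n (c + i) (l i))) {p..<r} len"
proof -
  have "decomp n (csum {a..b} (\<lambda>i. V n (c + i) (l i))) (\<Union>i\<in>{a..b}. {c + i}) len"
    by (rule decomp_csum) (use assms(1) in \<open>auto intro: decomp_V\<close>)
  moreover have "(\<Union>i\<in>{a..b}. {c + i}) = {p..<r}"
  proof (intro equalityI subsetI)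
    fix x assume "x \<in> {p..<r}"
    then have "x - c \<in> {a..b}" "x = c + (x - c)" using assms(2,3) by auto
    then show "x \<in> (\<Union>i\<in>{a..b}. {c + i})" by blast
  qed (use assms(2,3) in auto)
  ultimately show ?thesis by simp
qed

lemma decomp_append:
  assumes "decomp n X {p..<q} len" "decomp n Y {q..<r} len" "p \<le> q" "q \<le> r"
  shows "decomp n (X \<oplus> Y) {p..<r} len"
  using decomp_cplus[OF assms(1,2)] assms(3,4) by (simp add: ivl_disj_un ivl_disj_int)

lemma decomp_append3:
  assumes "decomp n X {p..<q} len" "decomp n Y {q..<r} len" "decomp n Z {r..<s} len" "p \<le> q" "q \<le> r" "r \<le> s"
  shows "decomp n (X \<oplus> Y \<oplus> Z) {p..<s} len"
  using decomp_append[OF assms(1) decomp_append[OF assms(2,3)]] assms(4-6) by simp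

lemma decomp_append4:
  assumes "decomp n X {p..<q} len" "decomp n Y {q..<r} len" "decomp n Z {r..<s} len" "decomp n T {s..<t} len"
    "p \<le> q" "q \<le> r" "r \<le> s" "s \<le> t"
  shows "decomp n (X \<oplus> Y \<oplus> Z \<oplus> T) {p..<t} len"
  using decomp_append[OF assms(1) decomp_append3[OF assms(2-4)]] assms(5-8) by simp

lemma Union_blocks: "(\<Union>k\<in>{0..<e}. {k * d..<k * d + d}) = {0..<e * d :: nat}"
proof (induction e)
  case (Suc e)
  have "{0..<Suc e} = insert e {0..<e}" by auto
  then show ?case using Suc by (auto simp: add.commute)
qed simp

lemma decomp_blocks:
  assumes "\<And>k. k < e \<Longrightarrow> decomp n (U k) {k * d..<k * d + d} len"
  shows "decomp n (csum {0..<e} U) {0..<e * d} len"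
proof -
  have "{k * d..<k * d + d} \<inter> {k' * d..<k' * d + d} = {}" if "k < k'" for k k'
  proof -
    have "Suc k * d \<le> k' * d" using that by (intro mult_le_mono1) simp
    then show ?thesis by auto
  qed
  then have "decomp n (csum {0..<e} U) (\<Union>k\<in>{0..<e}. {k * d..<k * d + d}) len"
    by (intro decomp_csum) (use assms in \<open>auto simp: neq_iff Int_commute\<close>)
  then show ?thesis by (simp add: Union_blocks)
qed

text \<open>Up to the multiple \<open>(e + m - 2k)d\<close>, \<open>res i\<close> is the length of the string that starts in
  degree \<open>kd + i\<close>.\<close>

definition res_small :: "nat \<Rightarrow> nat \<Rightarrow> nat \<Rightarrow> nat \<Rightarrow> int" where
  "res_small d f h i = (if i \<le> min f h then int f + int h + 1 - 2 * int i
     else if i \<le> max f h then 0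
     else if i \<le> f + h + 1 then int f + int h + 1 - 2 * int i
     else - int d)"

definition res_large :: "nat \<Rightarrow> nat \<Rightarrow> nat \<Rightarrow> nat \<Rightarrow> int" where
  "res_large d f h i = (if i \<le> f + h - d + 1 then int d
     else if min f h < i \<and> i \<le> max f h then 0
     else int f + int h + 1 - 2 * int i)"

text \<open>The computation is in integers because \<open>res\<close> can be negative. The final -1
  passes from the number of basis vectors of a string to the index l of
  \<open>V n i l\<close>.\<close>

definition string_len :: "nat \<Rightarrow> nat \<Rightarrow> nat \<Rightarrow> (nat \<Rightarrow> int) \<Rightarrow> nat \<Rightarrow> nat" where
  "string_len d e m res s = nat ((int e + int m - 2 * int (s div d)) * int d + res (s mod d) - 1)"

lemma string_len_eqI:
  assumes "i < d" "k \<le> e" "e \<le> m" "int ((e + m - 2 * k) * d) + res i = int l + 1"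
  shows "string_len d e m res (k * d + i) = l"
proof -
  have "(k * d + i) div d = k" "(k * d + i) mod d = i" using assms(1) by auto
  moreover have "(int e + int m - 2 * int k) * int d = int ((e + m - 2 * k) * d)"
    using assms(2,3) by (simp add: of_nat_diff)
  ultimately show ?thesis using assms(4) by (simp add: string_len_def del: of_nat_mult)
qed

section \<open>Sums of residues and the dimension count\<close>

lemma sum_arith:
  assumes "a \<le> b"
  shows "(\<Sum>i\<in>{a..<b}. C - 2 * int i) = (int b - int a) * (C + 1 - int a - int b)"
  using assms by (induction b rule: dec_induct) (simp_all add: algebra_simps)

lemma sum_pieces:
  fixes g :: "nat \<Rightarrow> int"
  assumes "a \<le> b" "b \<le> c" "c \<le> d"
  shows "sum g {0..<d} = sum g {0..<a} + sum g {a..<b} + sum g {b..<c} + sum g {c..<d}"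
  using assms by (simp add: sum.atLeastLessThan_concat)

text \<open>The residues at i and f + h + 1 - i are opposite, so over a full period only the
  constant residues -d beyond f + h + 1 contribute. The partial sum stops before the negative
  residues begin.\<close>

lemma sum_res_small:
  assumes "f + h + 1 < d"
  shows "(\<Sum>i<d. res_small d f h i) = int d * (int f + int h + 2 - int d)"
    "(\<Sum>i\<le>f. res_small d f h i) = (int f + 1) * (int h + 1)"
proof -
  let ?g = "res_small d f h"
  define lo hi where "lo = min f h" and "hi = max f h"
  have lh: "lo \<le> hi" "int f + int h = int lo + int hi" "f + h = lo + hi" by (auto simp: lo_def hi_def)
  have "sum ?g {0..<lo + 1} = (\<Sum>i\<in>{0..<lo + 1}. (int f + int h + 1) - 2 * int i)"
    by (rule sum.cong) (auto simp: res_small_def lo_def)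
  also have "\<dots> = (int (lo + 1) - int 0) * (int f + int h + 1 + 1 - int 0 - int (lo + 1))"
    by (rule sum_arith) simp
  also have "\<dots> = (int lo + 1) * (int hi + 1)"
    unfolding lh(2) by (simp add: algebra_simps)
  finally have 1: "sum ?g {0..<lo + 1} = (int lo + 1) * (int hi + 1)" .
  have 2: "sum ?g {lo + 1..<b} = 0" if "b \<le> hi + 1" for b
    using that by (intro sum.neutral) (auto simp: res_small_def lo_def hi_def)
  have "sum ?g {hi + 1..<f + h + 2} = (\<Sum>i\<in>{hi + 1..<f + h + 2}. (int f + int h + 1) - 2 * int i)"
    by (rule sum.cong) (auto simp: res_small_def lo_def hi_def)
  also have "\<dots> = (int (f + h + 2) - int (hi + 1)) * (int f + int h + 1 + 1 - int (hi + 1) - int (f + h + 2))"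
    by (rule sum_arith) (simp add: lh(3))
  also have "\<dots> = - ((int lo + 1) * (int hi + 1))"
    unfolding lh(3) lh(2) by (simp add: algebra_simps)
  finally have 3: "sum ?g {hi + 1..<f + h + 2} = - ((int lo + 1) * (int hi + 1))" .
  have "sum ?g {f + h + 2..<d} = (\<Sum>i\<in>{f + h + 2..<d}. - int d)"
    by (rule sum.cong) (auto simp: res_small_def)
  then have 4: "sum ?g {f + h + 2..<d} = int d * (int f + int h + 2 - int d)"
    using assms by (simp add: of_nat_diff algebra_simps)
  show "sum ?g {..<d} = int d * (int f + int h + 2 - int d)"
    using sum_pieces[of "lo + 1" "hi + 1" "f + h + 2" d ?g] assms lh 1 2[of "hi + 1"] 3 4
    by (simp add: lessThan_atLeast0)
  have "{..f} = {0..<f + 1}" by auto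
  then have "sum ?g {..f} = sum ?g {0..<lo + 1} + sum ?g {lo + 1..<f + 1}"
    by (simp only: sum.atLeastLessThan_concat lo_def min.cobounded1 add_le_mono1 zero_le)
  also have "sum ?g {lo + 1..<f + 1} = 0" by (rule 2) (simp add: hi_def)
  also have "sum ?g {0..<lo + 1} + 0 = (int lo + 1) * (int hi + 1)" using 1 by simp
  also have "\<dots> = (int f + 1) * (int h + 1)"
    by (cases "f \<le> h") (auto simp: lo_def hi_def algebra_simps)
  finally show "sum ?g {..f} = (int f + 1) * (int h + 1)" .
qed

text \<open>The same reflection exchanges the range from f + h - d + 2 to min f h with the range
  from max f h + 1 to d - 1; only the constant residues d at the beginning survive.\<close>

lemma sum_res_large:
  assumes "f < d" "h < d" "d \<le> f + h"
  shows "(\<Sum>i<d. res_large d f h i) = int d * (int f + int h + 2 - int d)"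
    "(\<Sum>i\<le>f. res_large d f h i) = (int f + 1) * (int h + 1)"
proof -
  let ?g = "res_large d f h"
  define lo hi c where "lo = min f h" and "hi = max f h" and "c = f + h - d + 1"
  have lh: "lo \<le> hi" "int f + int h = int lo + int hi" "c \<le> lo" "hi < d" "int c = int lo + int hi - int d + 1"
    using assms by (auto simp: lo_def hi_def c_def)
  have "sum ?g {0..<c + 1} = (\<Sum>i\<in>{0..<c + 1}. int d)"
    by (rule sum.cong) (auto simp: res_large_def c_def)
  then have 1: "sum ?g {0..<c + 1} = int d * (int f + int h + 2 - int d)"
    using lh by (simp add: algebra_simps)
  have "sum ?g {c + 1..<lo + 1} = (\<Sum>i\<in>{c + 1..<lo + 1}. (int f + int h + 1) - 2 * int i)"
    by (rule sum.cong) (auto simp: res_large_def c_def lo_def)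
  also have "\<dots> = (int lo - int c) * (int f + int h + 1 + 1 - int (c + 1) - int (lo + 1))"
    using lh(3) by (subst sum_arith) auto
  also have "\<dots> = (int d - 1 - int hi) * (int d - 1 - int lo)"
    unfolding lh(2,5) by (simp add: lh(5) algebra_simps)
  finally have 2: "sum ?g {c + 1..<lo + 1} = (int d - 1 - int hi) * (int d - 1 - int lo)" .
  have 3: "sum ?g {lo + 1..<b} = 0" if "b \<le> hi + 1" for b
    using that lh(3) by (intro sum.neutral) (auto simp: res_large_def lo_def hi_def c_def)
  have "sum ?g {hi + 1..<d} = (\<Sum>i\<in>{hi + 1..<d}. (int f + int h + 1) - 2 * int i)"
    by (rule sum.cong) (use lh(1,3) in \<open>auto simp: res_large_def hi_def c_def lo_def\<close>)
  also have "\<dots> = (int d - int (hi + 1)) * (int f + int h + 1 + 1 - int (hi + 1) - int d)"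
    using lh(4) by (subst sum_arith) auto
  also have "\<dots> = - ((int d - 1 - int hi) * (int d - 1 - int lo))"
    unfolding lh(2) by (simp add: algebra_simps)
  finally have 4: "sum ?g {hi + 1..<d} = - ((int d - 1 - int hi) * (int d - 1 - int lo))" .
  show "sum ?g {..<d} = int d * (int f + int h + 2 - int d)"
    using sum_pieces[of "c + 1" "lo + 1" "hi + 1" d ?g] lh 1 2 3[of "hi + 1"] 4
    by (simp add: lessThan_atLeast0)
  have fe: "{..f} = {0..<f + 1}" by auto
  have "c + 1 \<le> lo + 1" "lo + 1 \<le> f + 1" using lh by (auto simp: lo_def)
  then have "sum ?g {..f} = sum ?g {0..<c + 1} + sum ?g {c + 1..<lo + 1} + sum ?g {lo + 1..<f + 1}"
    unfolding fe by (simp only: sum.atLeastLessThan_concat zero_le)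
  also have "sum ?g {lo + 1..<f + 1} = 0" by (rule 3) (simp add: hi_def)
  also have "sum ?g {0..<c + 1} + sum ?g {c + 1..<lo + 1} + 0 = (int lo + 1) * (int hi + 1)"
    unfolding 1 2 lh(2) by (simp add: algebra_simps)
  also have "\<dots> = (int f + 1) * (int h + 1)"
    by (cases "f \<le> h") (auto simp: lo_def hi_def algebra_simps)
  finally show "sum ?g {..f} = (int f + 1) * (int h + 1)" .
qed

context primitive_root
begin

text \<open>The dimension count depends on the residues only through their sum over a full period
  and over the last, partial block; the rest is an arithmetic progression in k.\<close>

lemma iso_of_residues:
  assumes n: "n > 0" "q ^ n = 1" and U: "decomp n U {0..<e * d + f + 1} (string_len d e m res)"
    and f: "f < d" and em: "e \<le> m"
    and gen: "\<And>k i. k < e \<and> i < d \<or> k = e \<and> i \<le> f \<Longrightarrow>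
       \<exists>r > 0. int r = int ((e + m - 2 * k) * d) + res i \<and> gen_len (e * d + f) (m * d + h) (k * d + i) r"
    and sums: "(\<Sum>i<d. res i) = int d * (int f + int h + 2 - int d)" "(\<Sum>i\<le>f. res i) = (int f + 1) * (int h + 1)"
  shows "Cq_iso n (ctensor n q (V n 0 (e * d + f)) (V n 0 (m * d + h))) U"
proof (rule iso_of_gen_len[OF n])
  let ?len = "string_len d e m res"
  have U': "{0..<e * d + f + 1} = {..e * d + f}" by auto
  show "decomp n U {..e * d + f} ?len" using U unfolding U' .
  have len: "int (Suc (?len (k * d + i))) = int ((e + m - 2 * k) * d) + res i"
    "gen_len (e * d + f) (m * d + h) (k * d + i) (Suc (?len (k * d + i)))"
    if ki: "k < e \<and> i < d \<or> k = e \<and> i \<le> f" for k i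
  proof -
    obtain r where r: "r > 0" "int r = int ((e + m - 2 * k) * d) + res i" "gen_len (e * d + f) (m * d + h) (k * d + i) r"
      using gen[OF ki] by blast
    have "?len (k * d + i) = r - 1"
      by (rule string_len_eqI) (use ki f em r(1,2) in auto)
    then show "int (Suc (?len (k * d + i))) = int ((e + m - 2 * k) * d) + res i"
      "gen_len (e * d + f) (m * d + h) (k * d + i) (Suc (?len (k * d + i)))"
      using r by simp_all
  qed
  show "gen_len (e * d + f) (m * d + h) s (Suc (?len s))" if "s \<le> e * d + f" for s
  proof -
    have "s div d < e \<and> s mod d < d \<or> s div d = e \<and> s mod d \<le> f"
    proof (cases "s < e * d")
      case True
      then show ?thesis using d2 by (simp add: less_mult_imp_div_less)
    next
      case False
      define t where "t = s - e * d"
      have "s = e * d + t" "t \<le> f" using False that by (auto simp: t_def)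
      then show ?thesis using f by auto
    qed
    then show ?thesis using len(2)[of "s div d" "s mod d"] by simp
  qed
  have block: "(\<Sum>s\<in>{k * d..<k * d + d}. int (Suc (?len s))) = int d * int ((e + m - 2 * k) * d) + int d * (int f + int h + 2 - int d)"
    if "k < e" for k
  proof -
    have "(\<Sum>s\<in>{k * d..<k * d + d}. int (Suc (?len s))) = (\<Sum>i<d. int (Suc (?len (k * d + i))))"
      by (rule sum.reindex_bij_witness[of _ "\<lambda>i. k * d + i" "\<lambda>s. s - k * d"]) auto
    also have "\<dots> = (\<Sum>i<d. int ((e + m - 2 * k) * d) + res i)"
      using len(1)[of k] that by (intro sum.cong) auto
    finally show ?thesis by (simp add: sum.distrib sums)
  qed
  have "(\<Sum>s\<in>{e * d..<e * d + f + 1}. int (Suc (?len s))) = (\<Sum>i\<le>f. int (Suc (?len (e * d + i))))"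
    by (rule sum.reindex_bij_witness[of _ "\<lambda>i. e * d + i" "\<lambda>s. s - e * d"]) auto
  also have "\<dots> = (\<Sum>i\<le>f. int ((e + m - 2 * e) * d) + res i)"
    using len(1)[of e] by (intro sum.cong) auto
  finally have last: "(\<Sum>s\<in>{e * d..<e * d + f + 1}. int (Suc (?len s)))
      = (int f + 1) * ((int m - int e) * int d) + (int f + 1) * (int h + 1)"
    using em by (simp add: sum.distrib sums of_nat_diff)
  have tri: "(\<Sum>k<j. int e + int m - 2 * int k) = int j * (int e + int m + 1 - int j)" for j
    by (induction j) (simp_all add: algebra_simps)
  have "int (\<Sum>s\<le>e * d + f. Suc (?len s)) = (\<Sum>s\<in>{0..<e * d}. int (Suc (?len s))) + (\<Sum>s\<in>{e * d..<e * d + f + 1}. int (Suc (?len s)))"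
    unfolding U'[symmetric] of_nat_sum by (simp only: sum.atLeastLessThan_concat le_add1 zero_le add.assoc)
  also have "(\<Sum>s\<in>{0..<e * d}. int (Suc (?len s))) = (\<Sum>k<e. \<Sum>s\<in>{k * d..<k * d + d}. int (Suc (?len s)))"
    unfolding sum.nat_group by (simp add: lessThan_atLeast0)
  also have "\<dots> = (\<Sum>k<e. (int d * int d) * (int e + int m - 2 * int k) + int d * (int f + int h + 2 - int d))"
  proof (rule sum.cong[OF refl])
    fix k assume "k \<in> {..<e}"
    then have k: "k < e" by simp
    then have "int ((e + m - 2 * k) * d) = (int e + int m - 2 * int k) * int d"
      using em by (simp add: of_nat_diff)
    then show "(\<Sum>s\<in>{k * d..<k * d + d}. int (Suc (?len s)))
        = (int d * int d) * (int e + int m - 2 * int k) + int d * (int f + int h + 2 - int d)"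
      unfolding block[OF k] by (simp only: mult_ac)
  qed
  also have "\<dots> = (int d * int d) * (int e * (int m + 1)) + int e * (int d * (int f + int h + 2 - int d))"
    unfolding sum.distrib sum_distrib_left[symmetric] tri by simp
  finally have "int (\<Sum>s\<le>e * d + f. Suc (?len s)) = int (Suc (e * d + f) * Suc (m * d + h))"
    unfolding last by (simp add: algebra_simps)
  then show "(\<Sum>s\<le>e * d + f. Suc (?len s)) = Suc (e * d + f) * Suc (m * d + h)"
    by (simp only: of_nat_eq_iff)
qed

section \<open>A generator for every residue\<close>

text \<open>The smaller of f and h is exceeded by a factor X^(f+1) or Y^(h+1); the other variable
  gets the additional power y^(m+1) or x^(e+1) instead.\<close>

lemma gen_len_middle:
  assumes "f < d" "h < d" "k \<le> e" "e \<le> m" "min f h < i" "i \<le> max f h"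
  shows "gen_len (e * d + f) (m * d + h) (k * d + i) ((e + m - 2 * k) * d)"
proof (cases "f \<le> h")
  case True
  then have "gen_len (e * d + f) (m * d + h) (k * d + (f + 1 + (i - f - 1))) ((e + (m + 1) - 1 - 2 * k) * d)"
    using assms by (intro gen_len_full) auto
  moreover have "f + 1 + (i - f - 1) = i" "e + (m + 1) - 1 - 2 * k = e + m - 2 * k"
    using True assms by auto
  ultimately show ?thesis by simp
next
  case False
  then have "gen_len (e * d + f) (m * d + h) (k * d + (i - h - 1 + (h + 1))) ((e + 1 + m - 1 - 2 * k) * d)"
    using assms by (intro gen_len_full) auto
  moreover have "i - h - 1 + (h + 1) = i" "e + 1 + m - 1 - 2 * k = e + m - 2 * k"
    using False assms by auto
  ultimately show ?thesis by simp
qed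

lemma gen_len_upper:
  assumes "f < d" "h < d" "k < e" "e \<le> m" "max f h < i" "i \<le> f + h + 1" "i < d"
  shows "\<exists>r > 0. int r = int ((e + m - 2 * k) * d) + (int f + int h + 1 - 2 * int i) \<and>
    gen_len (e * d + f) (m * d + h) (k * d + i) r"
proof -
  \<comment> \<open>The reflection i to f + h + 1 - i leads back to the quantum vector of the lower
    residue j.\<close>
  define j where "j = f + h + 1 - i"
  have j: "j \<le> f" "j \<le> h" "f + h + 1 - j = i" using assms by (auto simp: j_def)
  define P where "P = (e + m - 2 * k) * d"
  \<comment> \<open>Because k < e, the multiple of d is large enough that the natural subtraction
    does not truncate.\<close>
  have "2 * d \<le> P" unfolding P_def using assms by (intro mult_le_mono1) simp
  then have "P - (f + h + 1 - 2 * j) > 0" "int (P - (f + h + 1 - 2 * j)) = int P + (int f + int h + 1 - 2 * int i)"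
    using assms j by linarith+
  moreover have "gen_len (e * d + f) (m * d + h) (k * d + i) ((e + m - 2 * k) * d - (f + h + 1 - 2 * j))"
    by (rule gen_len_short[of j f h k e m, unfolded j(3)]) (use j assms in auto)
  ultimately show ?thesis unfolding P_def by blast
qed

lemma gen_len_lower:
  assumes "f < d" "h < d" "k \<le> e" "e \<le> m" "i \<le> min f h" "f + h + 1 - i < d"
  shows "\<exists>r > 0. int r = int ((e + m - 2 * k) * d) + (int f + int h + 1 - 2 * int i) \<and>
    gen_len (e * d + f) (m * d + h) (k * d + i) r"
proof (intro exI conjI)
  show "gen_len (e * d + f) (m * d + h) (k * d + i) ((e + m - 2 * k) * d + (f + h + 1 - 2 * i))"
    by (rule gen_len_long) (use assms in auto)
qed (use assms in \<open>auto simp: of_nat_diff\<close>)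

lemma iso_small:
  assumes n: "n > 0" "q ^ n = 1" and fh: "f + h + 1 < d" and em: "e \<le> m" "h < f \<Longrightarrow> e < m"
    and U: "decomp n U {0..<e * d + f + 1} (string_len d e m (res_small d f h))"
  shows "Cq_iso n (ctensor n q (V n 0 (e * d + f)) (V n 0 (m * d + h))) U"
proof (rule iso_of_residues[OF n U _ em(1) _ sum_res_small[OF fh]])
  fix k i assume ki: "k < e \<and> i < d \<or> k = e \<and> i \<le> f"
  consider "i \<le> min f h" | "min f h < i" "i \<le> max f h" | "max f h < i" "i \<le> f + h + 1" | "f + h + 1 < i"
    by linarith
  then show "\<exists>r > 0. int r = int ((e + m - 2 * k) * d) + res_small d f h i \<and> gen_len (e * d + f) (m * d + h) (k * d + i) r"
  proof cases
    case 1
    then show ?thesis using gen_len_lower[of f h k e m i] fh ki em by (auto simp: res_small_def)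
  next
    case 2
    \<comment> \<open>For k = e a middle residue occurs only if h < f; then e < m, so the string is
      not empty.\<close>
    have "e + m - 2 * k > 0" using ki em 2 by auto
    then show ?thesis using gen_len_middle[of f h k e m i] 2 fh ki em d2
      by (intro exI[of _ "(e + m - 2 * k) * d"]) (auto simp: res_small_def)
  next
    case 3
    then show ?thesis using gen_len_upper[of f h k e m i] fh ki em by (auto simp: res_small_def)
  next
    case 4
    then have k: "k < e" "f < i" using ki by auto
    \<comment> \<open>Beyond f + h + 1 the monomial can contain both X^(f+1) and Y^(h+1), so the
      smaller exponents e and m suffice and the string is shorter by d.\<close>
    have "gen_len (e * d + f) (m * d + h) (k * d + (f + 1 + (i - f - 1))) ((e + m - 1 - 2 * k) * d)"
      by (rule gen_len_full) (use 4 k em in auto)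
    moreover have "f + 1 + (i - f - 1) = i" using k by simp
    moreover have "e + m - 2 * k = Suc (e + m - 1 - 2 * k)" "e + m - 1 - 2 * k > 0" using k em by auto
    ultimately show ?thesis using 4 d2
      by (intro exI[of _ "(e + m - 1 - 2 * k) * d"]) (auto simp: res_small_def)
  qed
qed (use fh in auto)

lemma iso_large:
  assumes n: "n > 0" "q ^ n = 1" and fh: "f < d" "h < d" "d \<le> f + h" and em: "e \<le> m" "h < f \<Longrightarrow> e < m"
    and U: "decomp n U {0..<e * d + f + 1} (string_len d e m (res_large d f h))"
  shows "Cq_iso n (ctensor n q (V n 0 (e * d + f)) (V n 0 (m * d + h))) U"
proof (rule iso_of_residues[OF n U fh(1) em(1) _ sum_res_large[OF fh]])
  fix k i assume ki: "k < e \<and> i < d \<or> k = e \<and> i \<le> f"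
  have c: "f + h - d + 1 \<le> min f h" using fh by auto
  consider "i \<le> f + h - d + 1" | "f + h - d + 1 < i" "i \<le> min f h" | "min f h < i" "i \<le> max f h" | "max f h < i"
    by linarith
  then show "\<exists>r > 0. int r = int ((e + m - 2 * k) * d) + res_large d f h i \<and> gen_len (e * d + f) (m * d + h) (k * d + i) r"
  proof cases
    case 1
    \<comment> \<open>Here f + h + 1 - i >= d, so \<open>small_generator\<close> does not apply. The
      pure power Y^i is used with the larger exponents e + 1 and m + 1, which lengthens the string
      by d.\<close>
    have "gen_len (e * d + f) (m * d + h) (k * d + (0 + i)) ((e + 1 + (m + 1) - 1 - 2 * k) * d)"
      by (rule gen_len_full) (use ki fh em in auto)
    moreover have "e + 1 + (m + 1) - 1 - 2 * k = Suc (e + m - 2 * k)" using ki em by auto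
    ultimately show ?thesis using 1 d2
      by (intro exI[of _ "Suc (e + m - 2 * k) * d"]) (auto simp: res_large_def)
  next
    case 2
    then show ?thesis using gen_len_lower[of f h k e m i] fh ki em by (auto simp: res_large_def)
  next
    case 3
    have "e + m - 2 * k > 0" using ki em 3 by auto
    then show ?thesis using gen_len_middle[of f h k e m i] 3 c fh ki em d2
      by (intro exI[of _ "(e + m - 2 * k) * d"]) (auto simp: res_large_def)
  next
    case 4
    then show ?thesis using gen_len_upper[of f h k e m i] c fh ki em by (auto simp: res_large_def)
  qed
qed

end

theorem theorem3p18:
  fixes n d e m f h \<gamma> :: nat
    and q :: "'k::{alg_closed_field, field_char_0}"
  assumes n: "n > 1"
    and q_root: "q ^ n = 1"
    and d: "d \<ge> 2"
    and q_order: "q ^ d = 1" "\<forall>t. 0 < t \<and> t < d \<longrightarrow> q ^ t \<noteq> 1"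
    and f: "f \<le> d - 1"
    and h: "h \<le> d - 1"
    and le: "e * d + f \<le> m * d + h"
    and \<gamma>: "\<gamma> = f + h - d + 1"
  shows
    "(f \<le> h \<and> f + h < d - 1 \<longrightarrow>
        Cq_iso n (ctensor n q (V n 0 (e * d + f)) (V n 0 (m * d + h)))
         (csum {0..<e} (\<lambda>k.
              csum {0..f} (\<lambda>i. V n (k * d + i) ((e + m - 2 * k) * d + f + h - 2 * i))
            \<oplus> csum {f + 1..h} (\<lambda>j. V n (k * d + j) ((e + m - 2 * k) * d - 1))
            \<oplus> csum {h + 1..f + h + 1} (\<lambda>r. V n (k * d + r) ((e + m - 2 * k) * d + h + f - 2 * r))
            \<oplus> csum {f + h + 2..d - 1} (\<lambda>s. V n (k * d + s) ((e + m - 1 - 2 * k) * d - 1)))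
          \<oplus> csum {0..f} (\<lambda>i. V n (e * d + i) ((m - e) * d + h + f - 2 * i))))
   \<and> (0 < f \<and> f \<le> h \<and> h < d \<and> f + h \<ge> d \<longrightarrow>
        Cq_iso n (ctensor n q (V n 0 (e * d + f)) (V n 0 (m * d + h)))
         (csum {0..<e} (\<lambda>k.
              csum {0..\<gamma>} (\<lambda>i. V n (k * d + i) ((e + m - 2 * k) * d + d - 1))
            \<oplus> csum {\<gamma> + 1..f} (\<lambda>j. V n (k * d + j) ((e + m - 2 * k) * d + f + h - 2 * j))
            \<oplus> csum {f + 1..h} (\<lambda>r. V n (k * d + r) ((e + m - 2 * k) * d - 1))
            \<oplus> csum {h + 1..d - 1} (\<lambda>s. V n (k * d + s) ((e + m - 2 * k) * d + h + f - 2 * s)))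
          \<oplus> csum {0..\<gamma>} (\<lambda>i. V n (e * d + i) ((m - e) * d + d - 1))
          \<oplus> csum {\<gamma> + 1..f} (\<lambda>i. V n (e * d + i) ((m - e) * d + f + h - 2 * i))))
   \<and> (h < f \<and> f < d \<and> f + h < d - 1 \<longrightarrow>
        Cq_iso n (ctensor n q (V n 0 (e * d + f)) (V n 0 (m * d + h)))
         (csum {0..<e} (\<lambda>k.
              csum {0..h} (\<lambda>i. V n (k * d + i) ((e + m - 2 * k) * d + h + f - 2 * i))
            \<oplus> csum {h + 1..f} (\<lambda>j. V n (k * d + j) ((e + m - 2 * k) * d - 1))
            \<oplus> csum {f + 1..h + f + 1} (\<lambda>r. V n (k * d + r) ((e + m - 2 * k) * d + h + f - 2 * r))
            \<oplus> csum {f + h + 2..d - 1} (\<lambda>s. V n (k * d + s) ((e + m - 1 - 2 * k) * d - 1)))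
          \<oplus> csum {0..h} (\<lambda>i. V n (e * d + i) ((m - e) * d + h + f - 2 * i))
          \<oplus> csum {h + 1..f} (\<lambda>i. V n (e * d + i) ((m - e) * d - 1))))
   \<and> (0 < h \<and> h < f \<and> f < d \<and> f + h \<ge> d \<longrightarrow>
        Cq_iso n (ctensor n q (V n 0 (e * d + f)) (V n 0 (m * d + h)))
         (csum {0..<e} (\<lambda>k.
              csum {0..\<gamma>} (\<lambda>i. V n (k * d + i) ((e + m - 2 * k) * d + d - 1))
            \<oplus> csum {\<gamma> + 1..h} (\<lambda>j. V n (k * d + j) ((e + m - 2 * k) * d + f + h - 2 * j))
            \<oplus> csum {h + 1..f} (\<lambda>r. V n (k * d + r) ((e + m - 2 * k) * d - 1))
            \<oplus> csum {f + 1..d - 1} (\<lambda>s. V n (k * d + s) ((e + m - 2 * k) * d + h + f - 2 * s)))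
          \<oplus> csum {0..\<gamma>} (\<lambda>i. V n (e * d + i) ((m - e) * d + d - 1))
          \<oplus> csum {\<gamma> + 1..h} (\<lambda>i. V n (e * d + i) ((m - e) * d + f + h - 2 * i))
          \<oplus> csum {h + 1..f} (\<lambda>i. V n (e * d + i) ((m - e) * d - 1))))"
proof -
  interpret primitive_root q d
    by unfold_locales (use d q_order in auto)
  have fd: "f < d" "h < d" using f h d by auto
  \<comment> \<open>As f and h are below d, the order of ed + f and md + h is lexicographic.\<close>
  have em: "e \<le> m"
  proof (rule ccontr)
    assume "\<not> e \<le> m"
    then have "Suc m * d \<le> e * d" by (intro mult_le_mono1) simp
    then show False using le fd by simp
  qed
  have em': "e < m" if "h < f"
    using le that em by (cases "e = m") auto
  have n0: "n > 0" using n by simp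
  have A: "2 * d \<le> (e + m - 2 * k) * d" "(e + m - 1 - 2 * k) * d = (e + m - 2 * k) * d - d" if "k < e" for k
  proof -
    show "2 * d \<le> (e + m - 2 * k) * d" using that em by (intro mult_le_mono1) simp
    have "e + m - 1 - 2 * k = (e + m - 2 * k) - 1" by simp
    then show "(e + m - 1 - 2 * k) * d = (e + m - 2 * k) * d - d"
      by (simp only: diff_mult_distrib mult_1)
  qed
  have B: "(e + m - 2 * e) * d = (m - e) * d" by simp
  have C: "d \<le> (m - e) * d" if "h < f"
    using em'[OF that] by (cases "m - e") auto
  note len = string_len_eqI[where res = "res_small d f h", OF _ _ em] string_len_eqI[where res = "res_large d f h", OF _ _ em]
  show ?thesis
  proof ((intro conjI impI; elim conjE), goal_cases)
    case c: 1
    have fh: "f + h + 1 < d" using c by simp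
    show ?case
    proof (rule iso_small[OF n0 q_root fh em em'], assumption,
        rule decomp_append[where q = "e * d", OF decomp_blocks], goal_cases)
      case (1 k)
      then have k: "k < e" .
      \<comment> \<open>Naming the product leaves linear arithmetic in P and d. The cut points
        supplied to \<open>decomp_append4\<close> are the starting degrees at which one inner sum
        ends and the next begins.\<close>
      define P where "P = (e + m - 2 * k) * d"
      note a = A[OF k, folded P_def]
      show ?case
        unfolding a(2) P_def[symmetric]
        by (rule decomp_append4[where q = "k * d + (f + 1)" and r = "k * d + (h + 1)" and s = "k * d + (f + h + 2)"];
            (rule decomp_strings)?; (rule len)?;
            use c fd k a in \<open>simp add: P_def[symmetric] res_small_def\<close>)
    qed (rule decomp_strings, rule len, use c fd in \<open>simp_all add: B res_small_def\<close>)
  next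
    case c: 2
    have fh: "d \<le> f + h" using c by simp
    show ?case
    proof (rule iso_large[OF n0 q_root fd fh em em'], assumption,
        rule decomp_append3[where q = "e * d" and r = "e * d + (\<gamma> + 1)", OF decomp_blocks], goal_cases)
      case (1 k)
      then have k: "k < e" .
      define P where "P = (e + m - 2 * k) * d"
      note a = A[OF k, folded P_def]
      show ?case
        unfolding a(2) P_def[symmetric]
        by (rule decomp_append4[where q = "k * d + (\<gamma> + 1)" and r = "k * d + (f + 1)" and s = "k * d + (h + 1)"];
            (rule decomp_strings)?; (rule len)?;
            use c fd k a in \<open>simp add: P_def[symmetric] res_large_def \<gamma>\<close>)
    qed ((rule decomp_strings)?; (rule len)?; use c fd C in \<open>simp add: B res_large_def \<gamma>\<close>)+
  next
    case c: 3
    have fh: "f + h + 1 < d" using c by simp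
    show ?case
    proof (rule iso_small[OF n0 q_root fh em em'], assumption,
        rule decomp_append3[where q = "e * d" and r = "e * d + (h + 1)", OF decomp_blocks], goal_cases)
      case (1 k)
      then have k: "k < e" .
      define P where "P = (e + m - 2 * k) * d"
      note a = A[OF k, folded P_def]
      show ?case
        unfolding a(2) P_def[symmetric]
        by (rule decomp_append4[where q = "k * d + (h + 1)" and r = "k * d + (f + 1)" and s = "k * d + (f + h + 2)"];
            (rule decomp_strings)?; (rule len)?;
            use c fd k a in \<open>simp add: P_def[symmetric] res_small_def\<close>)
    qed ((rule decomp_strings)?; (rule len)?; use c fd C in \<open>simp add: B res_small_def\<close>)+
  next
    case c: 4
    have fh: "d \<le> f + h" using c by simp
    show ?case
    proof (rule iso_large[OF n0 q_root fd fh em em'], assumption,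
        rule decomp_append4[where q = "e * d" and r = "e * d + (\<gamma> + 1)" and s = "e * d + (h + 1)", OF decomp_blocks], goal_cases)
      case (1 k)
      then have k: "k < e" .
      define P where "P = (e + m - 2 * k) * d"
      note a = A[OF k, folded P_def]
      show ?case
        unfolding a(2) P_def[symmetric]
        by (rule decomp_append4[where q = "k * d + (\<gamma> + 1)" and r = "k * d + (h + 1)" and s = "k * d + (f + 1)"];
            (rule decomp_strings)?; (rule len)?;
            use c fd k a in \<open>simp add: P_def[symmetric] res_large_def \<gamma>\<close>)
    qed ((rule decomp_strings)?; (rule len)?; use c fd C in \<open>simp add: B res_large_def \<gamma>\<close>)+
  qed
qed

end
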